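(* Let $1<p,q<\infty$, let $n,m$ be integers with $0\le n<m<\infty$, let $\omega\in\mathcal{D}$ be a two-sided doubling weight, and let $\upsilon$ be a positive Borel measure on $\mathbb{D}$. Then for all analytic self-maps $\varphi,\psi\in S(\mathbb{D})$ and all $u_n,u_m\in H(\mathbb{D})$, $$\|u_nD_{\varphi}^{(n)}+u_mD_{\psi}^{(m)}\|_{A_\omega^p\to L_\upsilon^q}\approx \|u_nD_{\varphi}^{(n)}\|_{A_\omega^p\to L_\upsilon^q}+\|u_mD_{\psi}^{(m)}\|_{A_\omega^p\to L_\upsilon^q}.$$ Moreover, if $p\le q$ and $u_nD_{\varphi}^{(n)}+u_mD_{\psi}^{(m)}:A_\omega^p\to L_\upsilon^q$ is bounded, then $$\|u_nD_{\varphi}^{(n)}+u_mD_{\psi}^{(m)}\|_{e,A_\omega^p\to L_\upsilon^q}\approx \|u_nD_{\varphi}^{(n)}\|_{e,A_\omega^p\to L_\upsilon^q}+\|u_mD_{\psi}^{(m)}\|_{e,A_\omega^p\to L_\upsilon^q}.$$ Here $X\approx Y$ means that $C^{-1}Y\le X\le CY$ for a constant $C\ge 1$ depending only on $p,q,n,m,\omega$ (in particular not on $\varphi,\psi,u_n,u_m$).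
   Context: $\mathbb{D}=\{z\in\mathbb{C}:|z|<1\}$; $H(\mathbb{D})$ is the space of analytic functions on $\mathbb{D}$; $S(\mathbb{D})$ is the set of analytic maps $\mathbb{D}\to\mathbb{D}$; $dA$ is normalized Lebesgue area measure on $\mathbb{D}$. Radial weights: a nonnegative $\omega\in L^1([0,1])$ is extended to $\mathbb{D}$ by $\omega(z)=\omega(|z|)$ and is called a radial weight. Put $\hat\omega(z)=\int_{|z|}^1\omega(t)\,dt$. Throughout it is assumed that $\hat\omega(z)>0$ for all $z\in\mathbb{D}$. The class $\hat{\mathcal{D}}$ consists of radial weights $\omega$ for which there is a constant $C=C(\omega)\ge 1$ with $\hat\omega(r)\le C\,\hat\omega\left(\frac{1+r}{2}\right)$ for all $0\le r<1$. The class $\mathcal{D}$ of two-sided doubling weights consists of those $\omega\in\hat{\mathcal{D}}$ for which there are constants $K=K(\omega)>1$ and $C=C(\omega)>1$ with $\hat\omega(r)\ge C\,\hat\omega\left(1-\frac{1-r}{K}\right)$ for all $0\le r<1$. Bergman space: $A_\omega^p=\{f\in H(\mathbb{D}):\|f\|_{A_\omega^p}^p=\int_{\mathbb{D}}|f(z)|^p\omega(z)\,dA(z)<\infty\}$. $L_\upsilon^q$ is the Lebesgue space $L^q(\mathbb{D},\upsilon)$. Generalized weighted composition operator: for an integer $k\ge 0$, $\varphi\in S(\mathbb{D})$, $u\in H(\mathbb{D})$, $uD_\varphi^{(k)}f=u\cdot(f^{(k)}\circ\varphi)$ for $f\in H(\mathbb{D})$. Norms: for a linear map $T$ defined on $A_\omega^p$,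 $\|T\|_{A_\omega^p\to L_\upsilon^q}=\sup\{\|Tf\|_{L_\upsilon^q}:\|f\|_{A_\omega^p}\le 1\}\in[0,\infty]$ (value $+\infty$ if $T$ is not bounded into $L_\upsilon^q$). For a bounded operator $T$ from a Banach space $X$ to a Banach space $Y$, the essential norm is $\|T\|_{e,X\to Y}=\inf\{\|T-K\|_{X\to Y}: K:X\to Y \text{ compact}\}$. *)

theory Defs
  imports "HOL-Analysis.Analysis"
begin

definition radial_weight :: "(real \<Rightarrow> real) \<Rightarrow> bool" where
  "radial_weight \<omega> \<longleftrightarrow> (\<forall>t\<in>{0..1}. 0 \<le> \<omega> t) \<and> set_integrable lebesgue {0..1} \<omega>"

definition weight_tail :: "(real \<Rightarrow> real) \<Rightarrow> real \<Rightarrow> real" where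
  "weight_tail \<omega> r = (LINT t:{r..1}|lebesgue. \<omega> t)"

definition upper_doubling :: "(real \<Rightarrow> real) \<Rightarrow> bool" where
  "upper_doubling \<omega> \<longleftrightarrow>
     radial_weight \<omega> \<and> (\<forall>r\<in>{0..<1}. 0 < weight_tail \<omega> r) \<and>
     (\<exists>C\<ge>1. \<forall>r\<in>{0..<1}. weight_tail \<omega> r \<le> C * weight_tail \<omega> ((1 + r) / 2))"

definition two_sided_doubling :: "(real \<Rightarrow> real) \<Rightarrow> bool" where
  "two_sided_doubling \<omega> \<longleftrightarrow>
     upper_doubling \<omega> \<and>
     (\<exists>K>1. \<exists>C>1. \<forall>r\<in>{0..<1}. weight_tail \<omega> r \<ge> C * weight_tail \<omega> (1 - (1 - r) / K))"

text \<open>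
  A function on the disc is represented by a function on all of \<open>\<complex>\<close> whose values off the disc
  are irrelevant, and an element of a Lebesgue space by any of its representatives.
\<close>

definition disc_area :: "complex measure" where
  "disc_area = scale_measure (ennreal (1 / pi)) (lebesgue_on (ball 0 1))"

definition self_map :: "(complex \<Rightarrow> complex) \<Rightarrow> bool" where
  "self_map \<phi> \<longleftrightarrow> \<phi> holomorphic_on ball 0 1 \<and> \<phi> ` ball 0 1 \<subseteq> ball 0 1"

definition borel_measure_on_disc :: "complex measure \<Rightarrow> bool" where
  "borel_measure_on_disc \<upsilon> \<longleftrightarrow> sets \<upsilon> = sets (restrict_space borel (ball 0 1))"

text \<open>The power \<open>x\<^sup>a\<close> for an exponent \<open>a > 0\<close>, so that \<open>\<infinity>\<^sup>a = \<infinity>\<close>.\<close>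

definition ennreal_power :: "ennreal \<Rightarrow> real \<Rightarrow> ennreal" where
  "ennreal_power x a = (if x = top then top else ennreal (enn2real x powr a))"

definition bergman_norm :: "(real \<Rightarrow> real) \<Rightarrow> real \<Rightarrow> (complex \<Rightarrow> complex) \<Rightarrow> ennreal" where
  "bergman_norm \<omega> p f =
     ennreal_power (\<integral>\<^sup>+z. ennreal (cmod (f z) powr p * \<omega> (cmod z)) \<partial>disc_area) (1 / p)"

definition bergman :: "(real \<Rightarrow> real) \<Rightarrow> real \<Rightarrow> (complex \<Rightarrow> complex) set" where
  "bergman \<omega> p = {f. f holomorphic_on ball 0 1 \<and> bergman_norm \<omega> p f < top}"

definition Lq_norm :: "complex measure \<Rightarrow> real \<Rightarrow> (complex \<Rightarrow> complex) \<Rightarrow> ennreal" where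
  "Lq_norm \<upsilon> q g = ennreal_power (\<integral>\<^sup>+z. ennreal (cmod (g z) powr q) \<partial>\<upsilon>) (1 / q)"

definition Lq :: "complex measure \<Rightarrow> real \<Rightarrow> (complex \<Rightarrow> complex) set" where
  "Lq \<upsilon> q = {g \<in> borel_measurable \<upsilon>. Lq_norm \<upsilon> q g < top}"

type_synonym operator = "(complex \<Rightarrow> complex) \<Rightarrow> complex \<Rightarrow> complex"

definition weighted_comp_diff ::
    "(complex \<Rightarrow> complex) \<Rightarrow> (complex \<Rightarrow> complex) \<Rightarrow> nat \<Rightarrow> operator" where
  "weighted_comp_diff u \<phi> k f = (\<lambda>z. u z * (deriv ^^ k) f (\<phi> z))"

definition op_norm :: "(real \<Rightarrow> real) \<Rightarrow> real \<Rightarrow> complex measure \<Rightarrow> real \<Rightarrow> operator \<Rightarrow> ennreal" where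
  "op_norm \<omega> p \<upsilon> q T = (SUP f\<in>{f \<in> bergman \<omega> p. bergman_norm \<omega> p f \<le> 1}. Lq_norm \<upsilon> q (T f))"

text \<open>
  Linearity is up to \<open>\<upsilon>\<close>-null sets. The third condition says that, as an element of the Lebesgue
  space, \<open>T f\<close> depends only on the restriction of \<open>f\<close> to the disc.
\<close>

definition linear_op :: "(real \<Rightarrow> real) \<Rightarrow> real \<Rightarrow> complex measure \<Rightarrow> real \<Rightarrow> operator \<Rightarrow> bool" where
  "linear_op \<omega> p \<upsilon> q T \<longleftrightarrow>
     (\<forall>f\<in>bergman \<omega> p. T f \<in> Lq \<upsilon> q) \<and>
     (\<forall>f\<in>bergman \<omega> p. \<forall>g\<in>bergman \<omega> p. \<forall>a b.
        AE z in \<upsilon>. T (\<lambda>w. a * f w + b * g w) z = a * T f z + b * T g z) \<and>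
     (\<forall>f\<in>bergman \<omega> p. \<forall>g\<in>bergman \<omega> p.
        (\<forall>z\<in>ball 0 1. f z = g z) \<longrightarrow> (AE z in \<upsilon>. T f z = T g z))"

definition bounded_op :: "(real \<Rightarrow> real) \<Rightarrow> real \<Rightarrow> complex measure \<Rightarrow> real \<Rightarrow> operator \<Rightarrow> bool" where
  "bounded_op \<omega> p \<upsilon> q T \<longleftrightarrow>
     linear_op \<omega> p \<upsilon> q T \<and>
     (\<exists>M::real. \<forall>f\<in>bergman \<omega> p. Lq_norm \<upsilon> q (T f) \<le> ennreal M * bergman_norm \<omega> p f)"

text \<open>
  Compactness in sequential form, because \<open>Lq_norm\<close> is only a seminorm on representatives.
\<close>

definition compact_op :: "(real \<Rightarrow> real) \<Rightarrow> real \<Rightarrow> complex measure \<Rightarrow> real \<Rightarrow> operator \<Rightarrow> bool" where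
  "compact_op \<omega> p \<upsilon> q K \<longleftrightarrow>
     linear_op \<omega> p \<upsilon> q K \<and>
     (\<forall>F::nat \<Rightarrow> complex \<Rightarrow> complex.
        (\<forall>j. F j \<in> bergman \<omega> p \<and> bergman_norm \<omega> p (F j) \<le> 1) \<longrightarrow>
        (\<exists>s g. strict_mono s \<and> g \<in> Lq \<upsilon> q \<and>
           (\<lambda>j. Lq_norm \<upsilon> q (\<lambda>z. K (F (s j)) z - g z)) \<longlonglongrightarrow> 0))"

definition essential_norm ::
    "(real \<Rightarrow> real) \<Rightarrow> real \<Rightarrow> complex measure \<Rightarrow> real \<Rightarrow> operator \<Rightarrow> ennreal" where
  "essential_norm \<omega> p \<upsilon> q T =
     (INF K\<in>{K. compact_op \<omega> p \<upsilon> q K}. op_norm \<omega> p \<upsilon> q (\<lambda>f z. T f z - K f z))"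

definition comparable :: "real \<Rightarrow> ennreal \<Rightarrow> ennreal \<Rightarrow> bool" where
  "comparable C X Y \<longleftrightarrow> ennreal (inverse C) * Y \<le> X \<and> X \<le> ennreal C * Y"

end

theory Submission
  imports Defs "HOL-Complex_Analysis.Complex_Analysis"
begin

text \<open>
  Write \<open>A\<close> and \<open>B\<close> for the operators of order \<open>n\<close> and \<open>m\<close>, and \<open>S = A + B\<close>. Everything rests on
  bounding \<open>A\<close> by \<open>S\<close>; the bound for \<open>B = S - A\<close> and the reverse inequality follow from the
  triangle inequality.

  The disc is covered by cells, the cell around a node \<open>a\<close> having diameter comparable with
  \<open>1 - \<bar>a\<bar>\<close>, and the space is tested on atoms, the powers \<open>\<gamma>\<close> of \<open>(1 - \<bar>a\<bar>) / (1 - cnj a * w)\<close>,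
  normalized. Two facts tie the Bergman norm to the nodes. By \<open>synthesis\<close>, a sum of atoms with
  coefficients \<open>d\<^sub>k\<close> has \<open>p\<close>-norm at most a constant times the \<open>\<ell>\<^sup>p\<close> norm of \<open>d\<close>. By \<open>sampling\<close>, the
  suitably scaled suprema of \<open>f\<^sup>(\<^sup>n\<^sup>)\<close> over the cells form a sequence whose \<open>\<ell>\<^sup>p\<close> norm is at most
  a constant times the norm of \<open>f\<close>. Both use only that the measure \<open>\<omega>(\<bar>z\<bar>) dA(z)\<close> is invariant
  under rotations and that its masses on the annuli of a geometric partition grow and decay
  geometrically, which is what two-sided doubling means.

  The orders \<open>n < m\<close> enter through \<open>separation_three_point\<close>. Let \<open>\<phi>(z)\<close> lie in the cell of \<open>k\<close>, and
  let \<open>\<psi>(z)\<close> be arbitrary. For the atoms with exponents \<open>\<gamma>\<close>, \<open>\<gamma> + 1\<close>, \<open>\<gamma> + 2\<close> the values of \<open>S\<close> at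
  \<open>z\<close> are \<open>\<alpha>\<^sub>j t\<^sup>j U + \<beta>\<^sub>j s\<^sup>j V\<close>, with \<open>U\<close> and \<open>V\<close> coming from \<open>A\<close> and \<open>B\<close>. A bounded linear combination
  of the three removes \<open>V\<close>; what is left of \<open>U\<close> is bounded below because the numbers
  \<open>\<alpha>\<^sub>j / \<beta>\<^sub>j\<close> are the moments of a measure on \<open>[0, 1]\<close> (a Beta distribution) that is no point mass.
  Hence \<open>\<bar>A f(z)\<bar>\<close> is dominated by the coefficient of \<open>f\<close> at \<open>k\<close> times the three values of \<open>S\<close>
  on the atoms at \<open>k\<close>; this is \<open>cell_domination\<close>.

  For the operator norm and arbitrary \<open>p\<close>, \<open>q\<close>, the values \<open>d\<^sub>k S(atom\<^sub>k)(z)\<close> at the different nodes must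
  be controlled together. The \<open>q\<close>-th power of each of them is at most the mean over all
  choices of signs of \<open>\<bar>\<Sum> \<plusminus> d\<^sub>k S(atom\<^sub>k)(z)\<bar>\<^sup>q\<close>, by convexity (\<open>sign_sum_average\<close>), and that sum
  is \<open>S\<close> applied to a function whose norm is controlled by synthesis.

  For the essential norm with \<open>p \<le> q\<close>, cutting \<open>A\<close> off to \<open>\<bar>\<phi>(z)\<bar> < R\<close> gives a compact operator
  (\<open>truncation_compact\<close>), so only nodes close to the circle matter. There a compact perturbation
  \<open>K\<close> of \<open>S\<close> is harmless: averages of \<open>N\<close> atoms have norm at most of order \<open>N\<^sup>1\<^sup>/\<^sup>p\<^sup>-\<^sup>1\<close> by synthesis,
  which tends to zero, so \<open>K\<close> cannot stay bounded below on infinitely many atoms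
  (\<open>compact_op_atoms_vanish\<close>). Since \<open>p \<le> q\<close>, the contributions of the nodes may simply be added.
\<close>

section \<open>Rotations and radial functions in the disc\<close>

lemma borel_Complex [measurable]: "(\<lambda>p. Complex (fst p) (snd p)) \<in> borel_measurable (borel \<Otimes>\<^sub>M borel)"
proof -
  have "(\<lambda>p. Complex (fst p) (snd p)) = (\<lambda>p. complex_of_real (fst p) + \<i> * complex_of_real (snd p))"
    by (auto simp: complex_eq_iff)
  thus ?thesis by simp
qed

lemma lborel_complex: "(lborel :: complex measure) = distr (lborel \<Otimes>\<^sub>M lborel) borel (\<lambda>p. Complex (fst p) (snd p))"
proof (rule lborel_eqI)
  fix l u :: complex
  assume le: "\<And>b. b \<in> Basis \<Longrightarrow> l \<bullet> b \<le> u \<bullet> b"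
  hence le': "Re l \<le> Re u" "Im l \<le> Im u" using le[of 1] le[of \<i>] by (auto simp: Basis_complex_def)
  have "(\<lambda>p. Complex (fst p) (snd p)) -` box l u \<inter> space (lborel \<Otimes>\<^sub>M lborel) = {Re l<..<Re u} \<times> {Im l<..<Im u}"
    by (auto simp: box_def Basis_complex_def space_pair_measure)
  moreover have "emeasure (lborel \<Otimes>\<^sub>M lborel) ({Re l<..<Re u} \<times> {Im l<..<Im u}) = ennreal (Re u - Re l) * ennreal (Im u - Im l)"
    by (subst lborel.emeasure_pair_measure_Times) (use le' in auto)
  ultimately show "emeasure (distr (lborel \<Otimes>\<^sub>M lborel) borel (\<lambda>p. Complex (fst p) (snd p))) (box l u) = (\<Prod>b\<in>Basis. (u - l) \<bullet> b)"
    using le' by (subst emeasure_distr) (auto simp: Basis_complex_def ennreal_mult)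
qed simp

lemma nn_integral_complex_iterated:
  assumes [measurable]: "f \<in> borel_measurable borel"
  shows "(\<integral>\<^sup>+z. f z \<partial>lborel) = (\<integral>\<^sup>+x. \<integral>\<^sup>+y. f (Complex x y) \<partial>lborel \<partial>lborel)"
  by (subst lborel_complex) (simp add: nn_integral_distr lborel_pair.nn_integral_snd lborel.nn_integral_fst[symmetric])

text \<open>
  A rotation with real part \<open>a \<noteq> 0\<close> splits into two affine substitutions in one real variable
  each, with Jacobians \<open>1 / \<bar>a\<bar>\<close> and \<open>\<bar>a\<bar>\<close>. For \<open>a = 0\<close> it is a reflection followed by an exchange of the coordinates.
\<close>

lemma nn_integral_lborel_rotate:
  fixes c :: complex
  assumes c: "cmod c = 1" and [measurable]: "f \<in> borel_measurable borel"
  shows "(\<integral>\<^sup>+z. f (c * z) \<partial>lborel) = (\<integral>\<^sup>+z. f z \<partial>lborel)"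
proof -
  define a b where "a = Re c" and "b = Im c"
  have ab: "a^2 + b^2 = 1" using c by (simp add: a_def b_def cmod_def)
  have cmul: "c * Complex x y = Complex (a * x - b * y) (b * x + a * y)" for x y
    by (auto simp: complex_eq_iff a_def b_def)
  have [measurable]: "(\<lambda>p. f (Complex (g p) (h p))) \<in> borel_measurable M"
    if [measurable]: "g \<in> borel_measurable M" "h \<in> borel_measurable M" for g h and M :: "'x measure"
  proof -
    have "(\<lambda>p. (g p, h p)) \<in> M \<rightarrow>\<^sub>M borel \<Otimes>\<^sub>M borel" by measurable
    from measurable_compose[OF this borel_Complex] have "(\<lambda>p. Complex (g p) (h p)) \<in> borel_measurable M" by simp
    thus ?thesis by measurable
  qed
  have "(\<integral>\<^sup>+z. f (c * z) \<partial>lborel) = (\<integral>\<^sup>+x. \<integral>\<^sup>+y. f (Complex (a * x - b * y) (b * x + a * y)) \<partial>lborel \<partial>lborel)"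
    by (subst nn_integral_complex_iterated) (auto simp: cmul)
  also have "\<dots> = (\<integral>\<^sup>+x. \<integral>\<^sup>+y. f (Complex x y) \<partial>lborel \<partial>lborel)"
  proof (cases "a = 0")
    case False
    have "(\<integral>\<^sup>+x. \<integral>\<^sup>+y. f (Complex (a * x - b * y) (b * x + a * y)) \<partial>lborel \<partial>lborel)
      = (\<integral>\<^sup>+x. ennreal \<bar>1/a\<bar> * (\<integral>\<^sup>+y. f (Complex (x/a - b/a * y) y) \<partial>lborel) \<partial>lborel)"
    proof (intro nn_integral_cong)
      fix x :: real
      have "(\<integral>\<^sup>+y. f (Complex (a * x - b * y) (b * x + a * y)) \<partial>lborel) =
         ennreal \<bar>1/a\<bar> * (\<integral>\<^sup>+y. f (Complex (a * x - b * (-b/a*x + 1/a*y)) (b * x + a * (-b/a*x + 1/a*y))) \<partial>lborel)"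
        using False by (intro nn_integral_real_affine) auto
      also have "(\<lambda>y. f (Complex (a * x - b * (-b/a*x + 1/a*y)) (b * x + a * (-b/a*x + 1/a*y)))) = (\<lambda>y. f (Complex (x/a - b/a * y) y))"
      proof
        fix y
        have "a * x - b * (-b/a*x + 1/a*y) = (a^2+b^2)*x/a - b/a*y" using False by (simp add: field_simps power2_eq_square)
        moreover have "b * x + a * (-b/a*x + 1/a*y) = y" using False by (simp add: field_simps)
        ultimately show "f (Complex (a * x - b * (-b/a*x + 1/a*y)) (b * x + a * (-b/a*x + 1/a*y))) = f (Complex (x/a - b/a * y) y)"
          by (simp add: ab)
      qed
      finally show "(\<integral>\<^sup>+y. f (Complex (a * x - b * y) (b * x + a * y)) \<partial>lborel) = ennreal \<bar>1/a\<bar> * (\<integral>\<^sup>+y. f (Complex (x/a - b/a * y) y) \<partial>lborel)" .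
    qed
    also have "\<dots> = ennreal \<bar>1/a\<bar> * (\<integral>\<^sup>+x. \<integral>\<^sup>+y. f (Complex (x/a - b/a * y) y) \<partial>lborel \<partial>lborel)"
      by (rule nn_integral_cmult) measurable
    also have "(\<integral>\<^sup>+x. \<integral>\<^sup>+y. f (Complex (x/a - b/a * y) y) \<partial>lborel \<partial>lborel) = (\<integral>\<^sup>+y. \<integral>\<^sup>+x. f (Complex (x/a - b/a * y) y) \<partial>lborel \<partial>lborel)"
      by (rule lborel_pair.Fubini') measurable
    also have "\<dots> = (\<integral>\<^sup>+y. ennreal \<bar>a\<bar> * (\<integral>\<^sup>+x. f (Complex x y) \<partial>lborel) \<partial>lborel)"
    proof (intro nn_integral_cong)
      fix y :: real
      have "(\<integral>\<^sup>+x. f (Complex (x/a - b/a * y) y) \<partial>lborel) =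
         ennreal \<bar>a\<bar> * (\<integral>\<^sup>+x. f (Complex ((b*y + a*x)/a - b/a * y) y) \<partial>lborel)"
        using False by (intro nn_integral_real_affine) auto
      also have "(\<lambda>x. f (Complex ((b*y + a*x)/a - b/a * y) y)) = (\<lambda>x. f (Complex x y))"
        using False by (auto simp: field_simps)
      finally show "(\<integral>\<^sup>+x. f (Complex (x/a - b/a * y) y) \<partial>lborel) = ennreal \<bar>a\<bar> * (\<integral>\<^sup>+x. f (Complex x y) \<partial>lborel)" .
    qed
    also have "\<dots> = ennreal \<bar>a\<bar> * (\<integral>\<^sup>+y. \<integral>\<^sup>+x. f (Complex x y) \<partial>lborel \<partial>lborel)"
      by (rule nn_integral_cmult) measurable
    also have "(\<integral>\<^sup>+y. \<integral>\<^sup>+x. f (Complex x y) \<partial>lborel \<partial>lborel) = (\<integral>\<^sup>+x. \<integral>\<^sup>+y. f (Complex x y) \<partial>lborel \<partial>lborel)"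
      by (rule lborel_pair.Fubini'[symmetric]) measurable
    finally show ?thesis using False by (simp add: mult.assoc[symmetric] ennreal_mult[symmetric])
  next
    case True
    hence b: "b = 1 \<or> b = -1" using ab by (simp add: power2_eq_1_iff)
    have neg: "(\<integral>\<^sup>+x. g (- x) \<partial>lborel) = (\<integral>\<^sup>+x. g x \<partial>lborel)" if "g \<in> borel_measurable borel" for g :: "real \<Rightarrow> ennreal"
      using nn_integral_real_affine[OF that, of "-1" 0] by simp
    have m: "(\<lambda>x. \<integral>\<^sup>+y. f (Complex y x) \<partial>lborel) \<in> borel_measurable borel" by measurable
    have "(\<integral>\<^sup>+x. \<integral>\<^sup>+y. f (Complex (a * x - b * y) (b * x + a * y)) \<partial>lborel \<partial>lborel)
       = (\<integral>\<^sup>+x. \<integral>\<^sup>+y. f (Complex y x) \<partial>lborel \<partial>lborel)"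
      using b True neg[of "\<lambda>y. f (Complex y _)"] neg[OF m] by (auto)
    also have "\<dots> = (\<integral>\<^sup>+x. \<integral>\<^sup>+y. f (Complex x y) \<partial>lborel \<partial>lborel)"
      by (rule lborel_pair.Fubini'[symmetric]) measurable
    finally show ?thesis .
  qed
  also have "\<dots> = (\<integral>\<^sup>+z. f z \<partial>lborel)"
    by (rule nn_integral_complex_iterated[symmetric]) measurable
  finally show ?thesis .
qed

lemma indicator_disc_measurable [measurable]: "indicator (ball (0::complex) 1) \<in> borel_measurable borel"
  by (rule borel_measurable_indicator) simp

text \<open>
  Two finite measures on the line agree if they agree on all rays, and on rays the assertion is
  the formula for the area of a disc.
\<close>

lemma distr_cmod_disc:
  "distr (density lborel (indicator (ball 0 1))) borel cmod = density lborel (\<lambda>r. ennreal (2 * pi * r * indicator {0..1} r))"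
proof (rule measure_eqI_lessThan)
  fix x :: real
  let ?M = "distr (density lborel (indicator (ball 0 1))) borel cmod"
  have L: "emeasure ?M {x<..} = emeasure lborel (ball 0 1 - cball (0::complex) x)"
  proof -
    have "emeasure ?M {x<..} = emeasure (density lborel (indicator (ball 0 1))) {z. x < cmod z}"
      by (subst emeasure_distr) (auto simp: vimage_def)
    also have "\<dots> = (\<integral>\<^sup>+z. indicator (ball 0 1) z * indicator {z. x < cmod z} z \<partial>lborel)"
      by (subst emeasure_density) auto
    also have "\<dots> = (\<integral>\<^sup>+z. indicator (ball 0 1 - cball (0::complex) x) z \<partial>lborel)"
      by (intro nn_integral_cong) (auto split: split_indicator)
    finally show ?thesis by simp
  qed
  have ballE: "emeasure lborel (ball (0::complex) 1) = ennreal pi"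
    by (simp add: emeasure_ball unit_ball_vol_2)
  have E: "emeasure lborel (ball 0 1 - cball (0::complex) x) = ennreal (pi * (1 - (min 1 (max 0 x))^2))"
  proof -
    consider "x < 0" | "0 \<le> x" "x < 1" | "x \<ge> 1" by linarith
    thus ?thesis
    proof cases
      case 1 thus ?thesis by (simp add: ballE)
    next
      case 2
      have "emeasure lborel (ball 0 1 - cball (0::complex) x) = emeasure lborel (ball (0::complex) 1) - emeasure lborel (cball (0::complex) x)"
        using 2 by (intro emeasure_Diff) (auto simp: emeasure_cball)
      also have "\<dots> = ennreal (pi * (1 - x^2))"
        using 2 by (simp add: emeasure_cball ballE unit_ball_vol_2 ennreal_minus algebra_simps)
      finally show ?thesis using 2 by simp
    next
      case 3
      hence "ball 0 1 - cball (0::complex) x = {}" by auto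
      moreover have "pi * (1 - (min 1 (max 0 x))^2) = 0" using 3 by simp
      ultimately show ?thesis by (simp only: emeasure_empty ennreal_0)
    qed
  qed
  show "emeasure ?M {x<..} < \<infinity>" unfolding L E by simp
  define y where "y = min 1 (max 0 x)"
  have y: "0 \<le> y" "y \<le> 1" by (auto simp: y_def)
  have "emeasure (density lborel (\<lambda>r. ennreal (2 * pi * r * indicator {0..1} r))) {x<..} =
      (\<integral>\<^sup>+r. ennreal (2 * pi * r * indicator {0..1} r) * indicator {x<..} r \<partial>lborel)"
    by (subst emeasure_density) auto
  also have "\<dots> = (\<integral>\<^sup>+r. ennreal (2 * pi * r) * indicator {y..1} r \<partial>lborel)"
  proof (intro nn_integral_cong_AE)
    have "AE r in lborel. r \<noteq> y" by (rule AE_lborel_singleton)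
    moreover have "AE r in lborel. r \<noteq> 1" by (rule AE_lborel_singleton)
    ultimately show "AE r in lborel. ennreal (2 * pi * r * indicator {0..1} r) * indicator {x<..} r = ennreal (2 * pi * r) * indicator {y..1} r"
      by eventually_elim (auto simp: y_def split: split_indicator)
  qed
  also have "\<dots> = ennreal (pi * 1^2 - pi * y^2)"
  proof (rule nn_integral_has_integral_lebesgue')
    show "((\<lambda>r. 2 * pi * r) has_integral pi * 1^2 - pi * y^2) {y..1}"
      using y by (intro fundamental_theorem_of_calculus)
        (auto intro!: derivative_eq_intros simp flip: has_real_derivative_iff_has_vector_derivative)
  qed (use y in auto)
  finally show "emeasure ?M {x<..} = emeasure (density lborel (\<lambda>r. ennreal (2 * pi * r * indicator {0..1} r))) {x<..}"
    unfolding L E by (simp add: y_def algebra_simps)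
qed auto

lemma nn_integral_radial_disc:
  assumes [measurable]: "g \<in> borel_measurable borel"
  shows "(\<integral>\<^sup>+z. g (cmod z) * indicator (ball 0 1) z \<partial>lborel) = (\<integral>\<^sup>+r. g r * ennreal (2 * pi * r * indicator {0..1} r) \<partial>lborel)"
proof -
  have "(\<integral>\<^sup>+z. g (cmod z) * indicator (ball 0 1) z \<partial>lborel) = (\<integral>\<^sup>+r. g r \<partial>distr (density lborel (indicator (ball 0 1))) borel cmod)"
    by (subst nn_integral_distr) (auto simp: nn_integral_density mult.commute)
  also have "\<dots> = (\<integral>\<^sup>+r. g r * ennreal (2 * pi * r * indicator {0..1} r) \<partial>lborel)"
    unfolding distr_cmod_disc by (subst nn_integral_density) (auto simp: mult.commute)
  finally show ?thesis .
qed

section \<open>Finite sums and elementary inequalities\<close>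

definition unit_root :: "nat \<Rightarrow> nat \<Rightarrow> complex" where
  "unit_root N l = cis (2 * pi * real l / real N)"

lemma norm_unit_root [simp]: "cmod (unit_root N l) = 1"
  by (simp add: unit_root_def)

lemma unit_root_power: "unit_root N l ^ k = cis (2 * pi * real (l * k) / real N)"
  by (simp only: unit_root_def Complex.DeMoivre, rule arg_cong[where f = cis]) (simp add: mult_ac)

lemma unit_root_power_N: "N > 0 \<Longrightarrow> unit_root N l ^ N = 1"
  unfolding unit_root_power using cis_multiple_2pi[of "real l"] by (simp add: mult_ac)

lemma cis_eq_1_imp_int: "cis x = 1 \<Longrightarrow> \<exists>n::int. x = 2 * pi * n"
  using cos_one_2pi_int[of x] by (auto simp: complex_eq_iff mult_ac)

lemma sum_unit_root_orthogonal:
  assumes "j < N" "k < N"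
  shows "(\<Sum>l<N. unit_root N l ^ j * cnj (unit_root N l ^ k)) = (if j = k then of_nat N else 0)"
proof -
  define w where "w = cis (2 * pi * (real j - real k) / real N)"
  have N: "N > 0" using assms by simp
  have eq: "unit_root N l ^ j * cnj (unit_root N l ^ k) = w ^ l" for l
    by (simp only: unit_root_power w_def Complex.DeMoivre cis_cnj cis_mult, rule arg_cong[where f = cis])
      (simp add: diff_divide_distrib algebra_simps)
  show ?thesis
  proof (cases "j = k")
    case True thus ?thesis unfolding eq by (simp add: w_def)
  next
    case False
    have "w \<noteq> 1"
    proof
      assume "w = 1"
      then obtain n :: int where "2 * pi * (real j - real k) / real N = 2 * pi * n"
        unfolding w_def using cis_eq_1_imp_int by blast
      hence "2 * pi * ((real j - real k) / real N) = 2 * pi * n" by simp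
      hence "(real j - real k) / real N = n" by (simp only: mult_cancel_left) simp
      hence "real j - real k = real N * n" using N by (simp add: field_simps)
      hence *: "int j - int k = int N * n" by (metis of_int_diff of_int_eq_iff of_int_mult of_int_of_nat_eq)
      hence "n \<noteq> 0" using False by auto
      hence "1 \<le> \<bar>n\<bar>" by simp
      hence "int N \<le> \<bar>int N * n\<bar>" by (simp add: abs_mult mult_le_cancel_left1)
      thus False using * assms by linarith
    qed
    moreover have "w ^ N = 1"
    proof -
      have "w ^ N = cis (2 * pi * of_int (int j - int k))"
        using N by (simp add: w_def Complex.DeMoivre)
      also have "\<dots> = 1" by (rule cis_multiple_2pi) auto
      finally show ?thesis .
    qed
    ultimately have "(\<Sum>l<N. w ^ l) = 0" by (simp add: geometric_sum)
    thus ?thesis using False unfolding eq by simp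
  qed
qed

text \<open>
  With \<open>\<zeta>\<close> an \<open>N\<close>-th root of unity, \<open>1 / (1 - x \<zeta>) = (\<Sum>k<N. x\<^sup>k \<zeta>\<^sup>k) / (1 - x\<^sup>N)\<close>, and the denominator is the
  same for all \<open>\<zeta>\<close>. The sum over \<open>\<zeta>\<close> is therefore given by Parseval's identity on the cyclic
  group of order \<open>N\<close>.
\<close>

lemma sum_inverse_norm_sq_unit_root:
  assumes x: "cmod x < 1" and N: "N > 0"
  shows "(\<Sum>l<N. 1 / (cmod (1 - x * unit_root N l))\<^sup>2) \<le> real N / ((1 - cmod x) * (1 - cmod x ^ N)\<^sup>2)"
proof -
  define S where "S l = (\<Sum>k<N. x ^ k * unit_root N l ^ k)" for l
  have lt: "cmod x ^ N < 1" using x N by (simp add: power_less_one_iff)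
  have ne: "1 - x * unit_root N l \<noteq> 0" for l
    using x by (metis eq_iff_diff_eq_0 mult.right_neutral norm_mult norm_one norm_unit_root order_less_irrefl)
  have S: "S l = (1 - x ^ N) / (1 - x * unit_root N l)" for l
    using ne[of l] by (simp add: S_def sum_gp_strict flip: power_mult_distrib) (simp add: power_mult_distrib unit_root_power_N N)
  have nx: "cmod (1 - x ^ N) \<ge> 1 - cmod x ^ N"
    by (metis norm_one norm_power norm_triangle_ineq2)
  have "1 / (cmod (1 - x * unit_root N l))\<^sup>2 \<le> (cmod (S l))\<^sup>2 / (1 - cmod x ^ N)\<^sup>2" for l
  proof -
    have "(1 - cmod x ^ N)\<^sup>2 \<le> (cmod (1 - x ^ N))\<^sup>2" using nx lt by (intro power_mono) auto
    thus ?thesis using lt ne[of l] by (simp add: S norm_divide power_divide field_simps)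
  qed
  hence "(\<Sum>l<N. 1 / (cmod (1 - x * unit_root N l))\<^sup>2) \<le> (\<Sum>l<N. (cmod (S l))\<^sup>2) / (1 - cmod x ^ N)\<^sup>2"
    by (simp add: sum_divide_distrib sum_mono)
  also have "(\<Sum>l<N. (cmod (S l))\<^sup>2) = real N * (\<Sum>k<N. (cmod x ^ 2) ^ k)"
  proof -
    have "complex_of_real (\<Sum>l<N. (cmod (S l))\<^sup>2) = (\<Sum>l<N. \<Sum>j<N. \<Sum>k<N. (x ^ j * cnj (x ^ k)) * (unit_root N l ^ j * cnj (unit_root N l ^ k)))"
      by (simp only: of_real_sum complex_norm_square S_def cnj_sum sum_product complex_cnj_mult mult_ac)
    also have "\<dots> = (\<Sum>j<N. \<Sum>k<N. (x ^ j * cnj (x ^ k)) * (\<Sum>l<N. unit_root N l ^ j * cnj (unit_root N l ^ k)))"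
      by (simp only: sum_distrib_left) (subst sum.swap, rule sum.cong[OF refl], rule sum.swap)
    also have "\<dots> = (\<Sum>j<N. \<Sum>k<N. if j = k then x ^ j * cnj (x ^ k) * of_nat N else 0)"
      by (intro sum.cong refl) (subst sum_unit_root_orthogonal, auto)
    also have "\<dots> = (\<Sum>j<N. x ^ j * cnj (x ^ j) * of_nat N)" by simp
    also have "\<dots> = complex_of_real (real N * (\<Sum>k<N. (cmod x ^ 2) ^ k))"
    proof -
      have "x ^ j * cnj (x ^ j) = complex_of_real ((cmod x ^ 2) ^ j)" for j
        by (simp only: complex_norm_square[symmetric] norm_power power_mult[symmetric] mult.commute)
      thus ?thesis by (simp only: of_real_sum of_real_mult sum_distrib_left mult_ac of_real_of_nat_eq)
    qed
    finally show ?thesis by (simp only: of_real_eq_iff)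
  qed
  also have "(\<Sum>k<N. (cmod x ^ 2) ^ k) \<le> 1 / (1 - cmod x)"
  proof -
    have "(\<Sum>k<N. (cmod x ^ 2) ^ k) \<le> (\<Sum>k<N. cmod x ^ k)"
      using x by (intro sum_mono power_mono) (auto simp: power2_eq_square mult_left_le_one_le)
    also have "\<dots> = (1 - cmod x ^ N) / (1 - cmod x)" using x by (simp add: sum_gp_strict)
    also have "\<dots> \<le> 1 / (1 - cmod x)" using x by (intro divide_right_mono) auto
    finally show ?thesis .
  qed
  finally show ?thesis
    using lt x N by (simp add: divide_right_mono mult_left_mono)
qed

text \<open>
  At distance at least \<open>1 / N\<close> from the circle the \<open>N\<close> points are dense enough for the sum to have the size
  of the integral of \<open>N / \<bar>1 - x \<zeta>\<bar>\<^sup>2\<close> over the unit circle.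
\<close>

lemma sum_inverse_norm_sq_unit_root':
  assumes N: "N > 0" and x: "cmod x \<le> 1 - 1 / real N"
  shows "(\<Sum>l<N. 1 / (cmod (1 - x * unit_root N l))\<^sup>2) \<le> 4 * real N / (1 - cmod x)"
proof -
  have x1: "cmod x < 1" using x N by (smt (verit) divide_pos_pos of_nat_0_less_iff)
  have "cmod x ^ N \<le> (1 - 1 / real N) ^ N" using x by (intro power_mono) auto
  \<comment> \<open>\<open>(1 - 1/N)\<^sup>N \<le> exp (-1) \<le> 1/2\<close>\<close>
  also have "\<dots> \<le> exp (- (1 / real N)) ^ N"
    using exp_ge_add_one_self[of "- (1 / real N)"] N by (intro power_mono) (auto)
  also have "\<dots> = exp (-1)" using N by (simp flip: exp_of_nat_mult)
  also have "\<dots> \<le> 1/2" using exp_ge_add_one_self[of 1] by (simp add: exp_minus field_simps)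
  finally have h: "1/2 \<le> 1 - cmod x ^ N" by simp
  have "(1/2)\<^sup>2 \<le> (1 - cmod x ^ N)\<^sup>2" by (rule power_mono[OF h]) simp
  hence q: "1/4 \<le> (1 - cmod x ^ N)\<^sup>2" by (simp add: power2_eq_square)
  have "(\<Sum>l<N. 1 / (cmod (1 - x * unit_root N l))\<^sup>2) \<le> real N / ((1 - cmod x) * (1 - cmod x ^ N)\<^sup>2)"
    using x1 N by (rule sum_inverse_norm_sq_unit_root)
  also have "\<dots> \<le> real N / ((1 - cmod x) * (1/4))"
    using x1 q N by (intro divide_left_mono mult_left_mono) (auto intro!: mult_pos_pos simp: zero_less_power2)
  finally show ?thesis by (simp add: mult_ac)
qed

lemma powr_above_tangent:
  fixes x y p :: real
  assumes "p \<ge> 1" "x \<ge> 0" "y > 0"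
  shows "y powr p + p * y powr (p - 1) * (x - y) \<le> x powr p"
proof (cases "x = 0")
  case True
  have "y powr (p - 1) * y = y powr p" using assms by (simp add: powr_mult_base mult.commute)
  hence "y powr p + p * y powr (p - 1) * (0 - y) = (1 - p) * y powr p" by (simp add: algebra_simps)
  also have "\<dots> \<le> 0" using assms by (simp add: mult_nonpos_nonneg)
  finally show ?thesis using True by simp
next
  case False
  have "x powr p - y powr p \<ge> (p * y powr (p - 1)) * (x - y)"
    using assms False
    by (intro convex_on_imp_above_tangent[where A = "{0<..}"] powr_convex)
       (auto intro!: derivative_eq_intros simp: interior_open connected_Ioi)
  thus ?thesis by simp
qed

text \<open>
  Jensen's inequality for the weights \<open>w\<close>, which need not have sum one: sum the tangent inequality at
  the weighted mean.
\<close>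

lemma sum_powr_le:
  fixes p :: real
  assumes "finite K" "p \<ge> 1" "\<And>k. k \<in> K \<Longrightarrow> y k \<ge> 0" "\<And>k. k \<in> K \<Longrightarrow> w k \<ge> 0"
  shows "(\<Sum>k\<in>K. w k * y k) powr p \<le> (\<Sum>k\<in>K. w k) powr (p - 1) * (\<Sum>k\<in>K. w k * y k powr p)"
proof -
  define W where "W = sum w K"
  define s where "s = (\<Sum>k\<in>K. w k * y k)"
  have s0: "s \<ge> 0" unfolding s_def using assms by (intro sum_nonneg) auto
  have W0: "W \<ge> 0" unfolding W_def using assms by (intro sum_nonneg) auto
  have R0: "(\<Sum>k\<in>K. w k * y k powr p) \<ge> 0" using assms by (intro sum_nonneg) auto
  show ?thesis
  proof (cases "s = 0")
    case True thus ?thesis using R0 unfolding s_def by simp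
  next
    case False
    hence s: "s > 0" using s0 by simp
    have W: "W > 0"
    proof (rule ccontr)
      assume "\<not> W > 0"
      hence "W = 0" using W0 by simp
      hence "\<forall>k\<in>K. w k = 0" unfolding W_def using assms by (subst (asm) sum_nonneg_eq_0_iff) auto
      thus False using s unfolding s_def by simp
    qed
    define m where "m = s / W"
    have m: "m > 0" using s W by (simp add: m_def)
    have "(\<Sum>k\<in>K. w k * (m powr p + p * m powr (p - 1) * (y k - m))) \<le> (\<Sum>k\<in>K. w k * y k powr p)"
      using assms m by (intro sum_mono mult_left_mono powr_above_tangent) auto
    also have "(\<Sum>k\<in>K. w k * (m powr p + p * m powr (p - 1) * (y k - m))) =
       (\<Sum>k\<in>K. (m powr p - p * m powr (p - 1) * m) * w k + p * m powr (p - 1) * (w k * y k))"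
      by (intro sum.cong) (auto simp: algebra_simps)
    also have "\<dots> = (m powr p - p * m powr (p - 1) * m) * W + p * m powr (p - 1) * s"
      by (simp add: sum.distrib W_def s_def flip: sum_distrib_left)
    also have "\<dots> = m powr p * W"
      using W by (simp add: m_def algebra_simps)
    finally have "m powr p * W \<le> (\<Sum>k\<in>K. w k * y k powr p)" .
    hence "W powr (p - 1) * (m powr p * W) \<le> W powr (p - 1) * (\<Sum>k\<in>K. w k * y k powr p)"
      by (intro mult_left_mono) auto
    also have "W powr (p - 1) * (m powr p * W) = s powr p"
      using s W by (simp add: m_def powr_divide powr_diff)
    finally show ?thesis by (simp add: s_def W_def)
  qed
qed

lemma norm_sum_powr_le:
  fixes x :: "'a \<Rightarrow> complex"
  assumes "finite K" "p \<ge> 1"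
  shows "cmod (\<Sum>k\<in>K. x k) powr p \<le> real (card K) powr (p - 1) * (\<Sum>k\<in>K. cmod (x k) powr p)"
proof -
  have "cmod (\<Sum>k\<in>K. x k) powr p \<le> (\<Sum>k\<in>K. cmod (x k)) powr p"
    using assms by (intro powr_mono2 norm_sum) auto
  also have "\<dots> \<le> real (card K) powr (p - 1) * (\<Sum>k\<in>K. cmod (x k) powr p)"
    using sum_powr_le[OF assms, of "\<lambda>k. cmod (x k)" "\<lambda>_. 1"] by simp
  finally show ?thesis .
qed

lemma norm_add_powr_le:
  assumes "p \<ge> 1"
  shows "cmod (x + y) powr p \<le> 2 powr (p - 1) * (cmod x powr p + cmod y powr p)"
  using norm_sum_powr_le[of "{True, False}" p "\<lambda>b. if b then x else y"] assms by simp

definition sign_sum :: "'a set \<Rightarrow> ('a \<Rightarrow> complex) \<Rightarrow> 'a set \<Rightarrow> complex" where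
  "sign_sum K x E = (\<Sum>k\<in>K. (if k \<in> E then 1 else -1) * x k)"

lemma sum_Pow_insert:
  fixes h :: "'a set \<Rightarrow> real"
  assumes "finite K" "a \<notin> K"
  shows "(\<Sum>E\<in>Pow (insert a K). h E) = (\<Sum>E\<in>Pow K. h E + h (insert a E))"
proof -
  have "inj_on (insert a) (Pow K)" using assms(2) by (force simp: inj_on_def)
  moreover have "Pow K \<inter> insert a ` Pow K = {}" using assms(2) by auto
  ultimately show ?thesis using assms(1)
    by (simp add: Pow_insert sum.union_disjoint sum.reindex sum.distrib)
qed

lemma sign_sum_insert:
  assumes "finite K" "a \<notin> K" "E \<subseteq> K"
  shows "sign_sum (insert a K) x E = - x a + sign_sum K x E"
        "sign_sum (insert a K) x (insert a E) = x a + sign_sum K x E"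
  using assms by (auto simp: sign_sum_def intro!: sum.cong)

lemma norm_powr_le_symmetric:
  assumes "q \<ge> 1"
  shows "2 * cmod y powr q \<le> cmod (y - x) powr q + cmod (y + x) powr q"
proof -
  have "cmod ((y - x) + (y + x)) powr q \<le> 2 powr (q - 1) * (cmod (y - x) powr q + cmod (y + x) powr q)"
    by (rule norm_add_powr_le[OF assms])
  moreover have "cmod ((y - x) + (y + x)) powr q = 2 powr (q - 1) * (2 * cmod y powr q)"
    by (simp add: norm_mult powr_mult powr_diff)
  ultimately show ?thesis by simp
qed

text \<open>
  Induction on the number of signs: averaging over one more sign replaces \<open>y\<close> by the pair \<open>y \<plusminus> x\<close>,
  whose mean is \<open>y\<close>, and \<open>\<bar>\<cdot>\<bar>\<^sup>q\<close> is convex.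
\<close>

lemma sign_sum_average_shift:
  assumes "finite K" "q \<ge> 1"
  shows "2 ^ card K * cmod y powr q \<le> (\<Sum>E\<in>Pow K. cmod (y + sign_sum K x E) powr q)"
  using assms(1)
proof (induction K arbitrary: y rule: finite_induct)
  case empty thus ?case by (simp add: sign_sum_def)
next
  case (insert a K)
  have "2 ^ card (insert a K) * cmod y powr q \<le> 2 ^ card K * (cmod (y - x a) powr q + cmod (y + x a) powr q)"
    using insert norm_powr_le_symmetric[OF assms(2), of y "x a"] by (simp add: mult_ac)
  also have "\<dots> \<le> (\<Sum>E\<in>Pow K. cmod ((y - x a) + sign_sum K x E) powr q) + (\<Sum>E\<in>Pow K. cmod ((y + x a) + sign_sum K x E) powr q)"
    using insert.IH[of "y - x a"] insert.IH[of "y + x a"] by (simp add: distrib_left)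
  also have "\<dots> = (\<Sum>E\<in>Pow K. cmod (y + sign_sum (insert a K) x E) powr q + cmod (y + sign_sum (insert a K) x (insert a E)) powr q)"
    unfolding sum.distrib[symmetric]
    by (intro sum.cong) (use insert in \<open>auto simp: sign_sum_insert algebra_simps\<close>)
  also have "\<dots> = (\<Sum>E\<in>Pow (insert a K). cmod (y + sign_sum (insert a K) x E) powr q)"
    using insert by (subst sum_Pow_insert) auto
  finally show ?case .
qed

text \<open>
  Averaging over the signs of all other terms leaves \<open>\<plusminus> x k\<close>. This elementary bound takes the
  place of Khinchine's inequality, because only one node at a time has to be detected.
\<close>

lemma sign_sum_average:
  assumes "finite K" "q \<ge> 1" "k \<in> K"
  shows "cmod (x k) powr q \<le> (\<Sum>E\<in>Pow K. cmod (sign_sum K x E) powr q) / 2 ^ card K"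
proof -
  define K' where "K' = K - {k}"
  have K: "K = insert k K'" "k \<notin> K'" "finite K'" using assms by (auto simp: K'_def)
  have "2 ^ card K * cmod (x k) powr q = 2 ^ card K' * cmod (- x k) powr q + 2 ^ card K' * cmod (x k) powr q"
    using K by simp
  also have "\<dots> \<le> (\<Sum>E\<in>Pow K'. cmod (- x k + sign_sum K' x E) powr q) + (\<Sum>E\<in>Pow K'. cmod (x k + sign_sum K' x E) powr q)"
    using K assms by (intro add_mono sign_sum_average_shift) auto
  also have "\<dots> = (\<Sum>E\<in>Pow K'. cmod (sign_sum K x E) powr q + cmod (sign_sum K x (insert k E)) powr q)"
    unfolding sum.distrib[symmetric] K(1)
    by (intro sum.cong) (use K in \<open>auto simp: sign_sum_insert\<close>)
  also have "\<dots> = (\<Sum>E\<in>Pow K. cmod (sign_sum K x E) powr q)"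
    unfolding K(1) using K by (subst sum_Pow_insert) auto
  finally show ?thesis by (simp add: field_simps)
qed

text \<open>
  The coefficients \<open>c0\<close>, \<open>c1\<close>, \<open>c2\<close>, multiplied by \<open>\<beta>\<close>, are those of the polynomial
  \<open>(X - s) (X cnj t / t - cnj s)\<close>. It vanishes at \<open>s\<close>, which removes \<open>V\<close>. If \<open>Q j\<close> is the \<open>j\<close>-th moment of
  a measure \<open>\<nu>\<close>, then \<open>U\<close> is left with the factor \<open>R\<close>, the integral of \<open>\<bar>t x - s\<bar>\<^sup>2\<close> against \<open>\<nu>\<close>. Completing the
  square bounds it from below by \<open>\<bar>t\<bar>\<^sup>2\<close> times the variance of \<open>\<nu>\<close>, whatever \<open>s\<close> is.
\<close>

lemma separation_three_point:
  fixes U V s t :: complex and \<alpha> \<beta> :: "nat \<Rightarrow> real"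
  assumes pos: "\<alpha> 0 > 0" "\<beta> 0 \<ge> 1" "\<beta> 1 \<ge> 1" "\<beta> 2 \<ge> 1"
    and st: "t \<noteq> 0" "cmod s \<le> 1"
  defines "Q \<equiv> \<lambda>j. \<alpha> j / \<beta> j"
  defines "x \<equiv> \<lambda>j. \<alpha> j * t ^ j * U + \<beta> j * s ^ j * V"
  shows "cmod U * (cmod t)\<^sup>2 * (Q 2 - (Q 1)\<^sup>2 / Q 0) \<le> 2 * (cmod (x 0) + cmod (x 1) + cmod (x 2))"
proof -
  define c0 where "c0 = s * cnj s / \<beta> 0"
  define c1 where "c1 = - (cnj s + s * (cnj t / t)) / \<beta> 1"
  define c2 where "c2 = cnj t / t / \<beta> 2"
  define R where "R = (cmod s)\<^sup>2 * Q 0 - 2 * Re (cnj s * t) * Q 1 + (cmod t)\<^sup>2 * Q 2"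
  have Q0: "Q 0 > 0" using pos by (simp add: Q_def)
  have b: "\<beta> 0 \<noteq> 0" "\<beta> 1 \<noteq> 0" "\<beta> 2 \<noteq> 0" using pos by auto
  have "c0 * x 0 + c1 * x 1 + c2 * x 2 = U * (s * cnj s * Q 0 - (cnj s * t + s * cnj t) * Q 1 + t * cnj t * Q 2)"
    using b st by (simp add: c0_def c1_def c2_def x_def Q_def field_simps power2_eq_square)
  also have "s * cnj s * Q 0 - (cnj s * t + s * cnj t) * Q 1 + t * cnj t * Q 2 = of_real R"
  proof -
    have cc: "cnj s * t + s * cnj t = complex_of_real (2 * Re (cnj s * t))"
      using complex_add_cnj[of "cnj s * t"] by (simp only: complex_cnj_mult complex_cnj_cnj)
    show ?thesis by (simp only: R_def cc of_real_add of_real_diff of_real_mult complex_norm_square)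
  qed
  finally have "cmod U * \<bar>R\<bar> = cmod (c0 * x 0 + c1 * x 1 + c2 * x 2)" by (simp add: norm_mult)
  also have "\<dots> \<le> cmod (c0 * x 0) + cmod (c1 * x 1) + cmod (c2 * x 2)"
    using norm_triangle_ineq[of "c0 * x 0 + c1 * x 1" "c2 * x 2"] norm_triangle_ineq[of "c0 * x 0" "c1 * x 1"] by simp
  also have "\<dots> \<le> 2 * cmod (x 0) + 2 * cmod (x 1) + 2 * cmod (x 2)"
  proof -
    have "cmod c0 \<le> 2"
    proof -
      have "cmod s * cmod s \<le> 1 * 1" using st by (intro mult_mono) auto
      hence "cmod s * cmod s \<le> 2 * \<beta> 0" using pos by linarith
      thus ?thesis using pos by (simp add: c0_def norm_mult norm_divide field_simps)
    qed
    moreover have "cmod c1 \<le> 2"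
    proof -
      have "cmod (cnj s + s * (cnj t / t)) \<le> cmod (cnj s) + cmod (s * (cnj t / t))" by (rule norm_triangle_ineq)
      also have "\<dots> \<le> 2" using st by (simp add: norm_mult norm_divide)
      also have "\<dots> \<le> 2 * \<beta> 1" using pos by simp
      finally have "cmod (cnj s + s * (cnj t / t)) \<le> 2 * \<beta> 1" .
      thus ?thesis using pos unfolding c1_def norm_divide norm_minus_cancel by (simp add: field_simps)
    qed
    moreover have "cmod c2 \<le> 2"
    proof -
      have "cmod c2 = 1 / \<beta> 2" using pos st by (simp add: c2_def norm_divide norm_mult)
      moreover have "1 / \<beta> 2 \<le> 1" using pos by simp
      ultimately show ?thesis by linarith
    qed
    ultimately show ?thesis unfolding norm_mult by (intro add_mono mult_right_mono) auto
  qed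
  finally have 1: "cmod U * \<bar>R\<bar> \<le> 2 * (cmod (x 0) + cmod (x 1) + cmod (x 2))" by simp
  have "(cmod t)\<^sup>2 * (Q 2 - (Q 1)\<^sup>2 / Q 0) \<le> R"
  proof -
    have "\<bar>Re (cnj s * t)\<bar> \<le> cmod s * cmod t"
      using abs_Re_le_cmod[of "cnj s * t"] by (simp add: norm_mult)
    hence "2 * Re (cnj s * t) * Q 1 \<le> 2 * (cmod s * cmod t) * \<bar>Q 1\<bar>"
    proof -
      have "Re (cnj s * t) * Q 1 \<le> \<bar>Re (cnj s * t)\<bar> * \<bar>Q 1\<bar>"
        by (metis abs_ge_self abs_mult)
      also have "\<dots> \<le> (cmod s * cmod t) * \<bar>Q 1\<bar>"
        using \<open>\<bar>Re (cnj s * t)\<bar> \<le> cmod s * cmod t\<close> by (rule mult_right_mono) simp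
      finally show ?thesis using mult_left_mono[of "Re (cnj s * t) * Q 1" "cmod s * cmod t * \<bar>Q 1\<bar>" 2]
        by (simp only: mult.assoc)
    qed
    moreover have "0 \<le> (cmod s * Q 0 - cmod t * \<bar>Q 1\<bar>)\<^sup>2 / Q 0" using Q0 by simp
    moreover have "(cmod s * Q 0 - cmod t * \<bar>Q 1\<bar>)\<^sup>2 / Q 0 = (cmod s)\<^sup>2 * Q 0 - 2 * (cmod s * cmod t) * \<bar>Q 1\<bar> + (cmod t)\<^sup>2 * ((Q 1)\<^sup>2 / Q 0)"
      using Q0 by (simp add: power2_eq_square field_simps)
    ultimately show ?thesis unfolding R_def by (simp add: algebra_simps)
  qed
  hence "cmod U * ((cmod t)\<^sup>2 * (Q 2 - (Q 1)\<^sup>2 / Q 0)) \<le> cmod U * \<bar>R\<bar>"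
    by (intro mult_left_mono) auto
  with 1 show ?thesis by (simp add: mult.assoc)
qed

text \<open>
  Strictness in the Cauchy-Schwarz inequality for the moments \<open>Q j\<close>, which says that \<open>Q (j + 1) / Q j\<close>
  increases. Here this quotient is \<open>(a + j + n) / (a + j + m)\<close>, and \<open>n < m\<close> makes it strictly
  increasing.
\<close>

lemma pochhammer_ratio_strict:
  fixes a :: real
  assumes a: "a > 0" and nm: "n < m"
  defines "Q \<equiv> \<lambda>j::nat. pochhammer (a + real j) n / pochhammer (a + real j) m"
  shows "Q 2 - (Q 1)\<^sup>2 / Q 0 > 0"
proof -
  have pos: "pochhammer (a + real j) k > 0" for j k using a by (intro pochhammer_pos) auto
  have step: "Q (Suc j) = Q j * ((a + real j + real n) / (a + real j + real m))" for j
  proof -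
    have *: "pochhammer (a + real (Suc j)) k = pochhammer (a + real j) k * (a + real j + real k) / (a + real j)" for k
    proof -
      have "(a + real j) * pochhammer (a + real j + 1) k = pochhammer (a + real j) k * (a + real j + real k)"
        using pochhammer_rec[of "a + real j" k] pochhammer_Suc[of "a + real j" k] by simp
      thus ?thesis using a by (simp add: field_simps)
    qed
    have frac: "(x * X / A) / (y * Y / A) = x / y * (X / Y)" if "A \<noteq> 0" for x y X Y A :: real
      using that by (simp add: field_simps)
    show ?thesis unfolding Q_def * using a by (intro frac) auto
  qed
  define f where "f j = (a + real j + real n) / (a + real j + real m)" for j :: nat
  have Q0: "Q 0 > 0" using pos[of 0 n] pos[of 0 m] by (simp add: Q_def)
  have Q1: "Q 1 = Q 0 * f 0" using step[of 0] by (simp add: f_def)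
  have Q2: "Q 2 = Q 0 * f 0 * f 1" using step[of 1] Q1 by (simp add: f_def numeral_2_eq_2)
  have "f 0 < f 1" using a nm by (simp add: f_def field_simps)
  moreover have "f 0 > 0" using a by (simp add: f_def)
  ultimately have "Q 0 * f 0 * (f 1 - f 0) > 0" using Q0 by simp
  moreover have "Q 2 - (Q 1)\<^sup>2 / Q 0 = Q 0 * f 0 * (f 1 - f 0)"
    using Q0 unfolding Q1 Q2 by (simp add: power2_eq_square field_simps)
  ultimately show ?thesis by simp
qed

text \<open>
  Cauchy's formula for \<open>h \<zeta> (\<rho>\<^sup>2 - \<bar>w\<bar>\<^sup>2) / (\<rho>\<^sup>2 - cnj w \<zeta>)\<close>, a holomorphic function that agrees with \<open>h\<close> at \<open>w\<close>.
  On the circle of radius \<open>\<rho>\<close> its Cauchy kernel becomes the Poisson kernel, since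
  \<open>\<rho>\<^sup>2 - cnj w \<zeta> = \<zeta> cnj (\<zeta> - w)\<close> there.
\<close>

lemma poisson_formula:
  assumes h: "h holomorphic_on ball 0 1" and \<rho>: "\<rho> < 1" and w: "cmod w < \<rho>"
  defines "e \<equiv> \<lambda>t. complex_of_real \<rho> * exp (2 * of_real pi * \<i> * of_real t)"
  shows "((\<lambda>t. h (e t) * of_real ((\<rho>\<^sup>2 - (cmod w)\<^sup>2) / (cmod (e t - w))\<^sup>2)) has_integral h w) {0..1}"
proof -
  have \<rho>0: "\<rho> > 0" using w norm_ge_zero[of w] by linarith
  have ce: "cmod (e t) = \<rho>" for t using \<rho>0 by (simp add: e_def norm_mult)
  define g where "g \<zeta> = h \<zeta> * of_real (\<rho>\<^sup>2 - (cmod w)\<^sup>2) / (of_real (\<rho>\<^sup>2) - cnj w * \<zeta>)" for \<zeta>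
  have ne: "complex_of_real (\<rho>\<^sup>2) - cnj w * \<zeta> \<noteq> 0" if "cmod \<zeta> \<le> \<rho>" for \<zeta>
  proof
    assume "complex_of_real (\<rho>\<^sup>2) - cnj w * \<zeta> = 0"
    hence "complex_of_real (\<rho>\<^sup>2) = cnj w * \<zeta>" by simp
    hence "cmod (complex_of_real (\<rho>\<^sup>2)) = cmod w * cmod \<zeta>" by (metis complex_mod_cnj norm_mult)
    hence "\<rho>\<^sup>2 = cmod w * cmod \<zeta>" using norm_of_real[of "\<rho>\<^sup>2", where 'a=complex] by simp
    moreover have "cmod w * cmod \<zeta> \<le> cmod w * \<rho>" using that by (intro mult_left_mono) auto
    moreover have "cmod w * \<rho> < \<rho> * \<rho>" using w \<rho>0 by simp
    ultimately show False by (simp add: power2_eq_square)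
  qed
  have sub: "cball 0 \<rho> \<subseteq> ball (0::complex) 1" using \<rho> by auto
  have g: "g holomorphic_on cball 0 \<rho>"
    unfolding g_def using ne by (intro holomorphic_intros holomorphic_on_subset[OF h sub]) (auto simp: power2_eq_square)
  have "((\<lambda>u. g u / (u - w)) has_contour_integral (2 * of_real pi * \<i> * g w)) (circlepath 0 \<rho>)"
    using g w by (intro Cauchy_integral_circlepath holomorphic_on_imp_continuous_on)
      (auto intro: holomorphic_on_subset simp: dist_norm)
  moreover have "g w = h w"
  proof -
    have "complex_of_real (\<rho>\<^sup>2) - cnj w * w = complex_of_real (\<rho>\<^sup>2 - (cmod w)\<^sup>2)"
      by (simp only: of_real_diff complex_norm_square mult.commute)
    thus ?thesis unfolding g_def using ne[of w] w by simp
  qed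
  ultimately have "((\<lambda>t. g (circlepath 0 \<rho> t) / (circlepath 0 \<rho> t - w) * vector_derivative (circlepath 0 \<rho>) (at t within {0..1}))
      has_integral (2 * of_real pi * \<i> * h w)) {0..1}"
    by (simp only: has_contour_integral_def)
  also have "?this \<longleftrightarrow> ((\<lambda>t. g (e t) / (e t - w) * (2 * pi * \<i> * e t)) has_integral (2 * of_real pi * \<i> * h w)) {0..1}"
    by (intro has_integral_cong) (simp add: vector_derivative_circlepath01, simp add: circlepath e_def)
  finally have "((\<lambda>t. g (e t) / (e t - w) * (2 * pi * \<i> * e t)) has_integral (2 * of_real pi * \<i> * h w)) {0..1}" .
  hence "((\<lambda>t. (1 / (2 * pi * \<i>)) * (g (e t) / (e t - w) * (2 * pi * \<i> * e t))) has_integral (1 / (2 * pi * \<i>)) * (2 * of_real pi * \<i> * h w)) {0..1}"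
    by (rule has_integral_mult_right)
  also have "(1 / (2 * pi * \<i>)) * (2 * of_real pi * \<i> * h w) = h w" by simp
  also have "(\<lambda>t. (1 / (2 * pi * \<i>)) * (g (e t) / (e t - w) * (2 * pi * \<i> * e t))) = (\<lambda>t. h (e t) * of_real ((\<rho>\<^sup>2 - (cmod w)\<^sup>2) / (cmod (e t - w))\<^sup>2))"
  proof
    fix t
    have ew: "e t - w \<noteq> 0" using ce[of t] w by auto
    have "complex_of_real (\<rho>\<^sup>2) - cnj w * e t = e t * cnj (e t - w)"
      using ce[of t] by (simp add: algebra_simps complex_norm_square[symmetric] flip: of_real_power)
    hence "g (e t) / (e t - w) * e t = h (e t) * of_real (\<rho>\<^sup>2 - (cmod w)\<^sup>2) / ((e t - w) * cnj (e t - w))"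
    proof -
      have frac: "x / (y * c) / d * y = x / (d * c)" if "y \<noteq> 0" for x y c d :: complex
        using that by simp
      have "e t \<noteq> 0" using ce[of t] \<rho>0 by auto
      with \<open>complex_of_real (\<rho>\<^sup>2) - cnj w * e t = e t * cnj (e t - w)\<close> show ?thesis
        unfolding g_def by (simp only:) (rule frac)
    qed
    also have "\<dots> = h (e t) * of_real ((\<rho>\<^sup>2 - (cmod w)\<^sup>2) / (cmod (e t - w))\<^sup>2)"
      by (simp only: complex_norm_square of_real_divide times_divide_eq_right)
    finally have "g (e t) / (e t - w) * e t = h (e t) * of_real ((\<rho>\<^sup>2 - (cmod w)\<^sup>2) / (cmod (e t - w))\<^sup>2)" .
    moreover have "(1 / c) * (X * (c * y)) = X * y" if "c \<noteq> 0" for c X y :: complex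
      using that by simp
    hence "(1 / (2 * pi * \<i>)) * (g (e t) / (e t - w) * (2 * pi * \<i> * e t)) = g (e t) / (e t - w) * e t"
      by this simp
    ultimately show "(1 / (2 * pi * \<i>)) * (g (e t) / (e t - w) * (2 * pi * \<i> * e t)) = h (e t) * of_real ((\<rho>\<^sup>2 - (cmod w)\<^sup>2) / (cmod (e t - w))\<^sup>2)"
      by (rule trans[rotated])
  qed
  finally show ?thesis .
qed

section \<open>From two-sided doubling to a rotation-invariant measure\<close>

definition annulus :: "nat \<Rightarrow> nat \<Rightarrow> complex set" where
  "annulus \<kappa> j = {z. 1 - 1 / real \<kappa> ^ j \<le> cmod z \<and> cmod z < 1 - 1 / real \<kappa> ^ Suc j}"

definition disc_power_integral :: "complex measure \<Rightarrow> real \<Rightarrow> (complex \<Rightarrow> complex) \<Rightarrow> ennreal" where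
  "disc_power_integral \<mu> p f = (\<integral>\<^sup>+z. ennreal (cmod (f z) powr p) * indicator (ball 0 1) z \<partial>\<mu>)"

text \<open>
  What the estimates need of the weight. The number \<open>V j\<close> stands for a multiple of the tail of the weight
  at radius \<open>1 - \<kappa>\<^sup>-\<^sup>j\<close>. The lower bound concerns the annulus of index \<open>i + 2\<close>, two steps further out,
  because values of a function on annulus \<open>i\<close> and slightly beyond it are estimated through circles in that annulus.
\<close>

locale disc_weight =
  fixes \<mu> :: "complex measure" and \<kappa> :: nat and V :: "nat \<Rightarrow> real" and \<sigma> D c :: real
  assumes sets_mu [measurable_cong]: "sets \<mu> = sets borel"
    and kappa: "4 \<le> \<kappa>"
    and V_pos: "\<And>i. 0 < V i"
    and V_decay: "\<And>i. V (Suc i) \<le> \<sigma>\<^sup>2 * V i"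
    and V_doubling: "\<And>i. V i \<le> D * V (Suc i)"
    and sigma: "0 < \<sigma>" "\<sigma> < 1" and c_pos: "0 < c"
    and rotation: "\<And>a f. cmod a = 1 \<Longrightarrow> f \<in> borel_measurable borel \<Longrightarrow> (\<integral>\<^sup>+z. f (a * z) \<partial>\<mu>) = (\<integral>\<^sup>+z. f z \<partial>\<mu>)"
    and annulus_upper: "\<And>j. emeasure \<mu> (annulus \<kappa> j) \<le> ennreal (V j)"
    and annulus_lower: "\<And>i. ennreal (c * V i) \<le> emeasure \<mu> (annulus \<kappa> (i + 2))"
    and outside: "emeasure \<mu> (- ball 0 1) = 0"

lemma annulus_borel [measurable]: "annulus \<kappa> j \<in> sets borel"
  unfolding annulus_def by measurable

lemma borel_on_ball:
  assumes "f holomorphic_on ball 0 1"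
  shows "(\<lambda>z. f z * indicator (ball 0 1) z) \<in> borel_measurable borel"
proof -
  have "(\<lambda>z. indicator (ball 0 1) z *\<^sub>R f z) \<in> borel_measurable borel"
    using assms by (intro borel_measurable_continuous_on_indicator holomorphic_on_imp_continuous_on) auto
  also have "(\<lambda>z. indicator (ball 0 1) z *\<^sub>R f z) = (\<lambda>z. f z * indicator (ball 0 1) z)"
    by (auto split: split_indicator)
  finally show ?thesis .
qed

text \<open>
  Null sets of radii give null sets of points, so that a weight may be changed on a null set
  of radii.
\<close>

lemma AE_lborel_cmod:
  assumes "AE r in lborel. P r"
  shows "AE z in lborel. z \<in> ball 0 1 \<longrightarrow> P (cmod z)"
proof -
  from assms obtain N where N: "N \<in> null_sets lborel" "{r. \<not> P r} \<subseteq> N"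
    by (auto elim!: AE_E simp: null_sets_def)
  have [measurable]: "N \<in> sets borel" using N by auto
  have "(\<integral>\<^sup>+z. indicator N (cmod z) * indicator (ball 0 1) z \<partial>lborel)
      = (\<integral>\<^sup>+r. indicator N r * ennreal (2 * pi * r * indicator {0..1} r) \<partial>lborel)"
    by (rule nn_integral_radial_disc) measurable
  also have "\<dots> = (\<integral>\<^sup>+r. 0 \<partial>(lborel :: real measure))"
    using AE_not_in[OF N(1)] by (intro nn_integral_cong_AE) (auto elim!: eventually_mono)
  finally have "(\<integral>\<^sup>+z. indicator N (cmod z) * indicator (ball 0 1) z \<partial>lborel) = 0" by simp
  hence "AE z in lborel. (indicator N (cmod z) * indicator (ball 0 1) z :: ennreal) = 0"
    by (subst (asm) nn_integral_0_iff_AE) auto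
  thus ?thesis using N(2) by (auto elim!: eventually_mono split: split_indicator_asm)
qed

text \<open>
  A Lebesgue measurable weight is replaced by a Borel function, because rotations and passing to the
  modulus preserve Borel measurability.
\<close>

lemma weight_borel_version:
  assumes "radial_weight \<omega>"
  obtains w :: "real \<Rightarrow> real" where "w \<in> borel_measurable borel" "\<And>r. 0 \<le> w r"
    "AE r in lborel. r \<in> {0..1} \<longrightarrow> \<omega> r = w r"
    "\<And>r. 0 \<le> r \<Longrightarrow> r \<le> 1 \<Longrightarrow> (\<integral>\<^sup>+t. ennreal (w t) * indicator {r..1} t \<partial>lborel) = ennreal (weight_tail \<omega> r)"
proof -
  have pos: "\<And>t. t \<in> {0..1} \<Longrightarrow> 0 \<le> \<omega> t" and int: "set_integrable lebesgue {0..1} \<omega>"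
    using assms by (auto simp: radial_weight_def)
  have "(\<lambda>x. indicator {0..1} x *\<^sub>R \<omega> x) \<in> borel_measurable lebesgue"
    using int unfolding set_integrable_def by (rule borel_measurable_integrable)
  from completion_ex_borel_measurable_real[OF this]
  obtain w0 where w0 [measurable]: "w0 \<in> borel_measurable borel" and ae: "AE x in lborel. indicator {0..1} x *\<^sub>R \<omega> x = w0 x"
    by auto
  define w where "w x = max 0 (w0 x)" for x
  have [measurable]: "w \<in> borel_measurable borel" unfolding w_def by measurable
  have ae2: "AE r in lborel. r \<in> {0..1} \<longrightarrow> \<omega> r = w r"
    using ae
  proof eventually_elim
    case (elim x) thus ?case using pos[of x] by (auto simp: w_def max_def)
  qed
  have "(\<integral>\<^sup>+t. ennreal (w t) * indicator {r..1} t \<partial>lborel) = ennreal (weight_tail \<omega> r)" if "0 \<le> r" "r \<le> 1" for r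
  proof -
    have "set_integrable lebesgue {r..1} \<omega>" by (rule set_integrable_subset[OF int]) (use that in auto)
    hence i: "integrable lebesgue (\<lambda>t. indicator {r..1} t *\<^sub>R \<omega> t)" by (simp add: set_integrable_def)
    have "ennreal (weight_tail \<omega> r) = (\<integral>\<^sup>+t. ennreal (indicator {r..1} t *\<^sub>R \<omega> t) \<partial>lebesgue)"
      unfolding weight_tail_def set_lebesgue_integral_def
      using that pos by (intro nn_integral_eq_integral[OF i, symmetric]) (auto split: split_indicator)
    also have "\<dots> = (\<integral>\<^sup>+t. ennreal (indicator {r..1} t *\<^sub>R \<omega> t) \<partial>lborel)"
      by (rule nn_integral_completion)
    also have "\<dots> = (\<integral>\<^sup>+t. ennreal (w t) * indicator {r..1} t \<partial>lborel)"
      using ae2 by (intro nn_integral_cong_AE, eventually_elim) (use that in \<open>auto split: split_indicator\<close>)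
    finally show ?thesis by simp
  qed
  thus ?thesis using that[of w] ae2 by (auto simp: w_def)
qed

lemma upper_doubling_power:
  assumes C: "\<And>r. 0 \<le> r \<Longrightarrow> r < 1 \<Longrightarrow> weight_tail \<omega> r \<le> C * weight_tail \<omega> ((1 + r) / 2)" "C \<ge> 1"
    and r: "0 \<le> r" "r < 1"
  shows "weight_tail \<omega> r \<le> C ^ s * weight_tail \<omega> (1 - (1 - r) / 2 ^ s)"
proof (induction s)
  case (Suc s)
  have "(1 - r) / 2 ^ s \<le> 1" using r by (simp add: divide_le_eq) (smt (verit) two_realpow_ge_one)
  hence "weight_tail \<omega> (1 - (1 - r) / 2 ^ s) \<le> C * weight_tail \<omega> ((1 + (1 - (1 - r) / 2 ^ s)) / 2)"
    using r by (intro C) auto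
  also have "(1 + (1 - (1 - r) / 2 ^ s)) / 2 = 1 - (1 - r) / 2 ^ Suc s" by (simp add: field_simps)
  finally have "C ^ s * weight_tail \<omega> (1 - (1 - r) / 2 ^ s) \<le> C ^ s * (C * weight_tail \<omega> (1 - (1 - r) / 2 ^ Suc s))"
    using C(2) by (intro mult_left_mono) auto
  with Suc have "weight_tail \<omega> r \<le> C ^ s * (C * weight_tail \<omega> (1 - (1 - r) / 2 ^ Suc s))" by linarith
  thus ?case by (simp only: power_Suc mult_ac)
qed simp

text \<open>
  The ratio \<open>\<kappa>\<close> of the annuli is a power of two that exceeds the constant \<open>K\<close> of the lower doubling
  condition, so that passing to the next annulus costs a bounded factor and gains a definite one.
  The mass of an annulus is the difference of two consecutive tails, up to the factor \<open>2 r\<close>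
  from the area element. In the annuli of index at least two this factor is at least one.
\<close>

theorem disc_weight_exists:
  assumes "two_sided_doubling \<omega>"
  obtains \<mu> \<kappa> V \<sigma> D c where "disc_weight \<mu> \<kappa> V \<sigma> D c"
    "\<And>p f. f holomorphic_on ball 0 1 \<Longrightarrow> bergman_norm \<omega> p f = ennreal_power (disc_power_integral \<mu> p f) (1 / p)"
proof -
  define T where "T = weight_tail \<omega>"
  from assms have ud: "upper_doubling \<omega>" by (simp add: two_sided_doubling_def)
  hence rw: "radial_weight \<omega>" and Tpos: "\<And>r. 0 \<le> r \<Longrightarrow> r < 1 \<Longrightarrow> 0 < T r"
    by (auto simp: upper_doubling_def T_def)
  from ud obtain C1 where C1: "C1 \<ge> 1" "\<And>r. 0 \<le> r \<Longrightarrow> r < 1 \<Longrightarrow> T r \<le> C1 * T ((1 + r) / 2)"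
    by (auto simp: upper_doubling_def T_def)
  from assms obtain K C where K: "K > 1" and C: "C > 1" "\<And>r. 0 \<le> r \<Longrightarrow> r < 1 \<Longrightarrow> T r \<ge> C * T (1 - (1 - r) / K)"
    by (auto simp: two_sided_doubling_def T_def)
  obtain w where w [measurable]: "w \<in> borel_measurable borel" and w0: "\<And>r. 0 \<le> w r"
    and wae: "AE r in lborel. r \<in> {0..1} \<longrightarrow> \<omega> r = w r"
    and wT: "\<And>r. 0 \<le> r \<Longrightarrow> r \<le> 1 \<Longrightarrow> (\<integral>\<^sup>+t. ennreal (w t) * indicator {r..1} t \<partial>lborel) = ennreal (T r)"
    unfolding T_def by (rule weight_borel_version[OF rw]) blast
  have T1: "T r \<ge> 0" if "0 \<le> r" "r \<le> 1" for r
    unfolding T_def weight_tail_def set_lebesgue_integral_def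
    using rw that by (intro Bochner_Integration.integral_nonneg) (auto simp: radial_weight_def split: split_indicator)
  have Tdiff: "(\<integral>\<^sup>+t. ennreal (w t) * indicator {r..<s} t \<partial>lborel) = ennreal (T r - T s)" and Tmono: "T s \<le> T r"
    if rs: "0 \<le> r" "r \<le> s" "s \<le> 1" for r s
  proof -
    have "ennreal (T r) = (\<integral>\<^sup>+t. ennreal (w t) * indicator {r..<s} t + ennreal (w t) * indicator {s..1} t \<partial>lborel)"
      unfolding wT[of r, symmetric, OF rs(1) order.trans[OF rs(2,3)]]
      by (intro nn_integral_cong) (use rs in \<open>auto split: split_indicator\<close>)
    also have "\<dots> = (\<integral>\<^sup>+t. ennreal (w t) * indicator {r..<s} t \<partial>lborel) + ennreal (T s)"
      by (subst nn_integral_add) (use rs wT in auto)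
    finally have eq: "ennreal (T r) = (\<integral>\<^sup>+t. ennreal (w t) * indicator {r..<s} t \<partial>lborel) + ennreal (T s)" .
    thus "T s \<le> T r" using T1[of r] rs by (metis add.commute ennreal_le_iff le_iff_add order.trans)
    have "ennreal (T r) - ennreal (T s) = (\<integral>\<^sup>+t. ennreal (w t) * indicator {r..<s} t \<partial>lborel)"
      unfolding eq by (rule ennreal_add_diff_cancel_right) simp
    thus "(\<integral>\<^sup>+t. ennreal (w t) * indicator {r..<s} t \<partial>lborel) = ennreal (T r - T s)"
      using T1[of s] rs by (simp add: ennreal_minus)
  qed
  obtain s0 :: nat where s0: "K < 2 ^ s0" using real_arch_pow[of 2 K] by auto
  \<comment> \<open>the summand 2 makes \<open>\<kappa>\<close> at least 4\<close>
  define s where "s = s0 + 2"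
  define \<kappa> :: nat where "\<kappa> = 2 ^ s"
  have \<kappa>4: "4 \<le> \<kappa>" unfolding \<kappa>_def s_def by (simp add: power_add)
  have "K \<le> 4 * 2 ^ s0" using s0 zero_le_power[of "2::real" s0] by linarith
  hence \<kappa>K: "K \<le> real \<kappa>" unfolding \<kappa>_def s_def by (simp add: power_add)
  define R where "R i = 1 - 1 / real \<kappa> ^ i" for i :: nat
  have R: "0 \<le> R i" "R i < 1" for i using \<kappa>4 by (auto simp: R_def field_simps)
  have Rs: "1 - (1 - R i) / real \<kappa> = R (Suc i)" for i by (simp add: R_def)
  have Rle: "R i \<le> R (Suc i)" for i
  proof -
    have "(1 - R i) / real \<kappa> \<le> (1 - R i) / 1" using \<kappa>4 R[of i] by (intro divide_left_mono) auto
    thus ?thesis by (simp flip: Rs)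
  qed
  have dec: "C * T (R (Suc i)) \<le> T (R i)" for i
  proof -
    have "T (R (Suc i)) \<le> T (1 - (1 - R i) / K)"
      unfolding Rs[symmetric] using R[of i] K \<kappa>K by (intro Tmono diff_left_mono divide_left_mono) (auto simp: field_simps)
    hence "C * T (R (Suc i)) \<le> C * T (1 - (1 - R i) / K)" using C by simp
    thus ?thesis using C(2)[of "R i"] R[of i] by linarith
  qed
  define D where "D = C1 ^ s"
  have D1: "D \<ge> 1" unfolding D_def using C1 by simp
  have dbl: "T (R i) \<le> D * T (R (Suc i))" for i
    using upper_doubling_power[of \<omega> C1 "R i" s] C1 R[of i] unfolding T_def[symmetric] D_def
    by (simp add: Rs[symmetric] \<kappa>_def)
  define V where "V i = 2 * T (R i)" for i
  define \<sigma> where "\<sigma> = sqrt (1 / C)"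
  define c where "c = (1 - 1 / C) / (2 * D\<^sup>2)"
  define \<mu> where "\<mu> = density lborel (\<lambda>z. ennreal (w (cmod z) / pi) * indicator (ball 0 1) z)"
  have mu_int: "(\<integral>\<^sup>+z. f z \<partial>\<mu>) = (\<integral>\<^sup>+z. (ennreal (w (cmod z) / pi) * indicator (ball 0 1) z) * f z \<partial>lborel)"
    if "f \<in> borel_measurable borel" for f
    unfolding \<mu>_def using that by (intro nn_integral_density) auto
  have ann: "emeasure \<mu> (annulus \<kappa> j) = (\<integral>\<^sup>+r. ennreal (2 * r) * (ennreal (w r) * indicator {R j..<R (Suc j)} r) \<partial>lborel)" for j
  proof -
    have "emeasure \<mu> (annulus \<kappa> j) = (\<integral>\<^sup>+z. (ennreal (w (cmod z) / pi) * indicator {R j..<R (Suc j)} (cmod z)) * indicator (ball 0 1) z \<partial>lborel)"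
      unfolding \<mu>_def by (subst emeasure_density)
        (auto intro!: nn_integral_cong simp: annulus_def R_def split: split_indicator)
    also have "\<dots> = (\<integral>\<^sup>+r. (ennreal (w r / pi) * indicator {R j..<R (Suc j)} r) * ennreal (2 * pi * r * indicator {0..1} r) \<partial>lborel)"
      by (rule nn_integral_radial_disc[of "\<lambda>r. ennreal (w r / pi) * indicator {R j..<R (Suc j)} r"]) measurable
    also have "\<dots> = (\<integral>\<^sup>+r. ennreal (2 * r) * (ennreal (w r) * indicator {R j..<R (Suc j)} r) \<partial>lborel)"
    proof (intro nn_integral_cong)
      fix r
      show "(ennreal (w r / pi) * indicator {R j..<R (Suc j)} r) * ennreal (2 * pi * r * indicator {0..1} r) = ennreal (2 * r) * (ennreal (w r) * indicator {R j..<R (Suc j)} r)"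
      proof (cases "r \<in> {R j..<R (Suc j)}")
        case True
        hence "r \<in> {0..1}" using R[of j] R[of "Suc j"] by auto
        thus ?thesis using True w0[of r] by (simp flip: ennreal_mult)
      qed simp
    qed
    finally show ?thesis .
  qed
  have "disc_weight \<mu> \<kappa> V \<sigma> D c"
  proof
    show "sets \<mu> = sets borel" by (simp add: \<mu>_def)
    show "4 \<le> \<kappa>" by fact
    show "0 < V i" for i using Tpos R by (simp add: V_def)
    show "V (Suc i) \<le> \<sigma>\<^sup>2 * V i" for i using dec[of i] C by (simp add: V_def \<sigma>_def field_simps)
    show "V i \<le> D * V (Suc i)" for i using dbl[of i] by (simp add: V_def)
    show "0 < \<sigma>" "\<sigma> < 1" using C by (auto simp: \<sigma>_def)
    show "0 < c" using C D1 by (simp add: c_def)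
    show "emeasure \<mu> (- ball 0 1) = 0" unfolding \<mu>_def by (subst emeasure_density) (auto simp: nn_integral_0_iff_AE split: split_indicator)
    show "(\<integral>\<^sup>+z. f (a * z) \<partial>\<mu>) = (\<integral>\<^sup>+z. f z \<partial>\<mu>)" if a: "cmod a = 1" and [measurable]: "f \<in> borel_measurable borel" for a f
    proof -
      have "(\<integral>\<^sup>+z. f (a * z) \<partial>\<mu>) = (\<integral>\<^sup>+z. (ennreal (w (cmod (a * z)) / pi) * indicator (ball 0 1) (a * z)) * f (a * z) \<partial>lborel)"
        by (subst mu_int) (auto simp: norm_mult a indicator_def)
      also have "\<dots> = (\<integral>\<^sup>+z. (ennreal (w (cmod z) / pi) * indicator (ball 0 1) z) * f z \<partial>lborel)"
        by (rule nn_integral_lborel_rotate[OF a]) measurable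
      finally show ?thesis by (subst mu_int) auto
    qed
    show "emeasure \<mu> (annulus \<kappa> j) \<le> ennreal (V j)" for j
    proof -
      have le2: "ennreal (2 * r) \<le> 2" if "r < 1" for r :: real using ennreal_leI[of "2 * r" 2] that by simp
      have "emeasure \<mu> (annulus \<kappa> j) \<le> (\<integral>\<^sup>+r. ennreal 2 * (ennreal (w r) * indicator {R j..<R (Suc j)} r) \<partial>lborel)"
        unfolding ann using R[of j] R[of "Suc j"]
        by (intro nn_integral_mono) (auto intro!: mult_right_mono le2 split: split_indicator)
      also have "\<dots> = ennreal 2 * ennreal (T (R j) - T (R (Suc j)))"
        using R[of j] R[of "Suc j"] Rle[of j] by (subst nn_integral_cmult) (auto simp: Tdiff)
      also have "\<dots> \<le> ennreal (V j)"
        unfolding V_def using T1[of "R (Suc j)"] R[of "Suc j"] by (subst ennreal_mult'[symmetric]) (auto intro!: ennreal_leI)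
      finally show ?thesis .
    qed
    show "ennreal (c * V i) \<le> emeasure \<mu> (annulus \<kappa> (i + 2))" for i
    proof -
      define j where "j = i + 2"
      \<comment> \<open>here the area element \<open>2 r\<close> is at least 1\<close>
      have Rj: "R j \<ge> 1/2"
      proof -
        have "R 1 \<le> R j" using lift_Suc_mono_le[of R 1 j] Rle by (simp add: j_def)
        moreover have "R 1 \<ge> 1/2" using \<kappa>4 by (simp add: R_def field_simps)
        ultimately show ?thesis by simp
      qed
      have "c * V i \<le> T (R j) - T (R (Suc j))"
      proof -
        have "T (R i) \<le> D * (D * T (R j))"
          using dbl[of i] dbl[of "Suc i"] D1 by (simp add: j_def) (smt (verit) mult_left_mono)
        hence "T (R i) / D\<^sup>2 \<le> T (R j)" using D1 by (simp add: field_simps power2_eq_square)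
        hence "(1 - 1 / C) * (T (R i) / D\<^sup>2) \<le> (1 - 1 / C) * T (R j)" using C by (intro mult_left_mono) auto
        also have "\<dots> \<le> T (R j) - T (R (Suc j))" using dec[of j] C by (simp add: field_simps)
        finally show ?thesis by (simp add: c_def V_def)
      qed
      hence "ennreal (c * V i) \<le> ennreal (T (R j) - T (R (Suc j)))" by (rule ennreal_leI)
      also have "\<dots> = (\<integral>\<^sup>+r. ennreal 1 * (ennreal (w r) * indicator {R j..<R (Suc j)} r) \<partial>lborel)"
        using R[of j] R[of "Suc j"] Rle[of j] by (subst Tdiff[symmetric]) auto
      also have "\<dots> \<le> emeasure \<mu> (annulus \<kappa> j)"
        unfolding ann using Rj
        by (intro nn_integral_mono) (auto intro!: mult_right_mono ennreal_leI simp del: ennreal_1 split: split_indicator)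
      finally show ?thesis by (simp add: j_def)
    qed
  qed
  moreover have "bergman_norm \<omega> p f = ennreal_power (disc_power_integral \<mu> p f) (1 / p)" if f: "f holomorphic_on ball 0 1" for p f
  proof -
    note [measurable] = borel_on_ball[OF f]
    define g where "g z = ennreal (cmod (f z * indicator (ball 0 1) z) powr p) * indicator (ball 0 1) z" for z
    have g: "g = (\<lambda>z. ennreal (cmod (f z) powr p) * indicator (ball 0 1) z)"
      by (auto simp: g_def split: split_indicator)
    have [measurable]: "g \<in> borel_measurable borel" unfolding g_def by measurable
    have ae: "AE z in disc_area. cmod z < 1 \<longrightarrow> \<omega> (cmod z) = w (cmod z)"
    proof -
      have "AE z in lebesgue. z \<in> ball 0 1 \<longrightarrow> (cmod z \<in> {0..1} \<longrightarrow> \<omega> (cmod z) = w (cmod z))"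
        by (rule AE_completion[OF AE_lborel_cmod[OF wae]])
      hence "AE z in lebesgue_on (ball 0 1). cmod z < 1 \<longrightarrow> \<omega> (cmod z) = w (cmod z)"
        by (subst AE_restrict_space_iff) (auto elim!: eventually_mono)
      then obtain N where N: "N \<in> null_sets (lebesgue_on (ball 0 1))"
          "{z \<in> space (lebesgue_on (ball 0 1)). \<not> (cmod z < 1 \<longrightarrow> \<omega> (cmod z) = w (cmod z))} \<subseteq> N"
        by (auto elim!: AE_E simp: null_sets_def)
      show ?thesis
        by (rule AE_I'[of N]) (use N in \<open>auto simp: disc_area_def null_sets_def space_scale_measure\<close>)
    qed
    have "(\<integral>\<^sup>+z. ennreal (cmod (f z) powr p * \<omega> (cmod z)) \<partial>disc_area)
       = (\<integral>\<^sup>+z. ennreal (w (cmod z)) * g z \<partial>disc_area)"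
      by (rule nn_integral_cong_AE, use ae AE_space in eventually_elim)
        (auto simp: disc_area_def space_scale_measure g ennreal_mult'' w0 mult.commute)
    also have "\<dots> = ennreal (1 / pi) * (\<integral>\<^sup>+z. ennreal (w (cmod z)) * g z \<partial>lebesgue_on (ball 0 1))"
      unfolding disc_area_def
      by (rule nn_integral_scale_measure, intro measurable_restrict_space1 measurable_completion) measurable
    also have "(\<integral>\<^sup>+z. ennreal (w (cmod z)) * g z \<partial>lebesgue_on (ball 0 1)) = (\<integral>\<^sup>+z. ennreal (w (cmod z)) * g z * indicator (ball 0 1) z \<partial>lebesgue)"
      by (rule nn_integral_restrict_space) auto
    also have "\<dots> = (\<integral>\<^sup>+z. ennreal (w (cmod z)) * g z \<partial>lborel)"
      unfolding nn_integral_completion by (intro nn_integral_cong) (simp add: g split: split_indicator)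
    also have "ennreal (1 / pi) * \<dots> = (\<integral>\<^sup>+z. ennreal (1 / pi) * (ennreal (w (cmod z)) * g z) \<partial>lborel)"
      by (rule nn_integral_cmult[symmetric]) measurable
    also have "\<dots> = (\<integral>\<^sup>+z. (ennreal (w (cmod z) / pi) * indicator (ball 0 1) z) * g z \<partial>lborel)"
      by (intro nn_integral_cong) (auto simp: g w0 mult.assoc[symmetric] ennreal_mult'[symmetric] split: split_indicator)
    also have "\<dots> = (\<integral>\<^sup>+z. g z \<partial>\<mu>)"
      by (rule mu_int[symmetric]) measurable
    also have "\<dots> = disc_power_integral \<mu> p f"
      unfolding disc_power_integral_def g[symmetric] ..
    finally show ?thesis by (simp add: bergman_norm_def)
  qed
  ultimately show thesis by (rule that)
qed

section \<open>Nodes and atoms\<close>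

lemma powr_less_one_base:
  fixes x a :: real
  assumes "0 < x" "x < 1" "0 < a"
  shows "x powr a < 1"
  using powr_less_mono2[of a x 1] assms by simp

lemma sum_power_dist_le:
  fixes x :: real
  assumes "finite F" "0 \<le> x" "x < 1"
  shows "(\<Sum>i\<in>F. x ^ ((i - j) + (j - i))) \<le> 2 / (1 - x)"
proof -
  obtain n where n: "F \<subseteq> {..<n}" using assms(1) finite_nat_iff_bounded by auto
  have g: "(\<Sum>k<m. x ^ k) \<le> 1 / (1 - x)" for m
    using assms by (simp add: sum_gp_strict divide_right_mono)
  have "(\<Sum>i\<in>F. x ^ ((i - j) + (j - i))) \<le> (\<Sum>i<j + n. x ^ ((i - j) + (j - i)))"
    using n assms by (intro sum_mono2) auto
  also have "\<dots> = (\<Sum>i<j. x ^ (j - i)) + (\<Sum>i<n. x ^ i)"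
  proof -
    have "(\<Sum>i<j + n. x ^ ((i - j) + (j - i))) = (\<Sum>i<j. x ^ ((i - j) + (j - i))) + (\<Sum>i=j..<j + n. x ^ ((i - j) + (j - i)))"
      by (subst sum.atLeastLessThan_concat[of 0 j "j + n", symmetric, unfolded atLeast0LessThan]) auto
    also have "(\<Sum>i=j..<j + n. x ^ ((i - j) + (j - i))) = (\<Sum>i=0..<n. x ^ i)"
      using sum.shift_bounds_nat_ivl[of "\<lambda>i. x ^ ((i - j) + (j - i))" 0 j n] by (simp add: add.commute)
    finally show ?thesis by (simp add: atLeast0LessThan)
  qed
  also have "(\<Sum>i<j. x ^ (j - i)) = (\<Sum>i<j. x ^ Suc i)"
    by (rule sum.reindex_bij_witness[where i = "\<lambda>i. j - Suc i" and j = "\<lambda>i. j - Suc i"])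
      (auto simp: Suc_diff_Suc simp flip: power_Suc)
  also have "\<dots> \<le> (\<Sum>i<j. x ^ i)" using assms by (intro sum_mono) (simp add: mult_left_le_one_le)
  finally show ?thesis using g[of j] g[of n] by simp
qed

text \<open>
  On level \<open>i\<close> there are \<open>num i\<close> equally spaced nodes on the circle of radius \<open>rho i\<close>, whose distance to
  the unit circle is exactly \<open>1 / num i\<close>; the pair \<open>(i, l)\<close> is the index of the \<open>l\<close>-th of them. The
  \<open>mass\<close> of a node is its share of \<open>V i\<close>, which is split evenly among the nodes of the level. An \<open>atom\<close> is
  a power of \<open>kern\<close>, normalized such that its \<open>p\<close>-norm is bounded independently of the node.
\<close>

context disc_weight
begin

definition num :: "nat \<Rightarrow> nat" where "num i = \<kappa> ^ Suc i"
definition rho :: "nat \<Rightarrow> real" where "rho i = 1 - 1 / real (num i)"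
definition nodes :: "(nat \<times> nat) set" where "nodes = {(i, l). l < num i}"
definition node :: "nat \<times> nat \<Rightarrow> complex" where
  "node k = complex_of_real (rho (fst k)) * unit_root (num (fst k)) (snd k)"
definition kern :: "nat \<times> nat \<Rightarrow> complex \<Rightarrow> complex" where
  "kern k w = of_real (1 / real (num (fst k))) / (1 - cnj (node k) * w)"
definition mass :: "nat \<times> nat \<Rightarrow> real" where "mass k = V (fst k) / real (num (fst k))"
definition atom :: "real \<Rightarrow> nat \<Rightarrow> nat \<times> nat \<Rightarrow> complex \<Rightarrow> complex" where
  "atom p \<gamma> k w = of_real (mass k powr (- 1 / p)) * kern k w ^ \<gamma>"

lemma num_ge: "4 \<le> num i" and num_pos [simp]: "0 < num i" and num_neq_0 [simp]: "num i \<noteq> 0"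
proof -
  have "\<kappa> ^ 1 \<le> \<kappa> ^ Suc i" using kappa by (intro power_increasing) auto
  hence "\<kappa> \<le> num i" by (simp only: power_one_right num_def)
  thus "4 \<le> num i" using kappa by linarith
  thus "0 < num i" "num i \<noteq> 0" by auto
qed

lemma rho_bounds: "3 / 4 \<le> rho i" "rho i < 1"
  using num_ge[of i] by (auto simp: rho_def field_simps)

lemma norm_node: "cmod (node k) = rho (fst k)"
  using rho_bounds[of "fst k"] by (simp add: node_def norm_mult)

lemma mass_pos: "0 < mass k"
  using V_pos by (simp add: mass_def)

lemma annulus_iff: "z \<in> annulus \<kappa> j \<longleftrightarrow> 1 - real \<kappa> / real (num j) \<le> cmod z \<and> cmod z < rho j"
  using kappa by (simp add: annulus_def num_def rho_def)

lemma annulus_subset_ball: "z \<in> annulus \<kappa> j \<Longrightarrow> cmod z < 1"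
  using rho_bounds[of j] by (simp add: annulus_iff)

lemma norm_one_minus_ge:
  assumes "cmod w < 1"
  shows "1 / real (num (fst k)) \<le> cmod (1 - cnj (node k) * w)" "1 - cmod w \<le> cmod (1 - cnj (node k) * w)"
proof -
  have le: "1 - rho (fst k) * cmod w \<le> cmod (1 - cnj (node k) * w)"
    using norm_triangle_ineq2[of 1 "cnj (node k) * w"] by (simp add: norm_mult norm_node)
  have "rho (fst k) * cmod w \<le> rho (fst k)" "rho (fst k) * cmod w \<le> cmod w"
    using assms rho_bounds[of "fst k"] by (auto simp: mult_left_le mult_left_le_one_le)
  thus "1 / real (num (fst k)) \<le> cmod (1 - cnj (node k) * w)" "1 - cmod w \<le> cmod (1 - cnj (node k) * w)"
    using le by (auto simp: rho_def)
qed

lemma one_minus_neq_0: "cmod w < 1 \<Longrightarrow> 1 - cnj (node k) * w \<noteq> 0"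
  using norm_one_minus_ge(2)[of w k] by auto

lemma norm_kern: "cmod (kern k w) = 1 / (real (num (fst k)) * cmod (1 - cnj (node k) * w))"
  by (simp add: kern_def norm_divide norm_mult)

lemma norm_kern_le_1: "cmod w < 1 \<Longrightarrow> cmod (kern k w) \<le> 1"
  using norm_one_minus_ge(1)[of w k] by (cases "cmod (1 - cnj (node k) * w) = 0") (auto simp: norm_kern divide_simps mult.commute)

lemma norm_kern_annulus:
  assumes "w \<in> annulus \<kappa> j"
  shows "cmod (kern k w) \<le> (1 / real \<kappa>) ^ (fst k - j)"
proof (cases "fst k \<le> j")
  case True thus ?thesis using norm_kern_le_1[OF annulus_subset_ball[OF assms]] by simp
next
  case False
  hence eq: "real (num (fst k)) = real (num j) * real \<kappa> ^ (fst k - j)"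
    by (simp add: num_def flip: power_add)
  have "1 / real (num j) \<le> cmod (1 - cnj (node k) * w)"
    using assms norm_one_minus_ge(2)[OF annulus_subset_ball[OF assms], of k] by (simp add: annulus_iff rho_def)
  hence "1 \<le> real (num j) * cmod (1 - cnj (node k) * w)" by (simp add: field_simps)
  hence "real \<kappa> ^ (fst k - j) * 1 \<le> real \<kappa> ^ (fst k - j) * (real (num j) * cmod (1 - cnj (node k) * w))"
    by (intro mult_left_mono) auto
  also have "\<dots> = real (num (fst k)) * cmod (1 - cnj (node k) * w)" by (simp add: eq)
  finally have *: "real \<kappa> ^ (fst k - j) \<le> real (num (fst k)) * cmod (1 - cnj (node k) * w)" by simp
  have pos: "0 < real \<kappa> ^ (fst k - j)" using kappa by simp
  hence pos2: "0 < real (num (fst k)) * cmod (1 - cnj (node k) * w)" using * by linarith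
  show ?thesis unfolding norm_kern power_one_over
    by (rule divide_left_mono[OF *]) (simp, rule mult_pos_pos[OF pos2 pos])
qed

lemma sum_inverse_norm_sq_node:
  assumes "cmod w \<le> 1"
  shows "(\<Sum>l<num i. 1 / (cmod (1 - cnj (node (i, l)) * w))\<^sup>2) \<le> 4 * real (num i) ^ 2"
proof -
  define x where "x = of_real (rho i) * cnj w"
  have x: "cmod x \<le> rho i" using assms rho_bounds[of i] by (simp add: x_def norm_mult mult_left_le)
  have eq: "cmod (1 - cnj (node (i, l)) * w) = cmod (1 - x * unit_root (num i) l)" for l
    by (subst complex_mod_cnj[symmetric]) (simp add: x_def node_def mult_ac)
  have "(\<Sum>l<num i. 1 / (cmod (1 - cnj (node (i, l)) * w))\<^sup>2) \<le> 4 * real (num i) / (1 - cmod x)"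
    unfolding eq using x by (intro sum_inverse_norm_sq_unit_root') (auto simp: rho_def)
  also have "\<dots> \<le> 4 * real (num i) / (1 / real (num i))"
  proof (intro divide_left_mono mult_pos_pos)
    have "cmod x < 1" using x rho_bounds[of i] by linarith
    thus "0 < 1 - cmod x" by simp
  qed (use x in \<open>auto simp: rho_def\<close>)
  finally show ?thesis by (simp add: power2_eq_square)
qed

lemma sum_norm_kern_sq:
  assumes "cmod w \<le> 1"
  shows "(\<Sum>l<num i. (cmod (kern (i, l) w))\<^sup>2) \<le> 4"
proof -
  have "(\<Sum>l<num i. (cmod (kern (i, l) w))\<^sup>2) = (\<Sum>l<num i. 1 / (cmod (1 - cnj (node (i, l)) * w))\<^sup>2) / real (num i) ^ 2"
    by (simp add: norm_kern power_divide power_mult_distrib sum_divide_distrib mult.commute)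
  also have "\<dots> \<le> (4 * real (num i) ^ 2) / real (num i) ^ 2"
    using sum_inverse_norm_sq_node[OF assms] by (intro divide_right_mono) auto
  finally show ?thesis by simp
qed

lemma kern_borel [measurable]: "kern k \<in> borel_measurable borel"
  unfolding kern_def by measurable

lemma atom_borel [measurable]: "atom p \<gamma> k \<in> borel_measurable borel"
  unfolding atom_def by measurable

lemma kern_holomorphic: "kern k holomorphic_on ball 0 1"
  unfolding kern_def by (intro holomorphic_intros) (use one_minus_neq_0 in auto)

lemma atom_holomorphic: "atom p \<gamma> k holomorphic_on ball 0 1"
  unfolding atom_def by (intro holomorphic_intros kern_holomorphic)

text \<open>
  Rotation by \<open>unit_root\<close> moves the nodes of a level to each other, so all of them give the same
  integral. Their sum is controlled pointwise by \<open>sum_norm_kern_sq\<close>.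
\<close>

lemma nn_integral_kern_sq:
  assumes l: "l < num i"
  shows "(\<integral>\<^sup>+z. ennreal ((cmod (kern (i, l) z))\<^sup>2) * indicator (annulus \<kappa> j) z \<partial>\<mu>) \<le> ennreal (4 * V j / real (num i))"
proof -
  define X where "X l = (\<integral>\<^sup>+z. ennreal ((cmod (kern (i, l) z))\<^sup>2) * indicator (annulus \<kappa> j) z \<partial>\<mu>)" for l
  have X0: "X l = X 0" for l
  proof -
    let ?f = "\<lambda>z. ennreal ((cmod (kern (i, l) z))\<^sup>2) * indicator (annulus \<kappa> j) z"
    have "kern (i, l) (unit_root (num i) l * z) = kern (i, 0) z" for z
    proof -
      have "cnj (unit_root (num i) l) * unit_root (num i) l = 1"
        using complex_norm_square[of "unit_root (num i) l"] by (simp add: mult.commute)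
      moreover have "unit_root (num i) 0 = 1" by (simp add: unit_root_def)
      ultimately have "cnj (node (i, l)) * (unit_root (num i) l * z) = cnj (node (i, 0)) * z"
        by (simp add: node_def mult.assoc[symmetric])
      thus ?thesis by (simp add: kern_def)
    qed
    moreover have "unit_root (num i) l * z \<in> annulus \<kappa> j \<longleftrightarrow> z \<in> annulus \<kappa> j" for z
      by (simp add: annulus_def norm_mult)
    ultimately have "?f (unit_root (num i) l * z) = ennreal ((cmod (kern (i, 0) z))\<^sup>2) * indicator (annulus \<kappa> j) z" for z
      by (simp add: indicator_def)
    moreover have "(\<integral>\<^sup>+z. ?f (unit_root (num i) l * z) \<partial>\<mu>) = (\<integral>\<^sup>+z. ?f z \<partial>\<mu>)"
      by (rule rotation) measurable
    ultimately show ?thesis by (simp add: X_def)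
  qed
  have "of_nat (num i) * X 0 = (\<Sum>l<num i. X 0)" by simp
  also have "\<dots> = (\<Sum>l<num i. X l)" by (intro sum.cong refl X0[symmetric])
  also have "\<dots> = (\<integral>\<^sup>+z. (\<Sum>l<num i. ennreal ((cmod (kern (i, l) z))\<^sup>2) * indicator (annulus \<kappa> j) z) \<partial>\<mu>)"
    unfolding X_def by (rule nn_integral_sum[symmetric]) measurable
  also have "\<dots> \<le> (\<integral>\<^sup>+z. ennreal 4 * indicator (annulus \<kappa> j) z \<partial>\<mu>)"
  proof (intro nn_integral_mono)
    fix z
    show "(\<Sum>l<num i. ennreal ((cmod (kern (i, l) z))\<^sup>2) * indicator (annulus \<kappa> j) z) \<le> ennreal 4 * indicator (annulus \<kappa> j) z"
    proof (cases "z \<in> annulus \<kappa> j")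
      case True
      have "ennreal (\<Sum>l<num i. (cmod (kern (i, l) z))\<^sup>2) \<le> ennreal 4"
        using annulus_subset_ball[OF True] by (intro ennreal_leI sum_norm_kern_sq) auto
      thus ?thesis using True by simp
    qed simp
  qed
  also have "\<dots> = ennreal 4 * emeasure \<mu> (annulus \<kappa> j)"
    by (rule nn_integral_cmult_indicator) measurable
  also have "\<dots> \<le> ennreal 4 * ennreal (V j)" by (intro mult_left_mono annulus_upper) auto
  finally have le: "of_nat (num i) * X 0 \<le> ennreal (4 * V j)"
    using V_pos[of j] by (simp add: ennreal_mult)
  have "X l = ennreal (1 / real (num i)) * (of_nat (num i) * X 0)"
    by (simp add: X0[of l] mult.assoc[symmetric] ennreal_of_nat_eq_real_of_nat ennreal_mult[symmetric])
  also have "\<dots> \<le> ennreal (1 / real (num i)) * ennreal (4 * V j)" using le by (rule mult_left_mono) simp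
  also have "\<dots> = ennreal (4 * V j / real (num i))"
    using V_pos[of j] by (simp flip: ennreal_mult)
  finally show ?thesis by (simp add: X_def)
qed

lemma V_decay_power: "V (i + m) \<le> (\<sigma> ^ 2) ^ m * V i"
proof (induction m)
  case (Suc m)
  have "V (i + Suc m) \<le> \<sigma>\<^sup>2 * V (i + m)" using V_decay[of "i + m"] by simp
  also have "\<dots> \<le> \<sigma>\<^sup>2 * ((\<sigma> ^ 2) ^ m * V i)" using Suc by (intro mult_left_mono) auto
  finally show ?case by simp
qed simp

lemma D_pos: "D > 0"
  using V_doubling[of 0] V_pos[of 0] V_pos[of "Suc 0"] by (smt (verit) zero_less_mult_pos2)

lemma V_doubling_power: "V i \<le> D ^ m * V (i + m)"
proof (induction m)
  case (Suc m)
  have "D ^ m * V (i + m) \<le> D ^ m * (D * V (Suc (i + m)))" using V_doubling[of "i + m"] D_pos by (intro mult_left_mono) auto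
  thus ?case using Suc by (simp add: mult_ac)
qed simp

lemma annulus_cover:
  assumes z: "cmod z < 1"
  obtains j where "z \<in> annulus \<kappa> j"
proof -
  obtain n where n: "1 / (1 - cmod z) < real \<kappa> ^ n" using real_arch_pow[of "real \<kappa>" "1 / (1 - cmod z)"] kappa by auto
  define P where "P n \<longleftrightarrow> cmod z < 1 - 1 / real \<kappa> ^ n" for n
  have "P n" unfolding P_def using n z kappa by (simp add: field_simps)
  moreover have "\<not> P 0" by (simp add: P_def)
  ultimately obtain m where "\<not> P m" "P (Suc m)" using ex_least_nat_less[of P n] by blast
  hence "z \<in> annulus \<kappa> m" by (simp add: P_def annulus_def)
  thus thesis by (rule that)
qed

lemma disc_power_integral_annuli:
  assumes [measurable]: "f \<in> borel_measurable borel"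
  shows "disc_power_integral \<mu> p f \<le> (\<Sum>j. \<integral>\<^sup>+z. ennreal (cmod (f z) powr p) * indicator (annulus \<kappa> j) z \<partial>\<mu>)"
proof -
  have "(\<Sum>j. \<integral>\<^sup>+z. ennreal (cmod (f z) powr p) * indicator (annulus \<kappa> j) z \<partial>\<mu>)
      = (\<integral>\<^sup>+z. (\<Sum>j. ennreal (cmod (f z) powr p) * indicator (annulus \<kappa> j) z) \<partial>\<mu>)"
    by (rule nn_integral_suminf[symmetric]) measurable
  moreover have "ennreal (cmod (f z) powr p) * indicator (ball 0 1) z \<le> (\<Sum>j. ennreal (cmod (f z) powr p) * indicator (annulus \<kappa> j) z)" for z
  proof (cases "z \<in> ball 0 1")
    case True
    then obtain j where j: "z \<in> annulus \<kappa> j" using annulus_cover by auto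
    have "ennreal (cmod (f z) powr p) * indicator (ball 0 1) z \<le> (\<Sum>i\<in>{j}. ennreal (cmod (f z) powr p) * indicator (annulus \<kappa> i) z)"
      using j by (simp split: split_indicator)
    also have "\<dots> \<le> (\<Sum>j. ennreal (cmod (f z) powr p) * indicator (annulus \<kappa> j) z)"
      by (rule sum_le_suminf) auto
    finally show ?thesis .
  qed simp
  ultimately show ?thesis unfolding disc_power_integral_def by (simp add: nn_integral_mono)
qed

text \<open>
  Jensen's inequality with weights \<open>\<bar>kern\<bar>\<^sup>2 \<theta>\<^sup>\<bar>\<^sup>i\<^sup>-\<^sup>j\<^sup>\<bar>\<close>, where \<open>\<theta> = \<sigma>\<^sup>1\<^sup>/\<^sup>(\<^sup>p\<^sup>-\<^sup>1\<^sup>)\<close>: the square makes the sum over one level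
  bounded, the second factor makes the sum over the levels converge, and \<open>\<theta>\<close> is chosen such
  that undoing it costs only \<open>\<sigma>\<^sup>-\<^sup>\<bar>\<^sup>i\<^sup>-\<^sup>j\<^sup>\<bar>\<close>. The remaining power of the kernel is small on annuli much closer to the origin.
\<close>

lemma synthesis_pointwise:
  assumes p: "1 < p" and K: "finite K" "K \<subseteq> nodes" and z: "z \<in> annulus \<kappa> j" and \<gamma>: "g + 2 \<le> \<gamma>"
  shows "cmod (\<Sum>k\<in>K. d k * atom p \<gamma> k z) powr p \<le>
     (8 / (1 - \<sigma> powr (1 / (p - 1)))) powr (p - 1) *
       (\<Sum>k\<in>K. cmod (d k) powr p / mass k * (((1 / real \<kappa>) ^ (fst k - j)) ^ g * (1 / \<sigma>) ^ ((fst k - j) + (j - fst k))) * (cmod (kern k z))\<^sup>2)"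
proof -
  define \<theta> where "\<theta> = \<sigma> powr (1 / (p - 1))"
  have \<theta>: "0 < \<theta>" "\<theta> < 1" using sigma p by (auto simp: \<theta>_def powr_less_one_base)
  define e where "e k = (fst k - j) + (j - fst k)" for k :: "nat \<times> nat"
  define t where "t k = cmod (kern k z)" for k
  define \<tau> where "\<tau> k = (1 / real \<kappa>) ^ (fst k - j)" for k :: "nat \<times> nat"
  have \<tau>: "0 < \<tau> k" "\<tau> k \<le> 1" for k using kappa by (auto simp: \<tau>_def power_le_one)
  have z1: "cmod z < 1" by (rule annulus_subset_ball[OF z])
  have t: "0 \<le> t k" "t k \<le> 1" "t k \<le> \<tau> k" for k
    using norm_kern_le_1[OF z1] norm_kern_annulus[OF z] by (auto simp: t_def \<tau>_def)
  define y where "y k = cmod (d k) * mass k powr (- 1 / p) * t k ^ g / \<theta> ^ e k" for k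
  define w where "w k = t k ^ 2 * \<theta> ^ e k" for k
  have "cmod (\<Sum>k\<in>K. d k * atom p \<gamma> k z) \<le> (\<Sum>k\<in>K. w k * y k)"
  proof (rule sum_norm_le)
    fix k
    have "t k ^ \<gamma> \<le> t k ^ (g + 2)" using t[of k] \<gamma> by (intro power_decreasing) auto
    hence "cmod (d k) * mass k powr (- 1 / p) * t k ^ \<gamma> \<le> cmod (d k) * mass k powr (- 1 / p) * t k ^ (g + 2)"
      by (intro mult_left_mono) auto
    moreover have "cmod (d k * atom p \<gamma> k z) = cmod (d k) * mass k powr (- 1 / p) * t k ^ \<gamma>"
      by (simp add: atom_def norm_mult norm_power t_def)
    moreover have "w k * y k = cmod (d k) * mass k powr (- 1 / p) * t k ^ (g + 2)"
      using \<theta> by (simp add: w_def y_def power_add power2_eq_square)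
    ultimately show "cmod (d k * atom p \<gamma> k z) \<le> w k * y k" by simp
  qed
  hence "cmod (\<Sum>k\<in>K. d k * atom p \<gamma> k z) powr p \<le> (\<Sum>k\<in>K. w k * y k) powr p"
    using p by (intro powr_mono2) auto
  also have "\<dots> \<le> (\<Sum>k\<in>K. w k) powr (p - 1) * (\<Sum>k\<in>K. w k * y k powr p)"
    using p K t \<theta> by (intro sum_powr_le) (auto simp: w_def y_def)
  also have "\<dots> \<le> (8 / (1 - \<theta>)) powr (p - 1) * (\<Sum>k\<in>K. cmod (d k) powr p / mass k * (\<tau> k ^ g * (1 / \<sigma>) ^ e k) * (t k)\<^sup>2)"
  proof (rule mult_mono[OF powr_mono2 sum_mono])
    have "(\<Sum>k\<in>K. w k) \<le> (\<Sum>k\<in>(SIGMA i:fst ` K. {..<num i}). w k)"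
      using K \<theta> t by (intro sum_mono2) (force simp: nodes_def w_def)+
    also have "\<dots> = (\<Sum>i\<in>fst ` K. \<Sum>l<num i. w (i, l))" using K by (subst sum.Sigma) auto
    also have "\<dots> = (\<Sum>i\<in>fst ` K. \<theta> ^ ((i - j) + (j - i)) * (\<Sum>l<num i. (cmod (kern (i, l) z))\<^sup>2))"
      by (simp add: w_def t_def e_def sum_distrib_left mult.commute)
    also have "\<dots> \<le> (\<Sum>i\<in>fst ` K. \<theta> ^ ((i - j) + (j - i)) * 4)"
      using \<theta> z1 by (intro sum_mono mult_left_mono sum_norm_kern_sq) auto
    also have "\<dots> \<le> 2 / (1 - \<theta>) * 4"
      unfolding sum_distrib_right[symmetric] using \<theta> K by (intro mult_right_mono sum_power_dist_le) auto
    finally show "(\<Sum>k\<in>K. w k) \<le> 8 / (1 - \<theta>)" by simp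
  next
    fix k
    have E1: "(1 / \<theta> ^ e k) powr p * \<theta> ^ e k = (1 / \<sigma>) ^ e k"
    proof -
      have le: "\<theta> ^ e k = \<sigma> powr (real (e k) / (p - 1))"
        using sigma by (simp add: \<theta>_def powr_power)
      have "(1 / \<theta> ^ e k) powr p * \<theta> ^ e k = \<sigma> powr (- (real (e k) / (p - 1)) * p + real (e k) / (p - 1))"
        unfolding le using sigma by (simp add: powr_minus_divide[symmetric] powr_powr flip: powr_add)
      also have "- (real (e k) / (p - 1)) * p + real (e k) / (p - 1) = - real (e k)"
      proof -
        have ring: "- X * p + X = - (X * (p - 1))" for X :: real by (simp add: algebra_simps)
        have "- (real (e k) / (p - 1)) * p + real (e k) / (p - 1) = - (real (e k) / (p - 1) * (p - 1))" by (rule ring)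
        also have "\<dots> = - real (e k)" using p by simp
        finally show ?thesis .
      qed
      also have "\<sigma> powr (- real (e k)) = (1 / \<sigma>) ^ e k"
        using sigma by (simp add: powr_minus powr_realpow power_one_over inverse_eq_divide)
      finally show ?thesis .
    qed
    have E2: "(mass k powr (- 1 / p)) powr p = 1 / mass k"
    proof -
      have "(mass k powr (- 1 / p)) powr p = mass k powr (- 1 / p * p)" by (rule powr_powr)
      also have "- 1 / p * p = - 1" using p by simp
      finally show ?thesis using mass_pos[of k] by (simp add: powr_minus_divide)
    qed
    have E3: "y k powr p = cmod (d k) powr p * (mass k powr (- 1 / p)) powr p * (t k ^ g) powr p * (1 / \<theta> ^ e k) powr p"
      using t[of k] \<theta> by (simp add: y_def powr_mult powr_divide)
    have "w k * y k powr p = cmod (d k) powr p * (mass k powr (- 1 / p)) powr p * ((t k ^ g) powr p * ((1 / \<theta> ^ e k) powr p * \<theta> ^ e k)) * (t k)\<^sup>2"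
      unfolding E3 w_def by (simp only: mult_ac)
    also have "\<dots> = cmod (d k) powr p / mass k * ((t k ^ g) powr p * (1 / \<sigma>) ^ e k) * (t k)\<^sup>2"
      unfolding E1 E2 by simp
    also have "\<dots> \<le> cmod (d k) powr p / mass k * (\<tau> k ^ g * (1 / \<sigma>) ^ e k) * (t k)\<^sup>2"
    proof -
      have "(t k ^ g) powr p \<le> (t k ^ g) powr 1"
        using t[of k] p by (intro powr_mono') (auto simp: power_le_one)
      also have "\<dots> \<le> \<tau> k ^ g" using t[of k] by (simp add: power_mono)
      finally show ?thesis using mass_pos[of k] sigma by (intro mult_right_mono mult_left_mono) auto
    qed
    finally show "w k * y k powr p \<le> cmod (d k) powr p / mass k * (\<tau> k ^ g * (1 / \<sigma>) ^ e k) * (t k)\<^sup>2" .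
  qed (use p \<theta> t in \<open>auto simp: w_def intro!: sum_nonneg\<close>)
  finally show ?thesis by (simp add: \<theta>_def \<tau>_def e_def t_def)
qed

text \<open>
  In the bound of \<open>synthesis_pointwise\<close> the factor \<open>\<sigma>\<^sup>-\<^sup>\<bar>\<^sup>i\<^sup>-\<^sup>j\<^sup>\<bar>\<close> has to be beaten by the quotient \<open>V j / V i\<close>.
  For \<open>j \<ge> i\<close> that quotient is at most \<open>\<sigma>\<^sup>2\<^sup>(\<^sup>j\<^sup>-\<^sup>i\<^sup>)\<close> by the decay of the tails. For \<open>j < i\<close> it grows at most
  like \<open>D\<^sup>i\<^sup>-\<^sup>j\<close>, which the power of \<open>\<kappa>\<^sup>-\<^sup>(\<^sup>i\<^sup>-\<^sup>j\<^sup>)\<close> from the kernel absorbs once the exponent is large.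
\<close>

theorem synthesis:
  assumes p: "1 < p"
  obtains \<gamma>0 :: nat and C :: real where "C > 0"
    "\<And>\<gamma> K d. \<gamma>0 \<le> \<gamma> \<Longrightarrow> finite K \<Longrightarrow> K \<subseteq> nodes \<Longrightarrow>
       disc_power_integral \<mu> p (\<lambda>z. \<Sum>k\<in>K. d k * atom p \<gamma> k z) \<le> ennreal (C * (\<Sum>k\<in>K. cmod (d k) powr p))"
proof -
  obtain g :: nat where g: "D / \<sigma> ^ 2 < real \<kappa> ^ g" using real_arch_pow[of "real \<kappa>" "D / \<sigma>\<^sup>2"] kappa by auto
  define L where "L = (8 / (1 - \<sigma> powr (1 / (p - 1)))) powr (p - 1)"
  have L: "L > 0" using sigma p by (auto simp: L_def powr_less_one_base)
  define C where "C = L * 4 * (2 / (1 - \<sigma>))"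
  have C: "C > 0" using L sigma by (auto simp: C_def intro!: mult_pos_pos)
  have key: "((1 / real \<kappa>) ^ (i - j)) ^ g * (1 / \<sigma>) ^ ((i - j) + (j - i)) * V j \<le> \<sigma> ^ ((i - j) + (j - i)) * V i" for i j
  proof (cases "i \<le> j")
    case True
    have "V j \<le> (\<sigma> ^ 2) ^ (j - i) * V i" using V_decay_power[of i "j - i"] True by simp
    hence "(1 / \<sigma>) ^ (j - i) * V j \<le> (1 / \<sigma>) ^ (j - i) * ((\<sigma> ^ 2) ^ (j - i) * V i)" using sigma by (intro mult_left_mono) auto
    also have "\<dots> = ((1 / \<sigma>) * \<sigma> ^ 2) ^ (j - i) * V i" by (simp only: power_mult_distrib mult.assoc)
    also have "(1 / \<sigma>) * \<sigma> ^ 2 = \<sigma>" using sigma by (simp add: power2_eq_square)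
    finally show ?thesis using True by simp
  next
    case False
    define m where "m = i - j"
    have "V j \<le> D ^ m * V i" using V_doubling_power[of j m] False by (simp add: m_def)
    hence "((1 / real \<kappa>) ^ m) ^ g * (1 / \<sigma>) ^ m * V j \<le> ((1 / real \<kappa>) ^ m) ^ g * (1 / \<sigma>) ^ m * (D ^ m * V i)"
      using sigma by (intro mult_left_mono) auto
    also have "\<dots> = ((1 / real \<kappa>) ^ g * (1 / \<sigma>) * D) ^ m * V i"
      by (simp only: power_mult_distrib power_mult[symmetric] mult.commute mult.left_commute mult.assoc)
    also have "\<dots> \<le> \<sigma> ^ m * V i"
    proof (intro mult_right_mono power_mono)
      have "D \<le> real \<kappa> ^ g * \<sigma> ^ 2" using g sigma by (simp add: divide_less_eq)
      thus "(1 / real \<kappa>) ^ g * (1 / \<sigma>) * D \<le> \<sigma>" using sigma kappa by (simp add: power_one_over field_simps power2_eq_square)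
    qed (use D_pos sigma V_pos[of i] in auto)
    finally show ?thesis using False by (simp add: m_def)
  qed
  have main: "disc_power_integral \<mu> p (\<lambda>z. \<Sum>k\<in>K. d k * atom p \<gamma> k z) \<le> ennreal (C * (\<Sum>k\<in>K. cmod (d k) powr p))"
    if \<gamma>: "g + 2 \<le> \<gamma>" and K: "finite K" "K \<subseteq> nodes" for \<gamma> K d
  proof -
    define a where "a k j = L * (cmod (d k) powr p / mass k * (((1 / real \<kappa>) ^ (fst k - j)) ^ g * (1 / \<sigma>) ^ ((fst k - j) + (j - fst k))))" for k j
    have a0: "0 \<le> a k j" for k j using L mass_pos[of k] sigma by (auto simp: a_def)
    have ann: "(\<integral>\<^sup>+z. ennreal (cmod (\<Sum>k\<in>K. d k * atom p \<gamma> k z) powr p) * indicator (annulus \<kappa> j) z \<partial>\<mu>)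
        \<le> ennreal (\<Sum>k\<in>K. L * 4 * cmod (d k) powr p * \<sigma> ^ ((fst k - j) + (j - fst k)))" for j
    proof -
      have "(\<integral>\<^sup>+z. ennreal (cmod (\<Sum>k\<in>K. d k * atom p \<gamma> k z) powr p) * indicator (annulus \<kappa> j) z \<partial>\<mu>)
         \<le> (\<integral>\<^sup>+z. (\<Sum>k\<in>K. ennreal (a k j) * (ennreal ((cmod (kern k z))\<^sup>2) * indicator (annulus \<kappa> j) z)) \<partial>\<mu>)"
      proof (intro nn_integral_mono)
        fix z
        show "ennreal (cmod (\<Sum>k\<in>K. d k * atom p \<gamma> k z) powr p) * indicator (annulus \<kappa> j) z
          \<le> (\<Sum>k\<in>K. ennreal (a k j) * (ennreal ((cmod (kern k z))\<^sup>2) * indicator (annulus \<kappa> j) z))"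
        proof (cases "z \<in> annulus \<kappa> j")
          case True
          have "ennreal (cmod (\<Sum>k\<in>K. d k * atom p \<gamma> k z) powr p) \<le> ennreal (\<Sum>k\<in>K. a k j * (cmod (kern k z))\<^sup>2)"
            using synthesis_pointwise[OF p K True \<gamma>, of d]
            by (intro ennreal_leI) (simp add: a_def L_def sum_distrib_left mult.assoc)
          also have "\<dots> = (\<Sum>k\<in>K. ennreal (a k j) * ennreal ((cmod (kern k z))\<^sup>2))"
            using a0 by (subst sum_ennreal[symmetric]) (auto simp: ennreal_mult)
          finally show ?thesis using True by simp
        qed simp
      qed
      also have "\<dots> = (\<Sum>k\<in>K. ennreal (a k j) * (\<integral>\<^sup>+z. ennreal ((cmod (kern k z))\<^sup>2) * indicator (annulus \<kappa> j) z \<partial>\<mu>))"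
        by (subst nn_integral_sum) (auto simp: nn_integral_cmult)
      also have "\<dots> \<le> (\<Sum>k\<in>K. ennreal (L * 4 * cmod (d k) powr p * \<sigma> ^ ((fst k - j) + (j - fst k))))"
      proof (rule sum_mono)
        fix k assume "k \<in> K"
        then obtain i l where k: "k = (i, l)" "l < num i" using K by (auto simp: nodes_def)
        have "ennreal (a k j) * (\<integral>\<^sup>+z. ennreal ((cmod (kern k z))\<^sup>2) * indicator (annulus \<kappa> j) z \<partial>\<mu>) \<le> ennreal (a k j) * ennreal (4 * V j / real (num i))"
          unfolding k by (intro mult_left_mono nn_integral_kern_sq k) auto
        also have "\<dots> = ennreal (a k j * (4 * V j / real (num i)))" using a0[of k j] V_pos[of j] by (subst ennreal_mult) auto
        also have "a k j * (4 * V j / real (num i)) = L * 4 * cmod (d k) powr p / V i * (((1 / real \<kappa>) ^ (i - j)) ^ g * (1 / \<sigma>) ^ ((i - j) + (j - i)) * V j)"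
          by (simp add: a_def k mass_def)
        also have "ennreal \<dots> \<le> ennreal (L * 4 * cmod (d k) powr p / V i * (\<sigma> ^ ((i - j) + (j - i)) * V i))"
          using L V_pos[of i] by (intro ennreal_leI mult_left_mono key) auto
        also have "L * 4 * cmod (d k) powr p / V i * (\<sigma> ^ ((i - j) + (j - i)) * V i) = L * 4 * cmod (d k) powr p * \<sigma> ^ ((fst k - j) + (j - fst k))"
          using V_pos[of i] by (simp add: k)
        finally show "ennreal (a k j) * (\<integral>\<^sup>+z. ennreal ((cmod (kern k z))\<^sup>2) * indicator (annulus \<kappa> j) z \<partial>\<mu>) \<le> ennreal (L * 4 * cmod (d k) powr p * \<sigma> ^ ((fst k - j) + (j - fst k)))" .
      qed
      also have "\<dots> = ennreal (\<Sum>k\<in>K. L * 4 * cmod (d k) powr p * \<sigma> ^ ((fst k - j) + (j - fst k)))"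
        using L sigma by (intro sum_ennreal) auto
      finally show ?thesis .
    qed
    have "disc_power_integral \<mu> p (\<lambda>z. \<Sum>k\<in>K. d k * atom p \<gamma> k z)
       \<le> (\<Sum>j. \<integral>\<^sup>+z. ennreal (cmod (\<Sum>k\<in>K. d k * atom p \<gamma> k z) powr p) * indicator (annulus \<kappa> j) z \<partial>\<mu>)"
      by (rule disc_power_integral_annuli) measurable
    also have "\<dots> \<le> ennreal (C * (\<Sum>k\<in>K. cmod (d k) powr p))"
      unfolding suminf_eq_SUP
    proof (rule SUP_least)
      fix J :: nat
      have "(\<Sum>j<J. \<integral>\<^sup>+z. ennreal (cmod (\<Sum>k\<in>K. d k * atom p \<gamma> k z) powr p) * indicator (annulus \<kappa> j) z \<partial>\<mu>)
        \<le> (\<Sum>j<J. ennreal (\<Sum>k\<in>K. L * 4 * cmod (d k) powr p * \<sigma> ^ ((fst k - j) + (j - fst k))))"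
        by (intro sum_mono ann)
      also have "\<dots> = ennreal (\<Sum>j<J. \<Sum>k\<in>K. L * 4 * cmod (d k) powr p * \<sigma> ^ ((fst k - j) + (j - fst k)))"
        using L sigma by (intro sum_ennreal sum_nonneg) auto
      also have "(\<Sum>j<J. \<Sum>k\<in>K. L * 4 * cmod (d k) powr p * \<sigma> ^ ((fst k - j) + (j - fst k)))
         = (\<Sum>k\<in>K. L * 4 * cmod (d k) powr p * (\<Sum>j<J. \<sigma> ^ ((j - fst k) + (fst k - j))))"
        by (subst sum.swap) (simp add: sum_distrib_left add.commute)
      also have "\<dots> \<le> (\<Sum>k\<in>K. L * 4 * cmod (d k) powr p * (2 / (1 - \<sigma>)))"
        using L sigma by (intro sum_mono mult_left_mono sum_power_dist_le) auto
      also have "\<dots> = C * (\<Sum>k\<in>K. cmod (d k) powr p)" by (simp add: C_def sum_distrib_left sum_divide_distrib mult_ac)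
      finally show "(\<Sum>j<J. \<integral>\<^sup>+z. ennreal (cmod (\<Sum>k\<in>K. d k * atom p \<gamma> k z) powr p) * indicator (annulus \<kappa> j) z \<partial>\<mu>) \<le> ennreal (C * (\<Sum>k\<in>K. cmod (d k) powr p))"
        by (simp add: ennreal_leI)
    qed
    finally show ?thesis .
  qed
  show thesis using C main by (intro that[of C "g + 2"])
qed

end

section \<open>Sampling a function on the cells\<close>

text \<open>
  The parametrization of the circle starts at \<open>z\<close> and not at \<open>\<bar>z\<bar>\<close>, so that integrating over \<open>z\<close> later
  amounts to a rotation.
\<close>

lemma poisson_jensen:
  assumes f: "f holomorphic_on ball 0 1" and z: "cmod z < 1" and w: "cmod w < cmod z" and p: "1 \<le> p"
  defines "e \<equiv> \<lambda>t. z * exp (2 * of_real pi * \<i> * of_real t)"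
  shows "ennreal (cmod (f w) powr p) \<le>
    (\<integral>\<^sup>+t. ennreal (cmod (f (e t)) powr p * (((cmod z)\<^sup>2 - (cmod w)\<^sup>2) / (cmod (e t - w))\<^sup>2)) * indicator {0..1} t \<partial>lborel)"
proof -
  define \<rho> where "\<rho> = cmod z"
  have \<rho>: "0 < \<rho>" "\<rho> < 1" using w z norm_ge_zero[of w] unfolding \<rho>_def by linarith+
  define a where "a = z / of_real \<rho>"
  have a: "cmod a = 1" using \<rho> by (simp add: a_def norm_divide \<rho>_def)
  have aa: "a * cnj a = 1" using complex_norm_square[of a] a by simp
  have az: "a * of_real \<rho> = z" using \<rho> by (simp add: a_def)
  define P where "P t = (\<rho>\<^sup>2 - (cmod w)\<^sup>2) / (cmod (e t - w))\<^sup>2" for t :: real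
  have ce: "cmod (e t) = \<rho>" for t by (simp add: e_def norm_mult \<rho>_def)
  have P0: "0 \<le> P t" for t using w by (simp add: P_def \<rho>_def power_mono)
  have ce_cont: "continuous_on {0..1} e" unfolding e_def by (intro continuous_intros)
  have en: "e t - w \<noteq> 0" for t using ce[of t] w by (auto simp: \<rho>_def)
  have P_cont: "continuous_on {0..1} P"
    unfolding P_def by (intro continuous_intros ce_cont) (use en in auto)
  have poi: "((\<lambda>t. h (e t) * of_real (P t)) has_integral h w) {0..1}" if h: "h holomorphic_on ball 0 1" for h
  proof -
    have "(\<lambda>v. h (a * v)) holomorphic_on ball 0 1"
      by (rule holomorphic_on_compose_gen[OF _ h, unfolded o_def]) (auto intro!: holomorphic_intros simp: norm_mult a)
    from poisson_formula[OF this \<rho>(2), of "cnj a * w"]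
    have "((\<lambda>t. h (a * (\<rho> * exp (2 * of_real pi * \<i> * of_real t))) *
        of_real ((\<rho>\<^sup>2 - (cmod (cnj a * w))\<^sup>2) / (cmod (\<rho> * exp (2 * of_real pi * \<i> * of_real t) - cnj a * w))\<^sup>2))
        has_integral h (a * (cnj a * w))) {0..1}"
      using w a by (simp add: norm_mult \<rho>_def)
    moreover have "a * (\<rho> * exp (2 * of_real pi * \<i> * of_real t)) = e t" for t
      by (simp add: e_def az mult.assoc[symmetric])
    moreover have "cmod (\<rho> * exp (2 * of_real pi * \<i> * of_real t) - cnj a * w) = cmod (e t - w)" for t :: real
    proof -
      have "cmod (\<rho> * exp (2 * of_real pi * \<i> * of_real t) - cnj a * w) = cmod (a * (\<rho> * exp (2 * of_real pi * \<i> * of_real t) - cnj a * w))"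
        by (simp add: norm_mult a)
      also have "a * (\<rho> * exp (2 * of_real pi * \<i> * of_real t) - cnj a * w) = e t - w"
        by (simp add: right_diff_distrib mult.assoc[symmetric] az aa e_def)
      finally show ?thesis .
    qed
    moreover have "a * (cnj a * w) = w" by (simp add: mult.assoc[symmetric] aa)
    moreover have "cmod (cnj a * w) = cmod w" using a by (simp add: norm_mult)
    ultimately show ?thesis by (simp add: P_def)
  qed
  have P1: "(P has_integral 1) {0..1}"
  proof -
    have "((\<lambda>t. complex_of_real (P t)) has_integral 1) {0..1}" using poi[of "\<lambda>_. 1"] by simp
    from has_integral_Re[OF this] show ?thesis by simp
  qed
  define X where "X t = cmod (f (e t))" for t
  have sub: "e ` {0..1} \<subseteq> ball 0 1" using ce \<rho> by auto
  have fc: "continuous_on {0..1} (\<lambda>t. f (e t))"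
    by (rule continuous_on_compose2[OF holomorphic_on_imp_continuous_on[OF f] ce_cont sub])
  have X_cont: "continuous_on {0..1} X"
    unfolding X_def by (intro continuous_intros fc)
  have Xp_cont: "continuous_on {0..1} (\<lambda>t. X t powr p)"
    using X_cont p by (intro continuous_on_powr') (auto simp: X_def)
  obtain I where I: "((\<lambda>t. X t powr p * P t) has_integral I) {0..1}"
    using integrable_continuous_real[OF continuous_on_mult[OF Xp_cont P_cont]] by blast
  obtain J where J: "((\<lambda>t. X t * P t) has_integral J) {0..1}"
    using integrable_continuous_real[OF continuous_on_mult[OF X_cont P_cont]] by blast
  have "cmod (f w) powr p \<le> I"
  proof (cases "f w = 0")
    case True
    have "0 \<le> I" by (rule has_integral_nonneg[OF I]) (use P0 in auto)
    thus ?thesis using True by simp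
  next
    case False
    define y where "y = cmod (f w)"
    have y: "y > 0" using False by (simp add: y_def)
    have "norm (integral {0..1} (\<lambda>t. f (e t) * of_real (P t))) \<le> integral {0..1} (\<lambda>t. X t * P t)"
      using poi[OF f] J P0 by (intro integral_norm_bound_integral) (auto simp: norm_mult X_def)
    hence yJ: "y \<le> J" using integral_unique[OF poi[OF f]] integral_unique[OF J] by (simp add: y_def)
    have "((\<lambda>t. (y powr p - p * y powr (p - 1) * y) * P t + p * y powr (p - 1) * (X t * P t)) has_integral
        (y powr p - p * y powr (p - 1) * y) * 1 + p * y powr (p - 1) * J) {0..1}"
      by (intro has_integral_add has_integral_mult_right P1 J)
    hence "(y powr p - p * y powr (p - 1) * y) * 1 + p * y powr (p - 1) * J \<le> I"
    proof (rule has_integral_le[OF _ I])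
      fix t
      have "(y powr p + p * y powr (p - 1) * (X t - y)) * P t \<le> X t powr p * P t"
        using p y P0 by (intro mult_right_mono powr_above_tangent) (auto simp: X_def)
      thus "(y powr p - p * y powr (p - 1) * y) * P t + p * y powr (p - 1) * (X t * P t) \<le> X t powr p * P t"
        by (simp add: algebra_simps)
    qed
    moreover have "p * y powr (p - 1) * y \<le> p * y powr (p - 1) * J" using yJ p by (intro mult_left_mono) auto
    ultimately show ?thesis by (simp add: y_def)
  qed
  hence "ennreal (cmod (f w) powr p) \<le> ennreal I" by (rule ennreal_leI)
  also have "\<dots> = (\<integral>\<^sup>+t. ennreal (X t powr p * P t) * indicator {0..1} t \<partial>lborel)"
    by (rule nn_integral_has_integral_lebesgue'[OF _ I, symmetric]) (use P0 in auto)
  finally show ?thesis by (simp add: X_def P_def \<rho>_def)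
qed

context disc_weight
begin

text \<open>
  In a cell \<open>\<bar>1 - cnj a w\<bar>\<close> is at most \<open>beta\<close> times \<open>1 - \<bar>a\<bar>\<close>. The summand \<open>\<kappa> + 1\<close> of \<open>beta\<close> comes from the width
  of the annulus, and 8 from the angle \<open>2 \<pi> / num i\<close> between neighbouring nodes.
\<close>

definition beta :: real where "beta = real \<kappa> + 9"
definition cell :: "nat \<times> nat \<Rightarrow> complex set" where
  "cell k = {w. cmod w \<le> rho (fst k) \<and> cmod (1 - cnj (node k) * w) \<le> beta / real (num (fst k))}"

lemma beta_ge: "beta \<ge> 13"
  using kappa by (simp add: beta_def)

lemma cell_cover:
  assumes z: "z \<in> annulus \<kappa> i"
  obtains l where "l < num i" "z \<in> cell (i, l)"
proof -
  define N where "N = real (num i)"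
  have N: "N > 0" by (simp add: N_def)
  define \<theta> where "\<theta> = Arg2pi z"
  have \<theta>: "0 \<le> \<theta>" "\<theta> < 2 * pi" and zeq: "z = of_real (cmod z) * exp (\<i> * of_real \<theta>)"
    using Arg2pi[of z] by (auto simp: \<theta>_def is_Arg_def)
  define l where "l = nat \<lfloor>N * \<theta> / (2 * pi)\<rfloor>"
  have fl: "real l = of_int \<lfloor>N * \<theta> / (2 * pi)\<rfloor>" using \<theta> N by (simp add: l_def)
  have l1: "real l \<le> N * \<theta> / (2 * pi)" "N * \<theta> / (2 * pi) < real l + 1" unfolding fl by linarith+
  have "N * \<theta> / (2 * pi) < N" using \<theta> N by (simp add: field_simps)
  hence lN: "l < num i" using l1 unfolding N_def by linarith
  define \<delta> where "\<delta> = \<theta> - 2 * pi * real l / N"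
  have "\<delta> = 2 * pi / N * (N * \<theta> / (2 * pi) - real l)" using N by (simp add: \<delta>_def field_simps)
  moreover have "2 * pi / N * (N * \<theta> / (2 * pi) - real l) \<le> 2 * pi / N * 1" using l1 N by (intro mult_left_mono) auto
  moreover have "2 * pi / N * (N * \<theta> / (2 * pi) - real l) \<ge> 0" using l1 N by simp
  moreover have "2 * pi / N \<le> 8 / N" using pi_less_4 N by (intro divide_right_mono) auto
  ultimately have \<delta>: "\<bar>\<delta>\<bar> \<le> 8 / N" by simp
  have az: "cnj (node (i, l)) * z = of_real (rho i * cmod z) * exp (\<i> * of_real \<delta>)"
  proof -
    have "cnj (unit_root (num i) l) = exp (\<i> * of_real (- (2 * pi * real l / N)))"
      unfolding unit_root_def cis_cnj by (simp only: cis_conv_exp N_def)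
    hence "cnj (node (i, l)) * z = of_real (rho i) * (exp (\<i> * of_real (- (2 * pi * real l / N))) * (of_real (cmod z) * exp (\<i> * of_real \<theta>)))"
      using zeq by (simp add: node_def)
    also have "\<dots> = of_real (rho i * cmod z) * (exp (\<i> * of_real (- (2 * pi * real l / N))) * exp (\<i> * of_real \<theta>))" by simp
    also have "exp (\<i> * of_real (- (2 * pi * real l / N))) * exp (\<i> * of_real \<theta>) = exp (\<i> * of_real \<delta>)"
      by (simp add: \<delta>_def right_diff_distrib flip: exp_add)
    finally show ?thesis .
  qed
  define x where "x = rho i * cmod z"
  have z1: "1 - real \<kappa> / N \<le> cmod z" "cmod z < rho i" using z by (auto simp: annulus_iff N_def)
  have x: "0 \<le> x" "x \<le> 1" using rho_bounds[of i] z1 by (auto simp: x_def intro: mult_le_one)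
  have "1 - x \<le> (1 - rho i) + (1 - cmod z)"
  proof -
    have "0 \<le> (1 - rho i) * (1 - cmod z)" using rho_bounds[of i] z1 by simp
    thus ?thesis by (simp add: x_def algebra_simps)
  qed
  hence x2: "1 - x \<le> (1 + real \<kappa>) / N" using z1 by (simp add: rho_def N_def add_divide_distrib)
  have "cmod (1 - of_real x * exp (\<i> * of_real \<delta>)) = cmod (of_real (1 - x) + of_real x * (1 - exp (\<i> * of_real \<delta>)))"
    by (simp add: algebra_simps)
  also have "\<dots> \<le> cmod (of_real (1 - x) :: complex) + cmod (of_real x * (1 - exp (\<i> * of_real \<delta>)))"
    by (rule norm_triangle_ineq)
  also have "\<dots> = (1 - x) + x * dist (exp (\<i> * of_real \<delta>)) 1"
    using x by (simp add: norm_mult dist_norm norm_minus_commute del: of_real_diff)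
  also have "dist (exp (\<i> * of_real \<delta>)) 1 \<le> \<bar>\<delta>\<bar>"
    using abs_sin_x_le_abs_x[of "\<delta> / 2"] by (simp add: dist_norm dist_exp_i_1)
  hence "(1 - x) + x * dist (exp (\<i> * of_real \<delta>)) 1 \<le> (1 - x) + 1 * \<bar>\<delta>\<bar>"
    using x by (intro add_left_mono mult_mono) auto
  also have "\<dots> \<le> beta / N" using x2 \<delta> by (simp add: beta_def add_divide_distrib)
  finally have "z \<in> cell (i, l)" using az z1 by (simp add: cell_def x_def N_def)
  with lN show thesis by (rule that)
qed

lemma compact_cell: "compact (cell k)"
proof -
  have "cell k = cball 0 (rho (fst k)) \<inter> {w. cmod (1 - cnj (node k) * w) \<le> beta / real (num (fst k))}"
    by (auto simp: cell_def)
  moreover have "closed {w. cmod (1 - cnj (node k) * w) \<le> beta / real (num (fst k))}"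
    by (intro closed_Collect_le continuous_intros)
  ultimately show ?thesis by (simp add: compact_Int_closed)
qed

lemma cell_subset_ball: "cell k \<subseteq> ball 0 1"
  using rho_bounds[of "fst k"] by (auto simp: cell_def)

lemma node_in_cell: "node k \<in> cell k"
proof -
  have "cnj (node k) * node k = of_real ((rho (fst k))\<^sup>2)"
    using complex_norm_square[of "node k"] by (simp add: norm_node mult.commute)
  hence "cmod (1 - cnj (node k) * node k) = cmod (of_real (1 - (rho (fst k))\<^sup>2))" by simp
  also have "\<dots> = 1 - (rho (fst k))\<^sup>2" using rho_bounds[of "fst k"] by (simp add: power_le_one del: of_real_diff)
  also have "\<dots> = (1 - rho (fst k)) * (1 + rho (fst k))" by (simp add: power2_eq_square algebra_simps)
  also have "\<dots> \<le> (1 - rho (fst k)) * beta" using rho_bounds[of "fst k"] beta_ge by (intro mult_left_mono) auto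
  also have "\<dots> = beta / real (num (fst k))" by (simp add: rho_def)
  finally show ?thesis by (simp add: cell_def norm_node)
qed

lemma norm_kern_cell: "w \<in> cell k \<Longrightarrow> 1 / beta \<le> cmod (kern k w)"
  using one_minus_neq_0[of w k] cell_subset_ball[of k] beta_ge by (auto simp: cell_def norm_kern field_simps)

text \<open>
  Cauchy's estimate on a circle of radius \<open>1 / (2 num i)\<close>, which trades the derivative for a
  value of \<open>f\<close> at a point \<open>w'\<close> of a slightly larger cell.
\<close>

lemma cell_derivative_bound:
  assumes f: "f holomorphic_on ball 0 1" and w: "w \<in> cell k"
  obtains w' where "cmod w' \<le> 1 - 1 / (2 * real (num (fst k)))"
    "cmod (1 - cnj (node k) * w') \<le> (beta + 1) / real (num (fst k))"
    "cmod ((deriv ^^ n) f w) / real (num (fst k)) ^ n \<le> fact n * 2 ^ n * cmod (f w')"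
proof -
  define N where "N = real (num (fst k))"
  have N: "N \<ge> 4" using num_ge[of "fst k"] by (simp add: N_def)
  define r where "r = 1 / (2 * N)"
  have r: "r > 0" using N by (simp add: r_def)
  have wn: "cmod w \<le> 1 - 2 * r" and wc: "cmod (1 - cnj (node k) * w) \<le> beta / N"
    using w by (auto simp: cell_def rho_def r_def N_def)
  have cb: "cmod v \<le> 1 - r" if "v \<in> cball w r" for v
    using that wn norm_triangle_ineq2[of v w] by (simp add: dist_norm norm_minus_commute)
  hence sub: "cball w r \<subseteq> ball 0 1" using r by fastforce
  have cont: "continuous_on (cball w r) f"
    using f sub by (meson continuous_on_subset holomorphic_on_imp_continuous_on)
  obtain w' where w': "w' \<in> sphere w r" "\<And>v. v \<in> sphere w r \<Longrightarrow> cmod (f v) \<le> cmod (f w')"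
  proof -
    have "continuous_on (sphere w r) (\<lambda>v. cmod (f v))"
      by (intro continuous_intros continuous_on_subset[OF cont]) auto
    from continuous_attains_sup[OF compact_sphere _ this] show ?thesis using that r by auto
  qed
  have "cmod ((deriv ^^ n) f w) \<le> fact n * cmod (f w') / r ^ n"
    using r sub w'(2) by (intro Cauchy_inequality holomorphic_on_subset[OF f] cont) (auto simp: dist_norm)
  hence "cmod ((deriv ^^ n) f w) / N ^ n \<le> (fact n * cmod (f w') / r ^ n) / N ^ n"
    using N by (intro divide_right_mono) auto
  also have "\<dots> = fact n * 2 ^ n * cmod (f w')" using N by (simp add: r_def power_one_over power_mult_distrib field_simps)
  finally have 3: "cmod ((deriv ^^ n) f w) / N ^ n \<le> fact n * 2 ^ n * cmod (f w')" .
  have 2: "cmod (1 - cnj (node k) * w') \<le> (beta + 1) / N"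
  proof -
    have "cmod (1 - cnj (node k) * w') = cmod ((1 - cnj (node k) * w) + cnj (node k) * (w - w'))" by (simp add: algebra_simps)
    also have "\<dots> \<le> cmod (1 - cnj (node k) * w) + cmod (cnj (node k) * (w - w'))" by (rule norm_triangle_ineq)
    also have "cmod (cnj (node k) * (w - w')) = rho (fst k) * r" using w'(1) by (simp add: norm_mult norm_node dist_norm)
    also have "\<dots> \<le> 1 * (1 / N)" using rho_bounds[of "fst k"] r N by (intro mult_mono) (auto simp: r_def field_simps)
    finally show ?thesis using wc by (simp add: add_divide_distrib)
  qed
  have 1: "cmod w' \<le> 1 - 1 / (2 * N)" using cb[of w'] w'(1) by (simp add: r_def)
  show thesis using that 1 2 3 unfolding N_def by blast
qed

text \<open>
  For \<open>\<zeta>\<close> further out than the enlarged cell, \<open>\<bar>\<zeta> - w\<bar>\<close> is comparable with \<open>\<bar>1 - cnj a \<zeta>\<bar>\<close>, uniformly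
  for \<open>w\<close> in that cell. The kernel may thus be taken at the node, where the sum over a level is known.
\<close>

lemma poisson_kernel_cell:
  assumes w: "cmod w \<le> 1 - 1 / (2 * real (num (fst k)))" "cmod (1 - cnj (node k) * w) \<le> (beta + 1) / real (num (fst k))"
    and \<zeta>: "1 - 1 / (4 * real (num (fst k))) \<le> cmod \<zeta>" "cmod \<zeta> < 1"
  shows "((cmod \<zeta>)\<^sup>2 - (cmod w)\<^sup>2) / (cmod (\<zeta> - w))\<^sup>2 \<le> 2 * (beta + 1) * (4 * beta + 5)\<^sup>2 / real (num (fst k)) * (1 / (cmod (1 - cnj (node k) * \<zeta>))\<^sup>2)"
proof -
  define N where "N = real (num (fst k))"
  have N: "N \<ge> 4" using num_ge[of "fst k"] by (simp add: N_def)
  have w1: "cmod w < 1" using w(1) N unfolding N_def[symmetric] by (smt (verit) divide_pos_pos)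
  have "(cmod \<zeta>)\<^sup>2 - (cmod w)\<^sup>2 \<le> 1 - (cmod w)\<^sup>2" using \<zeta> by (simp add: power_le_one)
  also have "\<dots> = (1 - cmod w) * (1 + cmod w)" by (simp add: power2_eq_square algebra_simps)
  also have "\<dots> \<le> (1 - cmod w) * 2" using w1 by (intro mult_left_mono) auto
  also have "1 - cmod w \<le> (beta + 1) / N" using norm_one_minus_ge(2)[OF w1, of k] w(2) by (simp add: N_def)
  also have "(beta + 1) / N * 2 = 2 * (beta + 1) / N" by simp
  finally have num: "(cmod \<zeta>)\<^sup>2 - (cmod w)\<^sup>2 \<le> 2 * (beta + 1) / N" by simp
  have d0: "1 / (4 * N) \<le> cmod (\<zeta> - w)"
  proof -
    have "1 / (4 * N) = (1 - 1 / (4 * N)) - (1 - 1 / (2 * N))" using N by (simp add: field_simps)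
    also have "\<dots> \<le> cmod \<zeta> - cmod w" using w \<zeta> by (simp add: N_def)
    also have "\<dots> \<le> cmod (\<zeta> - w)" by (rule norm_triangle_ineq2)
    finally show ?thesis .
  qed
  have "cmod (1 - cnj (node k) * \<zeta>) = cmod ((1 - cnj (node k) * w) - cnj (node k) * (\<zeta> - w))" by (simp add: algebra_simps)
  also have "\<dots> \<le> cmod (1 - cnj (node k) * w) + cmod (cnj (node k) * (\<zeta> - w))" by (rule norm_triangle_ineq4)
  also have "cmod (cnj (node k) * (\<zeta> - w)) \<le> 1 * cmod (\<zeta> - w)"
    unfolding norm_mult complex_mod_cnj norm_node using rho_bounds[of "fst k"] by (intro mult_right_mono) auto
  also have "cmod (1 - cnj (node k) * w) \<le> 4 * (beta + 1) * (1 / (4 * N))" using w N by (simp add: N_def field_simps)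
  also have "4 * (beta + 1) * (1 / (4 * N)) \<le> 4 * (beta + 1) * cmod (\<zeta> - w)" using d0 beta_ge by (intro mult_left_mono) auto
  finally have den: "cmod (1 - cnj (node k) * \<zeta>) \<le> (4 * beta + 5) * cmod (\<zeta> - w)" by (simp add: algebra_simps)
  have pos: "0 < cmod (1 - cnj (node k) * \<zeta>)" using one_minus_neq_0[OF \<zeta>(2)] by simp
  have "0 < 1 / (4 * N)" using N by simp
  hence pos2: "0 < cmod (\<zeta> - w)" using d0 by linarith
  have "(cmod (1 - cnj (node k) * \<zeta>))\<^sup>2 \<le> ((4 * beta + 5) * cmod (\<zeta> - w))\<^sup>2" using den by (intro power_mono) auto
  hence le: "(cmod (1 - cnj (node k) * \<zeta>))\<^sup>2 \<le> (4 * beta + 5)\<^sup>2 * (cmod (\<zeta> - w))\<^sup>2" by (simp only: power_mult_distrib)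
  have "1 / X \<le> C * (1 / Y)" if "Y \<le> C * X" "0 < X" "0 < Y" for X Y C :: real
    using that by (simp add: field_simps)
  from this[OF le] have "1 / (cmod (\<zeta> - w))\<^sup>2 \<le> (4 * beta + 5)\<^sup>2 * (1 / (cmod (1 - cnj (node k) * \<zeta>))\<^sup>2)"
    using pos pos2 by (simp only: zero_less_power)
  hence "((cmod \<zeta>)\<^sup>2 - (cmod w)\<^sup>2) * (1 / (cmod (\<zeta> - w))\<^sup>2) \<le> (2 * (beta + 1) / N) * ((4 * beta + 5)\<^sup>2 * (1 / (cmod (1 - cnj (node k) * \<zeta>))\<^sup>2))"
    using num N beta_ge by (intro mult_mono) auto
  thus ?thesis by (simp add: N_def mult_ac)
qed

sublocale sigma_finite_measure \<mu>
proof
  let ?A = "insert (- ball 0 1) (range (annulus \<kappa>))"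
  have "z \<in> \<Union>?A" for z
  proof (cases "cmod z < 1")
    case True
    then obtain j where "z \<in> annulus \<kappa> j" using annulus_cover by auto
    thus ?thesis by auto
  next
    case False
    hence "z \<in> - ball 0 1" by simp
    thus ?thesis by blast
  qed
  hence "\<Union>?A = space \<mu>"
    using sets_eq_imp_space_eq[OF sets_mu] by (metis UNIV_I UNIV_eq_I space_borel)
  moreover have "emeasure \<mu> (annulus \<kappa> j) \<noteq> \<infinity>" for j
    using annulus_upper[of j] by (auto simp: top_unique)
  ultimately show "\<exists>A. countable A \<and> A \<subseteq> sets \<mu> \<and> \<Union>A = space \<mu> \<and> (\<forall>a\<in>A. emeasure \<mu> a \<noteq> \<infinity>)"
    using sets_mu outside annulus_borel by (intro exI[of _ ?A] conjI) (simp_all add: image_subset_iff)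
qed

definition annulus_integral :: "real \<Rightarrow> (complex \<Rightarrow> complex) \<Rightarrow> nat \<Rightarrow> ennreal" where
  "annulus_integral p f j = (\<integral>\<^sup>+z. ennreal (cmod (f z) powr p) * indicator (annulus \<kappa> j) z \<partial>\<mu>)"

lemma annulus_power_borel:
  assumes "f holomorphic_on ball 0 1"
  shows "(\<lambda>z. ennreal (cmod (f z) powr p) * indicator (annulus \<kappa> j) z) \<in> borel_measurable borel"
proof -
  note [measurable] = borel_on_ball[OF assms]
  have "(\<lambda>z. ennreal (cmod (f z) powr p) * indicator (annulus \<kappa> j) z) =
    (\<lambda>z. ennreal (cmod (f z * indicator (ball 0 1) z) powr p) * indicator (annulus \<kappa> j) z)"
    using annulus_subset_ball by (auto split: split_indicator)
  thus ?thesis by simp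
qed

lemma annulus_integral_sum_le:
  assumes f: "f holomorphic_on ball 0 1" and F: "finite F"
  shows "(\<Sum>i\<in>F. annulus_integral p f (i + 2)) \<le> disc_power_integral \<mu> p f"
proof -
  note [measurable] = annulus_power_borel[OF f]
  have "(\<Sum>i\<in>F. annulus_integral p f (i + 2)) = (\<integral>\<^sup>+z. (\<Sum>i\<in>F. ennreal (cmod (f z) powr p) * indicator (annulus \<kappa> (i + 2)) z) \<partial>\<mu>)"
    unfolding annulus_integral_def by (rule nn_integral_sum[symmetric]) measurable
  also have "\<dots> \<le> disc_power_integral \<mu> p f"
    unfolding disc_power_integral_def
  proof (intro nn_integral_mono)
    fix z
    have disj: "i = j" if "z \<in> annulus \<kappa> (i + 2)" "z \<in> annulus \<kappa> (j + 2)" for i j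
    proof (rule ccontr)
      have aux: False if "z \<in> annulus \<kappa> (i + 2)" "z \<in> annulus \<kappa> (j + 2)" "i < j" for i j
      proof -
        have "real \<kappa> ^ Suc (i + 2) \<le> real \<kappa> ^ (j + 2)" using that(3) kappa by (intro power_increasing) auto
        hence "1 / real \<kappa> ^ (j + 2) \<le> 1 / real \<kappa> ^ Suc (i + 2)" using kappa by (intro divide_left_mono) auto
        thus False using that(1,2) by (simp add: annulus_def)
      qed
      assume "i \<noteq> j" thus False using aux that by (metis nat_neq_iff)
    qed
    show "(\<Sum>i\<in>F. ennreal (cmod (f z) powr p) * indicator (annulus \<kappa> (i + 2)) z) \<le> ennreal (cmod (f z) powr p) * indicator (ball 0 1) z"
    proof (cases "\<exists>j\<in>F. z \<in> annulus \<kappa> (j + 2)")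
      case True
      then obtain j where j: "j \<in> F" "z \<in> annulus \<kappa> (j + 2)" by blast
      have "(\<Sum>i\<in>F. ennreal (cmod (f z) powr p) * indicator (annulus \<kappa> (i + 2)) z) = (\<Sum>i\<in>F. if i = j then ennreal (cmod (f z) powr p) else 0)"
        by (intro sum.cong refl) (use j disj in \<open>auto split: split_indicator\<close>)
      also have "\<dots> = ennreal (cmod (f z) powr p)" using j F by simp
      finally show ?thesis using annulus_subset_ball[OF j(2)] by simp
    next
      case False
      hence "(\<Sum>i\<in>F. ennreal (cmod (f z) powr p) * indicator (annulus \<kappa> (i + 2)) z) = 0" by (auto intro!: sum.neutral)
      thus ?thesis by simp
    qed
  qed
  finally show ?thesis .
qed

lemma sampling_circle:
  assumes f: "f holomorphic_on ball 0 1" and p: "1 \<le> p"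
    and w: "\<And>l. l < num i \<Longrightarrow> cmod (w l) \<le> 1 - 1 / (2 * real (num i))"
      "\<And>l. l < num i \<Longrightarrow> cmod (1 - cnj (node (i, l)) * w l) \<le> (beta + 1) / real (num i)"
    and z: "z \<in> annulus \<kappa> (i + 2)"
  shows "ennreal (\<Sum>l<num i. cmod (f (w l)) powr p) \<le>
     ennreal (8 * (beta + 1) * (4 * beta + 5)\<^sup>2 * real (num i)) *
      (\<integral>\<^sup>+t. ennreal (cmod (f (z * exp (2 * of_real pi * \<i> * of_real t))) powr p) * indicator {0..1} t \<partial>lborel)"
proof -
  define N where "N = real (num i)"
  have N: "N \<ge> 4" using num_ge[of i] by (simp add: N_def)
  define B where "B = 2 * (beta + 1) * (4 * beta + 5)\<^sup>2"
  have B: "B > 0" using beta_ge by (simp add: B_def)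
  define e where "e t = z * exp (2 * of_real pi * \<i> * of_real t)" for t :: real
  have z1: "cmod z < 1" by (rule annulus_subset_ball[OF z])
  have z2: "1 - 1 / (4 * N) \<le> cmod z"
  proof -
    have "real \<kappa> / real (num (i + 2)) = 1 / (real \<kappa> * N)" using kappa by (simp add: num_def N_def)
    also have "\<dots> \<le> 1 / (4 * N)" using kappa N by (intro divide_left_mono mult_right_mono) auto
    finally show ?thesis using z by (simp add: annulus_iff)
  qed
  have ce: "cmod (e t) = cmod z" for t by (simp add: e_def norm_mult)
  have wz: "cmod (w l) < cmod z" if "l < num i" for l
  proof -
    have "1 / (4 * N) < 1 / (2 * N)" using N by (simp add: field_simps)
    thus ?thesis using w(1)[OF that] z2 by (simp add: N_def)
  qed
  note [measurable] = borel_on_ball[OF f]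
  have [measurable]: "e \<in> borel_measurable borel" unfolding e_def by measurable
  have fe: "f (e t) = f (e t) * indicator (ball 0 1) (e t)" for t using ce[of t] z1 by simp
  have [measurable]: "(\<lambda>t. f (e t)) \<in> borel_measurable borel" by (subst fe) measurable
  define P where "P l t = ((cmod z)\<^sup>2 - (cmod (w l))\<^sup>2) / (cmod (e t - w l))\<^sup>2" for l t
  have "ennreal (\<Sum>l<num i. cmod (f (w l)) powr p) = (\<Sum>l<num i. ennreal (cmod (f (w l)) powr p))"
    by (rule sum_ennreal[symmetric]) simp
  also have "\<dots> \<le> (\<Sum>l<num i. \<integral>\<^sup>+t. ennreal (cmod (f (e t)) powr p * P l t) * indicator {0..1} t \<partial>lborel)"
    unfolding e_def P_def by (intro sum_mono poisson_jensen[OF f z1 _ p] wz) auto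
  also have "\<dots> = (\<integral>\<^sup>+t. (\<Sum>l<num i. ennreal (cmod (f (e t)) powr p * P l t) * indicator {0..1} t) \<partial>lborel)"
    unfolding P_def by (rule nn_integral_sum[symmetric]) measurable
  also have "\<dots> \<le> (\<integral>\<^sup>+t. ennreal (4 * B * N) * (ennreal (cmod (f (e t)) powr p) * indicator {0..1} t) \<partial>lborel)"
  proof (intro nn_integral_mono)
    fix t :: real
    have P0: "0 \<le> P l t" if "l < num i" for l using wz[OF that] by (simp add: P_def power_mono)
    have "(\<Sum>l<num i. P l t) \<le> (\<Sum>l<num i. B / N * (1 / (cmod (1 - cnj (node (i, l)) * e t))\<^sup>2))"
      unfolding B_def N_def P_def
      by (intro sum_mono poisson_kernel_cell[where \<zeta> = "e t" and k = "(i, _)", unfolded ce fst_conv])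
         (use w z1 z2 in \<open>auto simp: N_def\<close>)
    also have "\<dots> = B / N * (\<Sum>l<num i. 1 / (cmod (1 - cnj (node (i, l)) * e t))\<^sup>2)" by (simp add: sum_distrib_left)
    also have "\<dots> \<le> B / N * (4 * N ^ 2)"
      unfolding N_def using B z1 ce[of t] by (intro mult_left_mono sum_inverse_norm_sq_node) auto
    also have "\<dots> = 4 * B * N" using N by (simp add: power2_eq_square)
    finally have le: "(\<Sum>l<num i. P l t) \<le> 4 * B * N" .
    have "(\<Sum>l<num i. ennreal (cmod (f (e t)) powr p * P l t)) = ennreal (\<Sum>l<num i. cmod (f (e t)) powr p * P l t)"
      using P0 by (intro sum_ennreal) auto
    also have "\<dots> = ennreal (cmod (f (e t)) powr p * (\<Sum>l<num i. P l t))" by (simp add: sum_distrib_left)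
    also have "\<dots> \<le> ennreal (cmod (f (e t)) powr p * (4 * B * N))" using le by (intro ennreal_leI mult_left_mono) auto
    also have "\<dots> = ennreal (4 * B * N) * ennreal (cmod (f (e t)) powr p)"
      using B N by (subst ennreal_mult[symmetric]) (auto simp: mult.commute)
    finally show "(\<Sum>l<num i. ennreal (cmod (f (e t)) powr p * P l t) * indicator {0..1} t) \<le> ennreal (4 * B * N) * (ennreal (cmod (f (e t)) powr p) * indicator {0..1} t)"
      by (cases "t \<in> {0..1}") simp_all
  qed
  also have "\<dots> = ennreal (4 * B * N) * (\<integral>\<^sup>+t. ennreal (cmod (f (e t)) powr p) * indicator {0..1} t \<partial>lborel)"
    by (rule nn_integral_cmult) measurable
  also have "4 * B * N = 8 * (beta + 1) * (4 * beta + 5)\<^sup>2 * real (num i)" by (simp add: B_def N_def)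
  finally show ?thesis unfolding e_def .
qed

text \<open>
  The estimate on circles is averaged over the annulus of index \<open>i + 2\<close>. By Fubini's theorem and
  rotation invariance the additional mean over the circle disappears.
\<close>

lemma sampling_level:
  assumes f: "f holomorphic_on ball 0 1" and p: "1 \<le> p"
    and w: "\<And>l. l < num i \<Longrightarrow> cmod (w l) \<le> 1 - 1 / (2 * real (num i))"
      "\<And>l. l < num i \<Longrightarrow> cmod (1 - cnj (node (i, l)) * w l) \<le> (beta + 1) / real (num i)"
  shows "ennreal (V i / real (num i) * (\<Sum>l<num i. cmod (f (w l)) powr p)) \<le>
     ennreal (8 * (beta + 1) * (4 * beta + 5)\<^sup>2 / c) * annulus_integral p f (i + 2)"
proof -
  define S where "S = (\<Sum>l<num i. cmod (f (w l)) powr p)"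
  have S0: "S \<ge> 0" unfolding S_def by (intro sum_nonneg) auto
  define B where "B = 8 * (beta + 1) * (4 * beta + 5)\<^sup>2"
  have B: "B > 0" using beta_ge by (simp add: B_def)
  define A where "A = annulus \<kappa> (i + 2)"
  define g where "g z = ennreal (cmod (f z) powr p) * indicator A z" for z
  have [measurable]: "g \<in> borel_measurable borel" unfolding g_def A_def by (rule annulus_power_borel[OF f])
  have [measurable]: "A \<in> sets borel" by (simp add: A_def)
  interpret ps: pair_sigma_finite \<mu> "lborel :: real measure" ..
  have rot: "(\<integral>\<^sup>+z. g (exp (2 * of_real pi * \<i> * of_real t) * z) \<partial>\<mu>) = (\<integral>\<^sup>+z. g z \<partial>\<mu>)" for t :: real
    by (rule rotation) auto
  have gz: "ennreal (cmod (f (z * exp (2 * of_real pi * \<i> * of_real t))) powr p) * indicator A z = g (exp (2 * of_real pi * \<i> * of_real t) * z)" for z and t :: real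
    by (simp add: g_def A_def annulus_def norm_mult mult.commute indicator_def)
  have "ennreal S * ennreal (c * V i) \<le> ennreal S * emeasure \<mu> A"
    unfolding A_def by (intro mult_left_mono annulus_lower) auto
  also have "\<dots> = (\<integral>\<^sup>+z. ennreal S * indicator A z \<partial>\<mu>)"
    by (rule nn_integral_cmult_indicator[symmetric]) simp
  also have "\<dots> \<le> (\<integral>\<^sup>+z. ennreal (B * real (num i)) * (\<integral>\<^sup>+t. g (exp (2 * of_real pi * \<i> * of_real t) * z) * indicator {0..1} t \<partial>lborel) \<partial>\<mu>)"
  proof (intro nn_integral_mono)
    fix z
    show "ennreal S * indicator A z \<le> ennreal (B * real (num i)) * (\<integral>\<^sup>+t. g (exp (2 * of_real pi * \<i> * of_real t) * z) * indicator {0..1} t \<partial>lborel)"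
    proof (cases "z \<in> A")
      case True
      have "ennreal S \<le> ennreal (B * real (num i)) * (\<integral>\<^sup>+t. ennreal (cmod (f (z * exp (2 * of_real pi * \<i> * of_real t))) powr p) * indicator {0..1} t \<partial>lborel)"
        unfolding S_def B_def using True by (intro sampling_circle f p w) (auto simp: A_def)
      also have "(\<lambda>t::real. ennreal (cmod (f (z * exp (2 * of_real pi * \<i> * of_real t))) powr p)) = (\<lambda>t. g (exp (2 * of_real pi * \<i> * of_real t) * z))"
        using gz[of z] True by (simp add: fun_eq_iff)
      finally show ?thesis using True by simp
    qed simp
  qed
  also have "\<dots> = ennreal (B * real (num i)) * (\<integral>\<^sup>+z. (\<integral>\<^sup>+t. g (exp (2 * of_real pi * \<i> * of_real t) * z) * indicator {0..1} t \<partial>lborel) \<partial>\<mu>)"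
    by (rule nn_integral_cmult) measurable
  also have "(\<integral>\<^sup>+z. (\<integral>\<^sup>+t. g (exp (2 * of_real pi * \<i> * of_real t) * z) * indicator {0..1} t \<partial>lborel) \<partial>\<mu>)
      = (\<integral>\<^sup>+t. (\<integral>\<^sup>+z. g (exp (2 * of_real pi * \<i> * of_real t) * z) * indicator {0..1} t \<partial>\<mu>) \<partial>lborel)"
    by (rule ps.Fubini'[symmetric]) measurable
  also have "\<dots> = (\<integral>\<^sup>+t. (\<integral>\<^sup>+z. g z \<partial>\<mu>) * indicator {0..1::real} t \<partial>lborel)"
    by (intro nn_integral_cong) (subst nn_integral_multc, measurable, simp add: rot)
  also have "\<dots> = (\<integral>\<^sup>+z. g z \<partial>\<mu>) * emeasure lborel {0..1::real}"
    by (rule nn_integral_cmult_indicator) simp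
  also have "\<dots> = annulus_integral p f (i + 2)"
    unfolding annulus_integral_def g_def A_def by simp
  finally have le: "ennreal S * ennreal (c * V i) \<le> ennreal (B * real (num i)) * annulus_integral p f (i + 2)" .
  have "ennreal (V i / real (num i) * S) = ennreal (1 / (c * real (num i))) * (ennreal S * ennreal (c * V i))"
    using c_pos V_pos[of i] S0 by (simp flip: ennreal_mult)
  also have "\<dots> \<le> ennreal (1 / (c * real (num i))) * (ennreal (B * real (num i)) * annulus_integral p f (i + 2))"
    using le by (rule mult_left_mono) simp
  also have "\<dots> = ennreal (B / c) * annulus_integral p f (i + 2)"
    using c_pos B by (simp add: mult.assoc[symmetric] ennreal_mult[symmetric])
  finally show ?thesis by (simp add: S_def B_def)
qed

text \<open>
  Levels are estimated one at a time, each through its own annulus; the annuli are disjoint.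
\<close>

theorem sampling:
  assumes p: "1 \<le> p"
  obtains C where "C > 0"
    "\<And>f w K. f holomorphic_on ball 0 1 \<Longrightarrow> (\<And>k. k \<in> nodes \<Longrightarrow> w k \<in> cell k) \<Longrightarrow> finite K \<Longrightarrow> K \<subseteq> nodes \<Longrightarrow>
       ennreal (\<Sum>k\<in>K. mass k * (cmod ((deriv ^^ n) f (w k)) / real (num (fst k)) ^ n) powr p) \<le> ennreal C * disc_power_integral \<mu> p f"
proof -
  define B where "B = 8 * (beta + 1) * (4 * beta + 5)\<^sup>2 / c"
  have B: "B > 0" using beta_ge c_pos by (simp add: B_def)
  define a where "a = (fact n * 2 ^ n) powr p"
  have a: "a > 0" by (simp add: a_def)
  have "ennreal (\<Sum>k\<in>K. mass k * (cmod ((deriv ^^ n) f (w k)) / real (num (fst k)) ^ n) powr p) \<le> ennreal (a * B) * disc_power_integral \<mu> p f"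
    if f: "f holomorphic_on ball 0 1" and w: "\<And>k. k \<in> nodes \<Longrightarrow> w k \<in> cell k" and K: "finite K" "K \<subseteq> nodes" for f w K
  proof -
    have "\<exists>w'. cmod w' \<le> 1 - 1 / (2 * real (num (fst k))) \<and> cmod (1 - cnj (node k) * w') \<le> (beta + 1) / real (num (fst k)) \<and>
        cmod ((deriv ^^ n) f (w k)) / real (num (fst k)) ^ n \<le> fact n * 2 ^ n * cmod (f w')" if "k \<in> nodes" for k
      using cell_derivative_bound[OF f w[OF that], of n] by metis
    then obtain w' where w': "\<And>k. k \<in> nodes \<Longrightarrow> cmod (w' k) \<le> 1 - 1 / (2 * real (num (fst k)))"
        "\<And>k. k \<in> nodes \<Longrightarrow> cmod (1 - cnj (node k) * w' k) \<le> (beta + 1) / real (num (fst k))"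
        "\<And>k. k \<in> nodes \<Longrightarrow> cmod ((deriv ^^ n) f (w k)) / real (num (fst k)) ^ n \<le> fact n * 2 ^ n * cmod (f (w' k))"
      by metis
    have "(\<Sum>k\<in>K. mass k * (cmod ((deriv ^^ n) f (w k)) / real (num (fst k)) ^ n) powr p) \<le> (\<Sum>k\<in>K. a * (mass k * cmod (f (w' k)) powr p))"
    proof (rule sum_mono)
      fix k assume "k \<in> K"
      hence "(cmod ((deriv ^^ n) f (w k)) / real (num (fst k)) ^ n) powr p \<le> (fact n * 2 ^ n * cmod (f (w' k))) powr p"
        using w'(3)[of k] K p by (intro powr_mono2) auto
      also have "\<dots> = a * cmod (f (w' k)) powr p" by (simp add: a_def powr_mult)
      finally show "mass k * (cmod ((deriv ^^ n) f (w k)) / real (num (fst k)) ^ n) powr p \<le> a * (mass k * cmod (f (w' k)) powr p)"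
        using mass_pos[of k] by (simp add: mult.left_commute)
    qed
    also have "\<dots> \<le> (\<Sum>k\<in>(SIGMA i:fst ` K. {..<num i}). a * (mass k * cmod (f (w' k)) powr p))"
      using K a mass_pos by (intro sum_mono2) (force simp: nodes_def less_imp_le)+
    also have "\<dots> = (\<Sum>i\<in>fst ` K. \<Sum>l<num i. a * (mass (i, l) * cmod (f (w' (i, l))) powr p))"
      using K by (subst sum.Sigma) auto
    also have "\<dots> = (\<Sum>i\<in>fst ` K. a * (V i / real (num i) * (\<Sum>l<num i. cmod (f (w' (i, l))) powr p)))"
      by (simp add: mass_def sum_distrib_left)
    finally have "ennreal (\<Sum>k\<in>K. mass k * (cmod ((deriv ^^ n) f (w k)) / real (num (fst k)) ^ n) powr p) \<le> ennreal \<dots>"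
      by (rule ennreal_leI)
    also have "\<dots> = (\<Sum>i\<in>fst ` K. ennreal a * ennreal (V i / real (num i) * (\<Sum>l<num i. cmod (f (w' (i, l))) powr p)))"
    proof -
      have nn: "0 \<le> V i / real (num i) * (\<Sum>l<num i. cmod (f (w' (i, l))) powr p)" for i
        using V_pos[of i] by (intro mult_nonneg_nonneg sum_nonneg divide_nonneg_nonneg) auto
      show ?thesis
        using a nn by (simp only: ennreal_mult[symmetric] less_imp_le) (intro sum_ennreal[symmetric] mult_nonneg_nonneg[OF less_imp_le nn])
    qed
    also have "\<dots> \<le> (\<Sum>i\<in>fst ` K. ennreal a * (ennreal B * annulus_integral p f (i + 2)))"
    proof (intro sum_mono mult_left_mono)
      fix i
      show "ennreal (V i / real (num i) * (\<Sum>l<num i. cmod (f (w' (i, l))) powr p)) \<le> ennreal B * annulus_integral p f (i + 2)"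
        unfolding B_def by (intro sampling_level f p) (use w'[of "(i, _)"] in \<open>auto simp: nodes_def\<close>)
    qed simp
    also have "\<dots> = ennreal (a * B) * (\<Sum>i\<in>fst ` K. annulus_integral p f (i + 2))"
      using a B by (simp add: sum_distrib_left mult.assoc ennreal_mult)
    also have "\<dots> \<le> ennreal (a * B) * disc_power_integral \<mu> p f"
      using K by (intro mult_left_mono annulus_integral_sum_le f) auto
    finally show ?thesis .
  qed
  thus thesis using a B by (intro that[of "a * B"]) auto
qed

end

section \<open>Norms and operators\<close>

lemma ennreal_power_ennreal: "0 \<le> x \<Longrightarrow> ennreal_power (ennreal x) a = ennreal (x powr a)"
  by (simp add: ennreal_power_def)

lemma ennreal_power_mono: "0 \<le> a \<Longrightarrow> x \<le> y \<Longrightarrow> ennreal_power x a \<le> ennreal_power y a"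
  by (cases x; cases y) (auto simp: ennreal_power_def top_unique intro!: ennreal_leI powr_mono2)

lemma ennreal_power_inverse:
  assumes "0 < a" shows "ennreal_power (ennreal_power x a) (1 / a) = x"
  using assms by (cases x) (auto simp: ennreal_power_def powr_powr)

lemma ennreal_power_inverse':
  assumes "0 < a" shows "ennreal_power (ennreal_power x (1 / a)) a = x"
  using ennreal_power_inverse[of "1 / a" x] assms by simp

lemma ennreal_power_less_top_iff: "ennreal_power x a < top \<longleftrightarrow> x < top"
  by (cases x) (auto simp: ennreal_power_def)

lemma ennreal_power_le_iff:
  assumes "0 < q" "0 \<le> X"
  shows "ennreal_power I (1 / q) \<le> ennreal X \<longleftrightarrow> I \<le> ennreal (X powr q)"
proof
  assume "ennreal_power I (1 / q) \<le> ennreal X"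
  hence "ennreal_power (ennreal_power I (1 / q)) q \<le> ennreal_power (ennreal X) q"
    using assms by (intro ennreal_power_mono) auto
  thus "I \<le> ennreal (X powr q)" using assms by (simp add: ennreal_power_inverse' ennreal_power_ennreal)
next
  assume "I \<le> ennreal (X powr q)"
  hence "ennreal_power I (1 / q) \<le> ennreal_power (ennreal (X powr q)) (1 / q)"
    using assms by (intro ennreal_power_mono) auto
  thus "ennreal_power I (1 / q) \<le> ennreal X" using assms by (simp add: ennreal_power_ennreal powr_powr)
qed

lemma ennreal_power_mult:
  assumes "0 \<le> c" "0 < a"
  shows "ennreal_power (ennreal c * x) a = ennreal (c powr a) * ennreal_power x a"
proof (cases x)
  case (real r)
  thus ?thesis using assms by (simp add: ennreal_power_def powr_mult flip: ennreal_mult)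
next
  case top
  thus ?thesis using assms by (cases "c = 0") (auto simp: ennreal_power_def ennreal_mult_top)
qed

definition Lq_power :: "complex measure \<Rightarrow> real \<Rightarrow> (complex \<Rightarrow> complex) \<Rightarrow> ennreal" where
  "Lq_power \<upsilon> q g = (\<integral>\<^sup>+z. ennreal (cmod (g z) powr q) \<partial>\<upsilon>)"

lemma Lq_norm_eq: "Lq_norm \<upsilon> q g = ennreal_power (Lq_power \<upsilon> q g) (1 / q)"
  by (simp add: Lq_norm_def Lq_power_def)

lemma Lq_norm_le_iff:
  "0 < q \<Longrightarrow> 0 \<le> X \<Longrightarrow> Lq_norm \<upsilon> q g \<le> ennreal X \<longleftrightarrow> Lq_power \<upsilon> q g \<le> ennreal (X powr q)"
  unfolding Lq_norm_eq by (rule ennreal_power_le_iff)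

lemma Lq_norm_cong_AE: "AE z in \<upsilon>. f z = g z \<Longrightarrow> Lq_norm \<upsilon> q f = Lq_norm \<upsilon> q g"
  unfolding Lq_norm_def by (intro arg_cong2[where f = ennreal_power] nn_integral_cong_AE refl) (auto elim!: eventually_mono)

lemma Lq_norm_mono_AE:
  assumes "0 < q" "AE z in \<upsilon>. cmod (f z) \<le> cmod (g z)"
  shows "Lq_norm \<upsilon> q f \<le> Lq_norm \<upsilon> q g"
  unfolding Lq_norm_def using assms
  by (intro ennreal_power_mono nn_integral_mono_AE) (auto elim!: eventually_mono intro!: ennreal_leI powr_mono2)

lemma Lq_power_sum_le:
  assumes q: "1 \<le> q" and J: "finite J" and g: "\<And>j. j \<in> J \<Longrightarrow> g j \<in> borel_measurable \<upsilon>"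
  shows "Lq_power \<upsilon> q (\<lambda>z. \<Sum>j\<in>J. g j z) \<le> ennreal (real (card J) powr (q - 1)) * (\<Sum>j\<in>J. Lq_power \<upsilon> q (g j))"
proof -
  have "Lq_power \<upsilon> q (\<lambda>z. \<Sum>j\<in>J. g j z) \<le> (\<integral>\<^sup>+z. ennreal (real (card J) powr (q - 1)) * (\<Sum>j\<in>J. ennreal (cmod (g j z) powr q)) \<partial>\<upsilon>)"
    unfolding Lq_power_def
  proof (intro nn_integral_mono)
    fix z
    have "ennreal (cmod (\<Sum>j\<in>J. g j z) powr q) \<le> ennreal (real (card J) powr (q - 1) * (\<Sum>j\<in>J. cmod (g j z) powr q))"
      by (intro ennreal_leI norm_sum_powr_le J q)
    also have "\<dots> = ennreal (real (card J) powr (q - 1)) * (\<Sum>j\<in>J. ennreal (cmod (g j z) powr q))"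
      by (simp add: ennreal_mult sum_nonneg)
    finally show "ennreal (cmod (\<Sum>j\<in>J. g j z) powr q) \<le> ennreal (real (card J) powr (q - 1)) * (\<Sum>j\<in>J. ennreal (cmod (g j z) powr q))" .
  qed
  also have "\<dots> = ennreal (real (card J) powr (q - 1)) * (\<integral>\<^sup>+z. (\<Sum>j\<in>J. ennreal (cmod (g j z) powr q)) \<partial>\<upsilon>)"
    using g by (intro nn_integral_cmult borel_measurable_sum) measurable
  also have "(\<integral>\<^sup>+z. (\<Sum>j\<in>J. ennreal (cmod (g j z) powr q)) \<partial>\<upsilon>) = (\<Sum>j\<in>J. Lq_power \<upsilon> q (g j))"
    unfolding Lq_power_def using g by (intro nn_integral_sum) measurable
  finally show ?thesis .
qed

lemma Lq_power_add_le:
  assumes q: "1 \<le> q" and "f \<in> borel_measurable \<upsilon>" "g \<in> borel_measurable \<upsilon>"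
  shows "Lq_power \<upsilon> q (\<lambda>z. f z + g z) \<le> ennreal (2 powr (q - 1)) * (Lq_power \<upsilon> q f + Lq_power \<upsilon> q g)"
  using Lq_power_sum_le[OF q, of "{True, False}" "\<lambda>b. if b then f else g"] assms by simp

text \<open>
  The factor 2 comes from using only the convexity of the power; constants do not
  matter for comparability.
\<close>

lemma Lq_norm_add_le:
  assumes q: "1 \<le> q" and f: "f \<in> borel_measurable \<upsilon>" and g: "g \<in> borel_measurable \<upsilon>"
  shows "Lq_norm \<upsilon> q (\<lambda>z. f z + g z) \<le> 2 * (Lq_norm \<upsilon> q f + Lq_norm \<upsilon> q g)"
proof -
  define X where "X = max (Lq_power \<upsilon> q f) (Lq_power \<upsilon> q g)"
  have "Lq_power \<upsilon> q (\<lambda>z. f z + g z) \<le> ennreal (2 powr (q - 1)) * (X + X)"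
    by (rule order.trans[OF Lq_power_add_le[OF assms]]) (auto intro!: mult_left_mono add_mono simp: X_def)
  also have "X + X = ennreal 2 * X" by (simp add: mult_2)
  also have "ennreal (2 powr (q - 1)) * (ennreal 2 * X) = ennreal (2 powr (q - 1) * 2) * X"
    by (simp only: mult.assoc[symmetric]) (subst ennreal_mult, auto)
  also have "2 powr (q - 1) * 2 = 2 powr q" by (simp add: powr_diff)
  finally have "Lq_norm \<upsilon> q (\<lambda>z. f z + g z) \<le> ennreal_power (ennreal (2 powr q) * X) (1 / q)"
    unfolding Lq_norm_eq using q by (intro ennreal_power_mono) auto
  also have "\<dots> = 2 * ennreal_power X (1 / q)"
    using q by (subst ennreal_power_mult) (auto simp: powr_powr)
  also have "ennreal_power X (1 / q) \<le> Lq_norm \<upsilon> q f + Lq_norm \<upsilon> q g"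
    unfolding X_def max_def Lq_norm_eq by (auto simp: add_increasing add_increasing2)
  finally show ?thesis by (simp add: mult_left_mono)
qed

lemma Lq_norm_cmult:
  assumes q: "0 < q" and g: "g \<in> borel_measurable \<upsilon>"
  shows "Lq_norm \<upsilon> q (\<lambda>z. a * g z) = ennreal (cmod a) * Lq_norm \<upsilon> q g"
proof -
  have "Lq_power \<upsilon> q (\<lambda>z. a * g z) = (\<integral>\<^sup>+z. ennreal (cmod a powr q) * ennreal (cmod (g z) powr q) \<partial>\<upsilon>)"
    unfolding Lq_power_def by (intro nn_integral_cong) (simp add: norm_mult powr_mult ennreal_mult)
  also have "\<dots> = ennreal (cmod a powr q) * Lq_power \<upsilon> q g"
    unfolding Lq_power_def using g by (intro nn_integral_cmult) measurable
  finally show ?thesis unfolding Lq_norm_eq using q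
    by (simp add: ennreal_power_mult powr_powr)
qed

lemma Lq_cmult:
  assumes "0 < q" "g \<in> Lq \<upsilon> q" shows "(\<lambda>z. a * g z) \<in> Lq \<upsilon> q"
  using assms unfolding Lq_def by (auto simp: Lq_norm_cmult ennreal_mult_less_top)

lemma Lq_add:
  assumes "1 \<le> q" "f \<in> Lq \<upsilon> q" "g \<in> Lq \<upsilon> q" shows "(\<lambda>z. f z + g z) \<in> Lq \<upsilon> q"
proof -
  have fg: "f \<in> borel_measurable \<upsilon>" "g \<in> borel_measurable \<upsilon>" "Lq_norm \<upsilon> q f < top" "Lq_norm \<upsilon> q g < top"
    using assms by (auto simp: Lq_def)
  have "2 * (Lq_norm \<upsilon> q f + Lq_norm \<upsilon> q g) < top" using fg by (simp add: ennreal_mult_less_top)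
  from le_less_trans[OF Lq_norm_add_le[OF assms(1) fg(1,2)] this] show ?thesis
    using fg by (simp add: Lq_def)
qed

lemma Lq_diff:
  assumes "1 \<le> q" "f \<in> Lq \<upsilon> q" "g \<in> Lq \<upsilon> q" shows "(\<lambda>z. f z - g z) \<in> Lq \<upsilon> q"
  using Lq_add[OF assms(1,2) Lq_cmult[OF _ assms(3), of "-1"]] assms(1) by simp

lemma higher_deriv_sum:
  assumes "finite K" "\<And>k. k \<in> K \<Longrightarrow> g k holomorphic_on A" "open A" "z \<in> A"
  shows "(deriv ^^ n) (\<lambda>w. \<Sum>k\<in>K. c k * g k w) z = (\<Sum>k\<in>K. c k * (deriv ^^ n) (g k) z)"
  using assms(1,2)
proof (induction K rule: finite_induct)
  case empty thus ?case by simp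
next
  case (insert a K)
  have "(deriv ^^ n) (\<lambda>w. \<Sum>k\<in>insert a K. c k * g k w) z = (deriv ^^ n) (\<lambda>w. c a * g a w + (\<Sum>k\<in>K. c k * g k w)) z"
    using insert by simp
  also have "\<dots> = (deriv ^^ n) (\<lambda>w. c a * g a w) z + (deriv ^^ n) (\<lambda>w. \<Sum>k\<in>K. c k * g k w) z"
    using insert assms by (intro higher_deriv_add[of _ A] holomorphic_intros) auto
  also have "(deriv ^^ n) (\<lambda>w. c a * g a w) z = c a * (deriv ^^ n) (g a) z"
    using insert assms by (intro higher_deriv_cmult[of _ A]) auto
  finally show ?case using insert by simp
qed

lemma weighted_comp_diff_sum:
  assumes "finite K" "\<And>k. k \<in> K \<Longrightarrow> g k holomorphic_on ball 0 1" "self_map \<phi>" "z \<in> ball 0 1"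
  shows "weighted_comp_diff u \<phi> n (\<lambda>w. \<Sum>k\<in>K. c k * g k w) z = (\<Sum>k\<in>K. c k * weighted_comp_diff u \<phi> n (g k) z)"
proof -
  have "\<phi> z \<in> ball 0 1" using assms(3,4) unfolding self_map_def by blast
  thus ?thesis unfolding weighted_comp_diff_def
    using higher_deriv_sum[OF assms(1,2) open_ball, where z = "\<phi> z" and n = n and c = c] by (simp add: sum_distrib_left mult_ac)
qed

lemma space_disc_measure: "borel_measure_on_disc \<upsilon> \<Longrightarrow> space \<upsilon> = ball 0 1"
  unfolding borel_measure_on_disc_def by (drule sets_eq_imp_space_eq) (simp add: space_restrict_space)

lemma continuous_on_disc_measurable:
  assumes "borel_measure_on_disc \<upsilon>" "continuous_on (ball 0 1) f"
  shows "f \<in> borel_measurable \<upsilon>"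
proof -
  have "f \<in> borel_measurable (restrict_space borel (ball 0 1))"
    by (rule borel_measurable_continuous_on_restrict) (rule assms)
  moreover have "sets \<upsilon> = sets (restrict_space borel (ball 0 1))" using assms by (simp add: borel_measure_on_disc_def)
  ultimately show ?thesis using measurable_cong_sets[of \<upsilon> "restrict_space borel (ball 0 1)" borel borel] by simp
qed

lemma weighted_comp_diff_holomorphic:
  assumes "self_map \<phi>" "u holomorphic_on ball 0 1" "f holomorphic_on ball 0 1"
  shows "weighted_comp_diff u \<phi> n f holomorphic_on ball 0 1"
proof -
  have "(\<lambda>z. (deriv ^^ n) f (\<phi> z)) holomorphic_on ball 0 1"
    using assms unfolding self_map_def
    by (intro holomorphic_on_compose_gen[OF _ holomorphic_higher_deriv[OF assms(3)], unfolded o_def]) auto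
  thus ?thesis unfolding weighted_comp_diff_def using assms by (intro holomorphic_intros) auto
qed

lemma weighted_comp_diff_measurable:
  assumes "borel_measure_on_disc \<upsilon>" "self_map \<phi>" "u holomorphic_on ball 0 1" "f holomorphic_on ball 0 1"
  shows "weighted_comp_diff u \<phi> n f \<in> borel_measurable \<upsilon>"
  by (intro continuous_on_disc_measurable holomorphic_on_imp_continuous_on weighted_comp_diff_holomorphic assms)

lemma weighted_comp_diff_lincomb:
  assumes "f holomorphic_on ball 0 1" "g holomorphic_on ball 0 1" "self_map \<phi>" "z \<in> ball 0 1"
  shows "weighted_comp_diff u \<phi> n (\<lambda>w. a * f w + b * g w) z = a * weighted_comp_diff u \<phi> n f z + b * weighted_comp_diff u \<phi> n g z"
  using weighted_comp_diff_sum[of "{True, False}" "\<lambda>x. if x then f else g" \<phi> z u n "\<lambda>x. if x then a else b"] assms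
  by simp

lemma weighted_comp_diff_cong_disc:
  assumes "f holomorphic_on ball 0 1" "g holomorphic_on ball 0 1" "self_map \<phi>" "z \<in> ball 0 1" "\<forall>z\<in>ball 0 1. f z = g z"
  shows "weighted_comp_diff u \<phi> n f z = weighted_comp_diff u \<phi> n g z"
proof -
  have "\<phi> z \<in> ball 0 1" using assms(3,4) unfolding self_map_def by blast
  hence "(deriv ^^ n) f (\<phi> z) = (deriv ^^ n) g (\<phi> z)"
    using assms by (intro higher_deriv_transform_within_open[of _ "ball 0 1"]) auto
  thus ?thesis by (simp add: weighted_comp_diff_def)
qed

definition two_term ::
    "(complex \<Rightarrow> complex) \<Rightarrow> (complex \<Rightarrow> complex) \<Rightarrow> nat \<Rightarrow> (complex \<Rightarrow> complex) \<Rightarrow> (complex \<Rightarrow> complex) \<Rightarrow> nat \<Rightarrow> operator" where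
  "two_term u \<phi> n v \<psi> m f z = weighted_comp_diff u \<phi> n f z + weighted_comp_diff v \<psi> m f z"

lemma two_term_measurable:
  assumes "borel_measure_on_disc \<upsilon>" "self_map \<phi>" "self_map \<psi>" "u holomorphic_on ball 0 1" "v holomorphic_on ball 0 1" "f holomorphic_on ball 0 1"
  shows "two_term u \<phi> n v \<psi> m f \<in> borel_measurable \<upsilon>"
  unfolding two_term_def[abs_def] by (intro borel_measurable_add weighted_comp_diff_measurable assms)

lemma two_term_sum:
  assumes "finite K" "\<And>k. k \<in> K \<Longrightarrow> g k holomorphic_on ball 0 1" "self_map \<phi>" "self_map \<psi>" "z \<in> ball 0 1"
  shows "two_term u \<phi> n v \<psi> m (\<lambda>w. \<Sum>k\<in>K. c k * g k w) z = (\<Sum>k\<in>K. c k * two_term u \<phi> n v \<psi> m (g k) z)"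
  using weighted_comp_diff_sum[OF assms(1,2,3,5), where u = u and n = n and c = c]
    weighted_comp_diff_sum[OF assms(1,2,4,5), where u = v and n = m and c = c]
  by (simp add: two_term_def distrib_left sum.distrib)

lemma two_term_cmult:
  assumes "borel_measure_on_disc \<upsilon>" "self_map \<phi>" "self_map \<psi>" "f holomorphic_on ball 0 1"
  shows "AE z in \<upsilon>. two_term u \<phi> n v \<psi> m (\<lambda>w. a * f w) z = a * two_term u \<phi> n v \<psi> m f z"
  using two_term_sum[of "{()}" "\<lambda>_. f" \<phi> \<psi> _ u n v m "\<lambda>_. a"] assms
  by (intro AE_I2) (simp add: space_disc_measure)

text \<open>
  From here on the weight itself enters only through the identity for \<open>bergman_norm\<close>.
\<close>

locale bergman_space = disc_weight +
  fixes \<omega> :: "real \<Rightarrow> real" and p :: real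
  assumes p: "1 < p"
    and bergman_norm_eq: "\<And>f. f holomorphic_on ball 0 1 \<Longrightarrow> bergman_norm \<omega> p f = ennreal_power (disc_power_integral \<mu> p f) (1 / p)"
begin

lemma bergman_norm_le_iff:
  assumes "f holomorphic_on ball 0 1" "0 \<le> X"
  shows "bergman_norm \<omega> p f \<le> ennreal X \<longleftrightarrow> disc_power_integral \<mu> p f \<le> ennreal (X powr p)"
  unfolding bergman_norm_eq[OF assms(1)] using p assms by (intro ennreal_power_le_iff) auto

lemma bergman_iff: "f \<in> bergman \<omega> p \<longleftrightarrow> f holomorphic_on ball 0 1 \<and> disc_power_integral \<mu> p f < top"
  by (auto simp: bergman_def bergman_norm_eq ennreal_power_less_top_iff)

lemma bergman_holomorphic: "f \<in> bergman \<omega> p \<Longrightarrow> f holomorphic_on ball 0 1"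
  by (simp add: bergman_iff)

lemma power_borel:
  assumes "f holomorphic_on ball 0 1"
  shows "(\<lambda>z. ennreal (cmod (f z) powr p) * indicator (ball 0 1) z) \<in> borel_measurable borel"
proof -
  note [measurable] = borel_on_ball[OF assms]
  have "(\<lambda>z. ennreal (cmod (f z) powr p) * indicator (ball 0 1) z) = (\<lambda>z. ennreal (cmod (f z * indicator (ball 0 1) z) powr p))"
    using p by (auto split: split_indicator)
  thus ?thesis by simp
qed

lemma disc_power_integral_cmult:
  assumes "f holomorphic_on ball 0 1"
  shows "disc_power_integral \<mu> p (\<lambda>z. a * f z) = ennreal (cmod a powr p) * disc_power_integral \<mu> p f"
proof -
  note [measurable] = power_borel[OF assms]
  have "disc_power_integral \<mu> p (\<lambda>z. a * f z) = (\<integral>\<^sup>+z. ennreal (cmod a powr p) * (ennreal (cmod (f z) powr p) * indicator (ball 0 1) z) \<partial>\<mu>)"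
    unfolding disc_power_integral_def by (intro nn_integral_cong) (simp add: norm_mult powr_mult ennreal_mult mult.assoc)
  also have "\<dots> = ennreal (cmod a powr p) * disc_power_integral \<mu> p f"
    unfolding disc_power_integral_def by (rule nn_integral_cmult) measurable
  finally show ?thesis .
qed

lemma disc_power_integral_add:
  assumes "f holomorphic_on ball 0 1" "g holomorphic_on ball 0 1"
  shows "disc_power_integral \<mu> p (\<lambda>z. f z + g z) \<le> ennreal (2 powr (p - 1)) * (disc_power_integral \<mu> p f + disc_power_integral \<mu> p g)"
proof -
  note [measurable] = power_borel[OF assms(1)] power_borel[OF assms(2)]
  let ?F = "\<lambda>f z. ennreal (cmod (f z) powr p) * indicator (ball 0 1) z"
  have "disc_power_integral \<mu> p (\<lambda>z. f z + g z) \<le> (\<integral>\<^sup>+z. ennreal (2 powr (p - 1)) * (?F f z + ?F g z) \<partial>\<mu>)"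
    unfolding disc_power_integral_def
  proof (intro nn_integral_mono)
    fix z
    have "ennreal (cmod (f z + g z) powr p) \<le> ennreal (2 powr (p - 1) * (cmod (f z) powr p + cmod (g z) powr p))"
      using p by (intro ennreal_leI norm_add_powr_le) auto
    thus "ennreal (cmod (f z + g z) powr p) * indicator (ball 0 1) z \<le> ennreal (2 powr (p - 1)) * (?F f z + ?F g z)"
      by (simp add: ennreal_mult split: split_indicator)
  qed
  also have "\<dots> = ennreal (2 powr (p - 1)) * (disc_power_integral \<mu> p f + disc_power_integral \<mu> p g)"
    unfolding disc_power_integral_def by (simp add: nn_integral_cmult nn_integral_add)
  finally show ?thesis .
qed

lemma bergman_cmult: "f \<in> bergman \<omega> p \<Longrightarrow> (\<lambda>z. a * f z) \<in> bergman \<omega> p"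
  by (auto simp: bergman_iff disc_power_integral_cmult ennreal_mult_less_top intro!: holomorphic_intros)

lemma bergman_add: "f \<in> bergman \<omega> p \<Longrightarrow> g \<in> bergman \<omega> p \<Longrightarrow> (\<lambda>z. f z + g z) \<in> bergman \<omega> p"
  using le_less_trans[OF disc_power_integral_add[of f g], of top]
  by (simp add: bergman_iff ennreal_mult_less_top holomorphic_on_add)

lemma bergman_bounded:
  assumes "f holomorphic_on ball 0 1" "\<And>z. z \<in> ball 0 1 \<Longrightarrow> cmod (f z) \<le> 1"
  shows "f \<in> bergman \<omega> p"
proof -
  have pr: "ennreal (cmod (f z) powr p) * indicator (ball 0 1) z \<le> indicator (ball 0 1) z" for z
  proof (cases "z \<in> ball 0 1")
    case True
    hence "cmod (f z) powr p \<le> 1" using assms(2)[of z] p powr_mono2[of p "cmod (f z)" 1] by simp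
    hence "ennreal (cmod (f z) powr p) \<le> 1" by (simp add: ennreal_le_1)
    thus ?thesis using True by simp
  qed simp
  have "disc_power_integral \<mu> p f \<le> (\<integral>\<^sup>+z. indicator (ball 0 1) z \<partial>\<mu>)"
    unfolding disc_power_integral_def by (intro nn_integral_mono pr)
  also have "\<dots> = disc_power_integral \<mu> p (\<lambda>_. 1)" by (simp add: disc_power_integral_def)
  also have "\<dots> \<le> (\<Sum>j. \<integral>\<^sup>+z. ennreal (cmod (1::complex) powr p) * indicator (annulus \<kappa> j) z \<partial>\<mu>)"
    by (rule disc_power_integral_annuli) simp
  also have "\<dots> \<le> ennreal (V 0 / (1 - \<sigma>\<^sup>2))"
    unfolding suminf_eq_SUP
  proof (rule SUP_least)
    fix J :: nat
    have s2: "0 < \<sigma>\<^sup>2" "\<sigma>\<^sup>2 < 1" using sigma by (auto simp: power_less_one_iff)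
    have "(\<Sum>j<J. \<integral>\<^sup>+z. ennreal (cmod (1::complex) powr p) * indicator (annulus \<kappa> j) z \<partial>\<mu>) \<le> (\<Sum>j<J. ennreal ((\<sigma>\<^sup>2) ^ j * V 0))"
    proof (rule sum_mono)
      fix j
      have "V j \<le> (\<sigma>\<^sup>2) ^ j * V 0" using V_decay_power[of 0 j] by simp
      hence "emeasure \<mu> (annulus \<kappa> j) \<le> ennreal ((\<sigma>\<^sup>2) ^ j * V 0)" using annulus_upper[of j] order.trans ennreal_leI by metis
      thus "(\<integral>\<^sup>+z. ennreal (cmod (1::complex) powr p) * indicator (annulus \<kappa> j) z \<partial>\<mu>) \<le> ennreal ((\<sigma>\<^sup>2) ^ j * V 0)"
        by simp
    qed
    also have "\<dots> = ennreal (\<Sum>j<J. (\<sigma>\<^sup>2) ^ j * V 0)" using V_pos[of 0] by (intro sum_ennreal) auto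
    also have "(\<Sum>j<J. (\<sigma>\<^sup>2) ^ j * V 0) = (1 - (\<sigma>\<^sup>2) ^ J) / (1 - \<sigma>\<^sup>2) * V 0"
      using s2 by (simp add: sum_gp_strict flip: sum_distrib_right)
    also have "\<dots> \<le> 1 / (1 - \<sigma>\<^sup>2) * V 0" using s2 V_pos[of 0] by (intro mult_right_mono divide_right_mono) auto
    finally show "(\<Sum>j<J. \<integral>\<^sup>+z. ennreal (cmod (1::complex) powr p) * indicator (annulus \<kappa> j) z \<partial>\<mu>) \<le> ennreal (V 0 / (1 - \<sigma>\<^sup>2))"
      by (simp add: ennreal_leI)
  qed
  also have "\<dots> < top" by simp
  finally show ?thesis using assms by (simp add: bergman_iff)
qed

lemma linear_op_lincomb:
  assumes "linear_op \<omega> p \<upsilon> q T" "f \<in> bergman \<omega> p" "g \<in> bergman \<omega> p"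
  shows "AE z in \<upsilon>. T (\<lambda>w. a * f w + b * g w) z = a * T f z + b * T g z"
  using assms unfolding linear_op_def by blast

lemma linear_op_cmult:
  assumes "linear_op \<omega> p \<upsilon> q T" "f \<in> bergman \<omega> p"
  shows "AE z in \<upsilon>. T (\<lambda>w. a * f w) z = a * T f z"
proof -
  have "AE z in \<upsilon>. T (\<lambda>w. a * f w + 0 * f w) z = a * T f z + 0 * T f z"
    by (rule linear_op_lincomb[OF assms(1,2,2)])
  thus ?thesis by simp
qed

lemma linear_op_Lq: "linear_op \<omega> p \<upsilon> q T \<Longrightarrow> f \<in> bergman \<omega> p \<Longrightarrow> T f \<in> Lq \<upsilon> q"
  by (simp add: linear_op_def)

lemma bergman_sum:
  assumes "finite J" "\<And>j. j \<in> J \<Longrightarrow> h j \<in> bergman \<omega> p"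
  shows "(\<lambda>w. \<Sum>j\<in>J. h j w) \<in> bergman \<omega> p"
  using assms
proof (induction J rule: finite_induct)
  case empty
  have "(\<lambda>w. 0) \<in> bergman \<omega> p" by (rule bergman_bounded) auto
  thus ?case by simp
next
  case (insert a J)
  have "(\<lambda>w. h a w + (\<Sum>j\<in>J. h j w)) \<in> bergman \<omega> p" by (rule bergman_add) (use insert in auto)
  thus ?case using insert by simp
qed

lemma linear_op_sum:
  assumes T: "linear_op \<omega> p \<upsilon> q T" and J: "finite J" "\<And>j. j \<in> J \<Longrightarrow> h j \<in> bergman \<omega> p"
  shows "AE z in \<upsilon>. T (\<lambda>w. \<Sum>j\<in>J. h j w) z = (\<Sum>j\<in>J. T (h j) z)"
  using J
proof (induction J rule: finite_induct)
  case empty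
  have "(\<lambda>w. 0) \<in> bergman \<omega> p" by (rule bergman_bounded) auto
  from linear_op_cmult[OF T this, of 0] show ?case by simp
next
  case (insert a J)
  have s: "(\<lambda>w. \<Sum>j\<in>J. h j w) \<in> bergman \<omega> p" by (rule bergman_sum) (use insert in auto)
  have "h a \<in> bergman \<omega> p" using insert by auto
  from linear_op_lincomb[OF T this s] have "AE z in \<upsilon>. T (\<lambda>w. 1 * h a w + 1 * (\<Sum>j\<in>J. h j w)) z = 1 * T (h a) z + 1 * T (\<lambda>w. \<Sum>j\<in>J. h j w) z" .
  moreover have "AE z in \<upsilon>. T (\<lambda>w. \<Sum>j\<in>J. h j w) z = (\<Sum>j\<in>J. T (h j) z)" using insert by auto
  ultimately show ?case
  proof eventually_elim
    case (elim z)
    thus ?case using insert.hyps by simp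
  qed
qed

text \<open>
  Homogeneity almost everywhere suffices, which admits compact perturbations; these are linear
  only up to null sets.
\<close>

lemma op_norm_bound:
  assumes hom: "\<And>f a. f \<in> bergman \<omega> p \<Longrightarrow> AE z in \<upsilon>. T (\<lambda>w. a * f w) z = a * T f z"
    and meas: "\<And>f. f \<in> bergman \<omega> p \<Longrightarrow> T f \<in> borel_measurable \<upsilon>"
    and q: "0 < q" and f: "f \<in> bergman \<omega> p" and X: "0 < X" "bergman_norm \<omega> p f \<le> ennreal X"
  shows "Lq_norm \<upsilon> q (T f) \<le> ennreal X * op_norm \<omega> p \<upsilon> q T"
proof -
  define g where "g = (\<lambda>w. of_real (1 / X) * f w)"
  have holo: "f holomorphic_on ball 0 1" using f by (simp add: bergman_iff)
  have g: "g \<in> bergman \<omega> p" unfolding g_def by (rule bergman_cmult[OF f])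
  have "disc_power_integral \<mu> p f \<le> ennreal (X powr p)" using bergman_norm_le_iff[OF holo, of X] X by simp
  hence "disc_power_integral \<mu> p g \<le> ennreal ((1 / X) powr p) * ennreal (X powr p)"
    unfolding g_def using disc_power_integral_cmult[OF holo, of "of_real (1 / X)"] X
    by (auto simp: norm_divide intro!: mult_left_mono)
  also have "\<dots> = 1" using X by (simp add: powr_divide flip: ennreal_mult)
  finally have "bergman_norm \<omega> p g \<le> 1"
    using bergman_norm_le_iff[of g 1] g by (simp add: bergman_iff)
  hence "Lq_norm \<upsilon> q (T g) \<le> op_norm \<omega> p \<upsilon> q T"
    unfolding op_norm_def using g by (intro SUP_upper) auto
  hence "ennreal X * Lq_norm \<upsilon> q (T g) \<le> ennreal X * op_norm \<omega> p \<upsilon> q T" by (rule mult_left_mono) simp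
  moreover have "Lq_norm \<upsilon> q (T f) = ennreal X * Lq_norm \<upsilon> q (T g)"
  proof -
    have "Lq_norm \<upsilon> q (T g) = Lq_norm \<upsilon> q (\<lambda>z. of_real (1 / X) * T f z)"
      unfolding g_def by (rule Lq_norm_cong_AE[OF hom[OF f]])
    also have "\<dots> = ennreal (1 / X) * Lq_norm \<upsilon> q (T f)"
      using X by (subst Lq_norm_cmult[OF q meas[OF f]]) (simp add: norm_divide)
    finally show ?thesis using X by (simp add: mult.assoc[symmetric] flip: ennreal_mult)
  qed
  ultimately show ?thesis by simp
qed

end

section \<open>The term of lower order in the operator norm\<close>

lemma pochhammer_ge_1:
  fixes x :: real
  assumes "1 \<le> x" shows "1 \<le> pochhammer x n"
  unfolding pochhammer_prod using assms by (intro prod_ge_1) auto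

lemma sum3_powr_le:
  fixes a :: "nat \<Rightarrow> real"
  assumes "1 \<le> q" "\<And>j. 0 \<le> a j"
  shows "(\<Sum>j<3. a j) powr q \<le> 3 powr (q - 1) * (\<Sum>j<3. a j powr q)"
  using sum_powr_le[of "{..<3}" q a "\<lambda>_. 1"] assms by simp

context disc_weight
begin

lemma higher_deriv_kern_power:
  assumes "cmod w < 1"
  shows "(deriv ^^ n) (\<lambda>w. kern k w ^ \<gamma>) w =
     of_real (pochhammer (real \<gamma>) n) * (cnj (node k) * of_nat (num (fst k))) ^ n * kern k w ^ (\<gamma> + n)"
  using assms
proof (induction n arbitrary: w)
  case (Suc n)
  define c where "c = cnj (node k) * of_nat (num (fst k))"
  define P where "P = complex_of_real (pochhammer (real \<gamma>) n)"
  have ne: "1 - cnj (node k) * w \<noteq> 0" by (rule one_minus_neq_0[OF Suc.prems])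
  have N0: "complex_of_nat (num (fst k)) \<noteq> 0" by simp
  have dk: "(kern k has_field_derivative c * kern k w ^ 2) (at w)"
    unfolding kern_def c_def
    by (rule derivative_eq_intros refl ne)+ (use ne N0 in \<open>simp add: divide_simps power2_eq_square\<close>)
  have "(deriv ^^ Suc n) (\<lambda>w. kern k w ^ \<gamma>) w = deriv ((deriv ^^ n) (\<lambda>w. kern k w ^ \<gamma>)) w" by simp
  also have "\<dots> = deriv (\<lambda>w. P * c ^ n * kern k w ^ (\<gamma> + n)) w"
  proof (rule deriv_cong_ev[OF _ refl])
    have "eventually (\<lambda>w. w \<in> ball 0 1) (nhds w)" by (rule eventually_nhds_in_open) (use Suc.prems in auto)
    thus "eventually (\<lambda>w. (deriv ^^ n) (\<lambda>w. kern k w ^ \<gamma>) w = P * c ^ n * kern k w ^ (\<gamma> + n)) (nhds w)"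
      by eventually_elim (use Suc.IH in \<open>auto simp: P_def c_def\<close>)
  qed
  also have "\<dots> = P * c ^ n * (of_nat (\<gamma> + n) * kern k w ^ (\<gamma> + n - 1) * (c * kern k w ^ 2))"
    by (rule DERIV_imp_deriv) (auto intro!: derivative_eq_intros dk)
  also have "of_nat (\<gamma> + n) * kern k w ^ (\<gamma> + n - 1) * (c * kern k w ^ 2) = of_nat (\<gamma> + n) * c * kern k w ^ (\<gamma> + Suc n)"
    by (cases "\<gamma> + n") (simp_all add: power2_eq_square)
  also have "P * c ^ n * (of_nat (\<gamma> + n) * c * kern k w ^ (\<gamma> + Suc n)) = of_real (pochhammer (real \<gamma>) (Suc n)) * c ^ Suc n * kern k w ^ (\<gamma> + Suc n)"
    by (simp add: P_def pochhammer_Suc mult_ac)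
  finally show ?case by (simp add: c_def)
qed simp

text \<open>
  At \<open>a\<close> in the cell of \<open>k\<close> the kernel is bounded below, while at \<open>b\<close> nothing but the
  bound 1 is known. That is the asymmetry required by \<open>separation_three_point\<close>.
\<close>

lemma kern_separation:
  assumes nm: "n < m" and \<gamma>: "1 \<le> \<gamma>"
  obtains C where "C > 0"
    "\<And>k a b x y. a \<in> cell k \<Longrightarrow> cmod b < 1 \<Longrightarrow>
      cmod x * real (num (fst k)) ^ n \<le>
        C * (\<Sum>j<3. cmod (x * (deriv ^^ n) (\<lambda>w. kern k w ^ (\<gamma> + j)) a + y * (deriv ^^ m) (\<lambda>w. kern k w ^ (\<gamma> + j)) b))"
proof -
  define \<alpha> where "\<alpha> j = pochhammer (real \<gamma> + real j) n" for j :: nat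
  define \<beta> where "\<beta> j = pochhammer (real \<gamma> + real j) m" for j :: nat
  have \<alpha>1: "\<alpha> j \<ge> 1" and \<beta>1: "\<beta> j \<ge> 1" for j
    using \<gamma> unfolding \<alpha>_def \<beta>_def by (intro pochhammer_ge_1; simp)+
  define \<Delta> where "\<Delta> = \<alpha> 2 / \<beta> 2 - (\<alpha> 1 / \<beta> 1)\<^sup>2 / (\<alpha> 0 / \<beta> 0)"
  have \<Delta>: "\<Delta> > 0"
    using pochhammer_ratio_strict[of "real \<gamma>", OF _ nm] \<gamma> unfolding \<Delta>_def \<alpha>_def \<beta>_def by simp
  define C where "C = 2 * 2 ^ n * beta ^ (\<gamma> + n + 2) / \<Delta>"
  have b0: "beta > 0" using beta_ge by simp
  have C: "C > 0" using \<Delta> b0 by (simp add: C_def)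
  have "cmod x * real (num (fst k)) ^ n \<le>
        C * (\<Sum>j<3. cmod (x * (deriv ^^ n) (\<lambda>w. kern k w ^ (\<gamma> + j)) a + y * (deriv ^^ m) (\<lambda>w. kern k w ^ (\<gamma> + j)) b))"
    if a: "a \<in> cell k" and b: "cmod b < 1" for k a b x y
  proof -
    define N where "N = real (num (fst k))"
    define t where "t = kern k a"
    define s where "s = kern k b"
    define e where "e = cnj (node k) * of_nat (num (fst k))"
    have a1: "cmod a < 1" using a cell_subset_ball[of k] by auto
    have t: "1 / beta \<le> cmod t" using norm_kern_cell[OF a] by (simp add: t_def)
    have "0 < 1 / beta" using b0 by simp
    hence t0: "t \<noteq> 0" using t by auto
    have s: "cmod s \<le> 1" using norm_kern_le_1[OF b] by (simp add: s_def)
    define U where "U = x * e ^ n * t ^ (\<gamma> + n)"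
    define V' where "V' = y * e ^ m * s ^ (\<gamma> + m)"
    define X where "X j = x * (deriv ^^ n) (\<lambda>w. kern k w ^ (\<gamma> + j)) a + y * (deriv ^^ m) (\<lambda>w. kern k w ^ (\<gamma> + j)) b" for j
    have X: "X j = \<alpha> j * t ^ j * U + \<beta> j * s ^ j * V'" for j
      unfolding X_def higher_deriv_kern_power[OF a1] higher_deriv_kern_power[OF b]
      by (simp add: \<alpha>_def \<beta>_def U_def V'_def t_def s_def e_def power_add mult_ac)
    have "cmod U * (cmod t)\<^sup>2 * \<Delta> \<le> 2 * (cmod (X 0) + cmod (X 1) + cmod (X 2))"
      unfolding \<Delta>_def X using \<alpha>1[of 0] by (intro separation_three_point \<beta>1 t0 s) auto
    also have "cmod (X 0) + cmod (X 1) + cmod (X 2) = (\<Sum>j<3. cmod (X j))"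
      by (simp add: eval_nat_numeral)
    finally have le: "cmod U * (cmod t)\<^sup>2 * \<Delta> \<le> 2 * (\<Sum>j<3. cmod (X j))" .
    have "cmod x * ((1 / 2 * N) ^ n * (1 / beta) ^ (\<gamma> + n + 2)) * \<Delta> \<le> cmod x * ((rho (fst k) * N) ^ n * cmod t ^ (\<gamma> + n + 2)) * \<Delta>"
      using rho_bounds[of "fst k"] t b0 \<Delta>
      by (intro mult_right_mono mult_left_mono mult_mono power_mono) (auto simp: N_def)
    also have "\<dots> = cmod U * (cmod t)\<^sup>2 * \<Delta>"
      using rho_bounds[of "fst k"] by (simp add: U_def e_def N_def norm_mult norm_power norm_node power_add power2_eq_square power_mult_distrib mult_ac)
    finally have "cmod x * ((1 / 2 * N) ^ n * (1 / beta) ^ (\<gamma> + n + 2)) * \<Delta> \<le> 2 * (\<Sum>j<3. cmod (X j))" using le by simp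
    hence "cmod x * N ^ n \<le> C * (\<Sum>j<3. cmod (X j))"
      using \<Delta> b0 unfolding C_def by (simp add: power_mult_distrib power_one_over field_simps)
    thus ?thesis by (simp add: N_def X_def)
  qed
  with C show thesis by (rule that)
qed

lemma higher_deriv_atom:
  assumes "cmod w < 1"
  shows "(deriv ^^ n) (atom p \<gamma> k) w = of_real (mass k powr (- 1 / p)) * (deriv ^^ n) (\<lambda>w. kern k w ^ \<gamma>) w"
  unfolding atom_def
  by (rule higher_deriv_cmult[of _ "ball 0 1"]) (use assms in \<open>auto intro!: holomorphic_intros kern_holomorphic\<close>)

lemma atom_separation:
  assumes nm: "n < m" and \<gamma>: "1 \<le> \<gamma>"
  obtains C where "C > 0"
    "\<And>k a b x y. a \<in> cell k \<Longrightarrow> cmod b < 1 \<Longrightarrow>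
      cmod x * (mass k powr (- 1 / p) * real (num (fst k)) ^ n) \<le>
        C * (\<Sum>j<3. cmod (x * (deriv ^^ n) (atom p (\<gamma> + j) k) a + y * (deriv ^^ m) (atom p (\<gamma> + j) k) b))"
proof -
  obtain C where C: "C > 0"
    "\<And>k a b x y. a \<in> cell k \<Longrightarrow> cmod b < 1 \<Longrightarrow>
      cmod x * real (num (fst k)) ^ n \<le>
        C * (\<Sum>j<3. cmod (x * (deriv ^^ n) (\<lambda>w. kern k w ^ (\<gamma> + j)) a + y * (deriv ^^ m) (\<lambda>w. kern k w ^ (\<gamma> + j)) b))"
    by (rule kern_separation[OF nm \<gamma>]) blast
  show thesis
  proof (rule that[OF C(1)])
    fix k a b x y assume ab: "a \<in> cell k" "cmod b < 1"
    have a1: "cmod a < 1" using ab cell_subset_ball[of k] by auto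
    define W where "W = mass k powr (- 1 / p)"
    have W: "W \<ge> 0" by (simp add: W_def)
    have "W * (cmod x * real (num (fst k)) ^ n) \<le>
       W * (C * (\<Sum>j<3. cmod (x * (deriv ^^ n) (\<lambda>w. kern k w ^ (\<gamma> + j)) a + y * (deriv ^^ m) (\<lambda>w. kern k w ^ (\<gamma> + j)) b)))"
      by (intro mult_left_mono C(2) ab W)
    also have "\<dots> = C * (\<Sum>j<3. cmod (of_real W * (x * (deriv ^^ n) (\<lambda>w. kern k w ^ (\<gamma> + j)) a + y * (deriv ^^ m) (\<lambda>w. kern k w ^ (\<gamma> + j)) b)))"
      using W by (simp add: norm_mult sum_distrib_left mult_ac)
    also have "\<dots> = C * (\<Sum>j<3. cmod (x * (deriv ^^ n) (atom p (\<gamma> + j) k) a + y * (deriv ^^ m) (atom p (\<gamma> + j) k) b))"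
      unfolding higher_deriv_atom[OF a1] higher_deriv_atom[OF ab(2)] W_def[symmetric]
      by (simp add: algebra_simps)
    finally show "cmod x * (mass k powr (- 1 / p) * real (num (fst k)) ^ n) \<le>
        C * (\<Sum>j<3. cmod (x * (deriv ^^ n) (atom p (\<gamma> + j) k) a + y * (deriv ^^ m) (atom p (\<gamma> + j) k) b))"
      by (simp add: W_def mult_ac)
  qed
qed

definition level_nodes :: "nat \<Rightarrow> nat \<Rightarrow> (nat \<times> nat) set" where
  "level_nodes I J = (SIGMA i:{I..<J}. {..<num i})"

lemma finite_level_nodes: "finite (level_nodes I J)"
  by (simp add: level_nodes_def)

lemma level_nodes_subset: "level_nodes I J \<subseteq> nodes"
  by (auto simp: level_nodes_def nodes_def)

lemma level_nodes_cover:
  assumes "1 - 1 / real \<kappa> ^ I \<le> cmod w" "cmod w < 1 - 1 / real \<kappa> ^ J"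
  obtains k where "k \<in> level_nodes I J" "w \<in> cell k"
proof -
  have "0 < 1 / real \<kappa> ^ J" using kappa by simp
  hence "cmod w < 1" using assms(2) by linarith
  then obtain i where i: "w \<in> annulus \<kappa> i" using annulus_cover by blast
  obtain l where l: "l < num i" "w \<in> cell (i, l)" using cell_cover[OF i] by blast
  have mono: "1 - 1 / real \<kappa> ^ a \<le> 1 - 1 / real \<kappa> ^ b" if "a \<le> b" for a b
    using that kappa by (intro diff_left_mono divide_left_mono power_increasing) auto
  have "I \<le> i"
  proof (rule ccontr)
    assume "\<not> I \<le> i" hence "Suc i \<le> I" by simp
    from mono[OF this] show False using i assms(1) by (simp add: annulus_def)
  qed
  moreover have "i < J"
  proof (rule ccontr)
    assume "\<not> i < J" hence "J \<le> i" by simp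
    from mono[OF this] show False using i assms(2) by (simp add: annulus_def)
  qed
  ultimately have "(i, l) \<in> level_nodes I J" using l by (simp add: level_nodes_def)
  with l show thesis by (intro that)
qed

end

context bergman_space
begin

text \<open>
  A sequence \<open>d\<close> that dominates \<open>f\<^sup>(\<^sup>n\<^sup>)\<close> on every cell, in the scale in which the \<open>n\<close>-th derivative of
  a single atom has size one on its own cell, and that is bounded by \<open>C\<^sup>1\<^sup>/\<^sup>p\<close> in \<open>\<ell>\<^sup>p\<close>.
\<close>

definition coefficient_majorant :: "nat \<Rightarrow> (complex \<Rightarrow> complex) \<Rightarrow> real \<Rightarrow> (nat \<times> nat \<Rightarrow> real) \<Rightarrow> bool" where
  "coefficient_majorant n f C d \<longleftrightarrow> (\<forall>k. 0 \<le> d k) \<and>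
     (\<forall>k. \<forall>w\<in>cell k. cmod ((deriv ^^ n) f w) \<le> d k * (mass k powr (- 1 / p) * real (num (fst k)) ^ n)) \<and>
     (\<forall>K. finite K \<longrightarrow> K \<subseteq> nodes \<longrightarrow> (\<Sum>k\<in>K. d k powr p) \<le> C)"

lemma coefficient_majorantD:
  assumes "coefficient_majorant n f C d"
  shows "0 \<le> d k"
    "w \<in> cell k \<Longrightarrow> cmod ((deriv ^^ n) f w) \<le> d k * (mass k powr (- 1 / p) * real (num (fst k)) ^ n)"
    "finite K \<Longrightarrow> K \<subseteq> nodes \<Longrightarrow> (\<Sum>k\<in>K. d k powr p) \<le> C"
  using assms unfolding coefficient_majorant_def by blast+

text \<open>
  Take the maximum of \<open>\<bar>f\<^sup>(\<^sup>n\<^sup>)\<bar>\<close> over each (compact) cell and apply \<open>sampling\<close> to the points where it is attained.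
\<close>

lemma derivative_coefficients:
  obtains C where "C > 0"
    "\<And>f. f holomorphic_on ball 0 1 \<Longrightarrow> bergman_norm \<omega> p f \<le> 1 \<Longrightarrow> \<exists>d. coefficient_majorant n f C d"
proof -
  have p1: "1 \<le> p" using p by simp
  obtain C where C: "C > 0"
    "\<And>f w K. f holomorphic_on ball 0 1 \<Longrightarrow> (\<And>k. k \<in> nodes \<Longrightarrow> w k \<in> cell k) \<Longrightarrow> finite K \<Longrightarrow> K \<subseteq> nodes \<Longrightarrow>
       ennreal (\<Sum>k\<in>K. mass k * (cmod ((deriv ^^ n) f (w k)) / real (num (fst k)) ^ n) powr p) \<le> ennreal C * disc_power_integral \<mu> p f"
    by (rule sampling[OF p1, of n]) blast
  show thesis
  proof (rule that[OF C(1)])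
    fix f assume f: "f holomorphic_on ball 0 1" "bergman_norm \<omega> p f \<le> 1"
    have "\<exists>v\<in>cell k. \<forall>w\<in>cell k. cmod ((deriv ^^ n) f w) \<le> cmod ((deriv ^^ n) f v)" for k
    proof (rule continuous_attains_sup)
      show "compact (cell k)" by (rule compact_cell)
      show "cell k \<noteq> {}" using node_in_cell[of k] by auto
      show "continuous_on (cell k) (\<lambda>w. cmod ((deriv ^^ n) f w))"
        by (intro continuous_intros continuous_on_subset[OF holomorphic_on_imp_continuous_on[OF holomorphic_higher_deriv[OF f(1)]] cell_subset_ball]) auto
    qed
    then obtain v where v: "\<And>k. v k \<in> cell k" "\<And>k w. w \<in> cell k \<Longrightarrow> cmod ((deriv ^^ n) f w) \<le> cmod ((deriv ^^ n) f (v k))"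
      by metis
    define d where "d k = mass k powr (1 / p) * (cmod ((deriv ^^ n) f (v k)) / real (num (fst k)) ^ n)" for k
    have d0: "0 \<le> d k" for k by (simp add: d_def)
    have "cmod ((deriv ^^ n) f w) \<le> d k * (mass k powr (- 1 / p) * real (num (fst k)) ^ n)" if "w \<in> cell k" for k w
    proof -
      have "mass k powr (1 / p) * mass k powr (- 1 / p) = 1"
        using mass_pos[of k] by (simp flip: powr_add)
      hence "d k * (mass k powr (- 1 / p) * real (num (fst k)) ^ n) = cmod ((deriv ^^ n) f (v k))"
        by (simp add: d_def field_simps)
      thus ?thesis using v(2)[OF that] by simp
    qed
    moreover have "(\<Sum>k\<in>K. d k powr p) \<le> C" if K: "finite K" "K \<subseteq> nodes" for K
    proof -
      have "disc_power_integral \<mu> p f \<le> 1" using bergman_norm_le_iff[OF f(1), of 1] f(2) by simp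
      have "d k powr p = mass k * (cmod ((deriv ^^ n) f (v k)) / real (num (fst k)) ^ n) powr p" for k
      proof -
        have "(mass k powr (1 / p)) powr p = mass k" using mass_pos[of k] p by (simp add: powr_powr)
        thus ?thesis unfolding d_def by (simp only: powr_mult)
      qed
      hence "ennreal (\<Sum>k\<in>K. d k powr p) \<le> ennreal C * disc_power_integral \<mu> p f"
        using C(2)[OF f(1) _ K, of v] v(1) by simp
      also have "\<dots> \<le> ennreal C * 1" by (rule mult_left_mono) (fact, simp)
      finally show ?thesis using C(1) by simp
    qed
    ultimately show "\<exists>d. coefficient_majorant n f C d"
      using d0 unfolding coefficient_majorant_def by blast
  qed
qed

definition synthesis_constant :: "nat \<Rightarrow> real \<Rightarrow> bool" where
  "synthesis_constant \<gamma> M \<longleftrightarrow> 0 < M \<and> (\<forall>K d. finite K \<longrightarrow> K \<subseteq> nodes \<longrightarrow>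
     bergman_norm \<omega> p (\<lambda>z. \<Sum>k\<in>K. d k * atom p \<gamma> k z) \<le> ennreal (M * (\<Sum>k\<in>K. cmod (d k) powr p) powr (1 / p)))"

lemma synthesis_constantD:
  assumes "synthesis_constant \<gamma> M"
  shows "0 < M" "finite K \<Longrightarrow> K \<subseteq> nodes \<Longrightarrow>
     bergman_norm \<omega> p (\<lambda>z. \<Sum>k\<in>K. d k * atom p \<gamma> k z) \<le> ennreal (M * (\<Sum>k\<in>K. cmod (d k) powr p) powr (1 / p))"
  using assms unfolding synthesis_constant_def by blast+

lemma synthesis_norm:
  obtains \<gamma>0 M where "1 \<le> \<gamma>0" "\<And>\<gamma>. \<gamma>0 \<le> \<gamma> \<Longrightarrow> synthesis_constant \<gamma> M"
proof -
  obtain \<gamma>0 C where C: "C > 0"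
    "\<And>\<gamma> K d. \<gamma>0 \<le> \<gamma> \<Longrightarrow> finite K \<Longrightarrow> K \<subseteq> nodes \<Longrightarrow>
       disc_power_integral \<mu> p (\<lambda>z. \<Sum>k\<in>K. d k * atom p \<gamma> k z) \<le> ennreal (C * (\<Sum>k\<in>K. cmod (d k) powr p))"
    by (rule synthesis[OF p]) blast
  show thesis
  proof (rule that[of "max 1 \<gamma>0" "C powr (1 / p)"])
    fix \<gamma> assume \<gamma>: "max 1 \<gamma>0 \<le> \<gamma>"
    show "synthesis_constant \<gamma> (C powr (1 / p))" unfolding synthesis_constant_def
    proof (intro conjI allI impI)
      fix K d assume K: "finite K" "K \<subseteq> nodes"
      have S: "0 \<le> (\<Sum>k\<in>K. cmod (d k) powr p)" by (intro sum_nonneg) auto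
      have "(\<lambda>z. \<Sum>k\<in>K. d k * atom p \<gamma> k z) holomorphic_on ball 0 1"
        by (intro holomorphic_intros atom_holomorphic)
      moreover have "C * (\<Sum>k\<in>K. cmod (d k) powr p) = (C powr (1 / p) * (\<Sum>k\<in>K. cmod (d k) powr p) powr (1 / p)) powr p"
        using C(1) S p by (simp add: powr_mult powr_powr)
      ultimately show "bergman_norm \<omega> p (\<lambda>z. \<Sum>k\<in>K. d k * atom p \<gamma> k z) \<le> ennreal (C powr (1 / p) * (\<Sum>k\<in>K. cmod (d k) powr p) powr (1 / p))"
        using C(1) C(2)[of \<gamma> K d] \<gamma> K by (subst bergman_norm_le_iff) auto
    qed (use C in auto)
  qed simp
qed

lemma atom_sum_bergman:
  assumes "bergman_norm \<omega> p (\<lambda>z. \<Sum>k\<in>K. d k * atom p \<gamma> k z) \<le> ennreal X"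
  shows "(\<lambda>z. \<Sum>k\<in>K. d k * atom p \<gamma> k z) \<in> bergman \<omega> p"
  unfolding bergman_def using le_less_trans[OF assms] by (auto intro!: holomorphic_intros atom_holomorphic)

lemma atom_bergman:
  assumes "synthesis_constant \<gamma> M" "k \<in> nodes"
  shows "bergman_norm \<omega> p (atom p \<gamma> k) \<le> ennreal M" "atom p \<gamma> k \<in> bergman \<omega> p"
proof -
  show n: "bergman_norm \<omega> p (atom p \<gamma> k) \<le> ennreal M"
    using synthesis_constantD(2)[OF assms(1), of "{k}" "\<lambda>_. 1"] assms(2) by simp
  show "atom p \<gamma> k \<in> bergman \<omega> p"
    using le_less_trans[OF n] by (simp add: bergman_def atom_holomorphic)
qed

text \<open>
  The separation estimate, multiplied by the coefficient \<open>d k\<close>. Where \<open>\<phi>(z)\<close> lies in a cell, the term of order \<open>n\<close> is seen by the full operator on three atoms;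
  this holds wherever \<open>\<psi>(z)\<close> lies.
\<close>

lemma cell_domination:
  assumes nm: "n < m" and \<gamma>: "1 \<le> \<gamma>" and q: "1 \<le> q"
  obtains B where "B > 0"
    "\<And>u \<phi> v \<psi> f C d k z. coefficient_majorant n f C d \<Longrightarrow> self_map \<psi> \<Longrightarrow> z \<in> ball 0 1 \<Longrightarrow> \<phi> z \<in> cell k \<Longrightarrow>
       cmod (weighted_comp_diff u \<phi> n f z) powr q \<le>
         B * d k powr q * (\<Sum>j<3. cmod (two_term u \<phi> n v \<psi> m (atom p (\<gamma> + j) k) z) powr q)"
proof -
  obtain Cs where Cs: "Cs > 0"
    "\<And>k a b x y. a \<in> cell k \<Longrightarrow> cmod b < 1 \<Longrightarrow>
      cmod x * (mass k powr (- 1 / p) * real (num (fst k)) ^ n) \<le>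
        Cs * (\<Sum>j<3. cmod (x * (deriv ^^ n) (atom p (\<gamma> + j) k) a + y * (deriv ^^ m) (atom p (\<gamma> + j) k) b))"
    by (rule atom_separation[OF nm \<gamma>, of p]) blast
  show thesis
  proof (rule that[of "Cs powr q * 3 powr (q - 1)"])
    fix u \<phi> v \<psi> :: "complex \<Rightarrow> complex" and f C d k z
    assume d: "coefficient_majorant n f C d" and \<psi>: "self_map \<psi>" and z: "z \<in> ball 0 1" and k: "\<phi> z \<in> cell k"
    define X where "X j = cmod (two_term u \<phi> n v \<psi> m (atom p (\<gamma> + j) k) z)" for j
    have "\<psi> z \<in> ball 0 1" using \<psi> z unfolding self_map_def by blast
    hence \<psi>z: "cmod (\<psi> z) < 1" by simp
    have "cmod (weighted_comp_diff u \<phi> n f z) \<le> cmod (u z) * (d k * (mass k powr (- 1 / p) * real (num (fst k)) ^ n))"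
      unfolding weighted_comp_diff_def norm_mult by (intro mult_left_mono coefficient_majorantD(2)[OF d] k) auto
    also have "\<dots> = d k * (cmod (u z) * (mass k powr (- 1 / p) * real (num (fst k)) ^ n))" by simp
    also have "\<dots> \<le> d k * (Cs * (\<Sum>j<3. X j))"
      unfolding X_def two_term_def weighted_comp_diff_def
      by (intro mult_left_mono Cs(2) k \<psi>z coefficient_majorantD(1)[OF d])
    finally have "cmod (weighted_comp_diff u \<phi> n f z) powr q \<le> (d k * (Cs * (\<Sum>j<3. X j))) powr q"
      using q by (intro powr_mono2) auto
    also have "\<dots> = d k powr q * (Cs powr q * (\<Sum>j<3. X j) powr q)" by (simp only: powr_mult)
    also have "\<dots> \<le> d k powr q * (Cs powr q * (3 powr (q - 1) * (\<Sum>j<3. X j powr q)))"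
      using q by (intro mult_left_mono sum3_powr_le) (auto simp: X_def)
    finally show "cmod (weighted_comp_diff u \<phi> n f z) powr q \<le> Cs powr q * 3 powr (q - 1) * d k powr q * (\<Sum>j<3. X j powr q)"
      by (simp add: mult_ac)
  qed (use Cs in auto)
qed

lemma Lq_power_exhaustion:
  assumes \<upsilon>: "borel_measure_on_disc \<upsilon>" and \<phi>: "self_map \<phi>" and g: "g \<in> borel_measurable \<upsilon>"
    and bound: "\<And>I. (\<integral>\<^sup>+z. ennreal (cmod (g z) powr q) * indicator {z. cmod (\<phi> z) < 1 - 1 / real \<kappa> ^ I} z \<partial>\<upsilon>) \<le> X"
  shows "Lq_power \<upsilon> q g \<le> X"
proof -
  define G where "G I z = ennreal (cmod (g z) powr q) * indicator {z. cmod (\<phi> z) < 1 - 1 / real \<kappa> ^ I} z" for I z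
  have \<phi>_meas: "\<phi> \<in> borel_measurable \<upsilon>"
    using \<phi> unfolding self_map_def by (intro continuous_on_disc_measurable[OF \<upsilon>] holomorphic_on_imp_continuous_on) auto
  have G_meas: "G I \<in> borel_measurable \<upsilon>" for I
  proof -
    note [measurable] = \<phi>_meas g
    have "G I = (\<lambda>z. if cmod (\<phi> z) < 1 - 1 / real \<kappa> ^ I then ennreal (cmod (g z) powr q) else 0)"
      by (auto simp: G_def)
    thus ?thesis by simp
  qed
  have "Lq_power \<upsilon> q g = (\<integral>\<^sup>+z. (SUP I. G I z) \<partial>\<upsilon>)"
    unfolding Lq_power_def
  proof (rule nn_integral_cong)
    fix z assume z: "z \<in> space \<upsilon>"
    hence "\<phi> z \<in> ball 0 1" using \<phi> unfolding space_disc_measure[OF \<upsilon>] self_map_def by blast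
    hence "cmod (\<phi> z) < 1" by simp
    then obtain i where "\<phi> z \<in> annulus \<kappa> i" using annulus_cover by blast
    hence Gi: "G (Suc i) z = ennreal (cmod (g z) powr q)" by (simp add: G_def annulus_def)
    show "ennreal (cmod (g z) powr q) = (SUP I. G I z)"
    proof (rule antisym)
      show "ennreal (cmod (g z) powr q) \<le> (SUP I. G I z)"
        by (rule SUP_upper2[of "Suc i"]) (simp_all add: Gi)
      show "(SUP I. G I z) \<le> ennreal (cmod (g z) powr q)"
        by (rule SUP_least) (simp add: G_def split: split_indicator)
    qed
  qed
  also have "\<dots> = (SUP I. \<integral>\<^sup>+z. G I z \<partial>\<upsilon>)"
  proof (rule nn_integral_monotone_convergence_SUP)
    have mono: "1 - 1 / real \<kappa> ^ i \<le> 1 - 1 / real \<kappa> ^ j" if "i \<le> j" for i j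
      using that kappa by (intro diff_left_mono divide_left_mono power_increasing) auto
    show "incseq G"
    proof (intro incseq_SucI le_funI)
      fix i z show "G i z \<le> G (Suc i) z"
        using mono[of i "Suc i"] by (auto simp: G_def simp del: power_Suc split: split_indicator)
    qed
  qed (rule G_meas)
  also have "\<dots> \<le> X" by (rule SUP_least) (use bound in \<open>simp add: G_def\<close>)
  finally show ?thesis .
qed

text \<open>
  The functions \<open>F j E\<close> carry the coefficients of \<open>f\<close> with signs given by the set \<open>E\<close>. Their norms are
  bounded by synthesis and sampling. Averaging \<open>\<bar>S (F j E)\<bar>\<^sup>q\<close> over \<open>E\<close> dominates every node, in particular the
  one whose cell contains \<open>\<phi>(z)\<close>.
\<close>

theorem op_norm_lower_order_term:
  assumes nm: "n < m" and q: "1 < q"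
  obtains C where "C > 0"
    "\<And>\<upsilon> \<phi> \<psi> u v. borel_measure_on_disc \<upsilon> \<Longrightarrow> self_map \<phi> \<Longrightarrow> self_map \<psi> \<Longrightarrow> u holomorphic_on ball 0 1 \<Longrightarrow> v holomorphic_on ball 0 1 \<Longrightarrow>
      op_norm \<omega> p \<upsilon> q (weighted_comp_diff u \<phi> n) \<le> ennreal C * op_norm \<omega> p \<upsilon> q (two_term u \<phi> n v \<psi> m)"
proof -
  have q1: "1 \<le> q" "0 < q" using q by auto
  obtain \<gamma>0 M where M: "1 \<le> \<gamma>0" "\<And>\<gamma>. \<gamma>0 \<le> \<gamma> \<Longrightarrow> synthesis_constant \<gamma> M"
    by (rule synthesis_norm) blast
  have M0: "M > 0" by (rule synthesis_constantD[OF M(2)[OF order.refl]])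
  obtain B where B: "B > 0"
    "\<And>u \<phi> v \<psi> f C d k z. coefficient_majorant n f C d \<Longrightarrow> self_map \<psi> \<Longrightarrow> z \<in> ball 0 1 \<Longrightarrow> \<phi> z \<in> cell k \<Longrightarrow>
       cmod (weighted_comp_diff u \<phi> n f z) powr q \<le>
         B * d k powr q * (\<Sum>j<3. cmod (two_term u \<phi> n v \<psi> m (atom p (\<gamma>0 + j) k) z) powr q)"
    by (rule cell_domination[OF nm M(1) q1(1)]) blast
  obtain Cd where Cd: "Cd > 0"
    "\<And>f. f holomorphic_on ball 0 1 \<Longrightarrow> bergman_norm \<omega> p f \<le> 1 \<Longrightarrow> \<exists>d. coefficient_majorant n f Cd d"
    by (rule derivative_coefficients[of n]) blast
  define X where "X = M * Cd powr (1 / p)"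
  have X: "X > 0" using M0 Cd by (simp add: X_def)
  define C where "C = (3 * B) powr (1 / q) * X"
  have C: "C > 0" using B X by (simp add: C_def)
  have main: "op_norm \<omega> p \<upsilon> q (weighted_comp_diff u \<phi> n) \<le> ennreal C * op_norm \<omega> p \<upsilon> q (two_term u \<phi> n v \<psi> m)"
    if \<upsilon>: "borel_measure_on_disc \<upsilon>" and \<phi>: "self_map \<phi>" and \<psi>: "self_map \<psi>"
      and u: "u holomorphic_on ball 0 1" and v: "v holomorphic_on ball 0 1" for \<upsilon> \<phi> \<psi> u v
  proof -
    define A where "A = weighted_comp_diff u \<phi> n"
    define S where "S = two_term u \<phi> n v \<psi> m"
    have A_meas: "A f \<in> borel_measurable \<upsilon>" if "f holomorphic_on ball 0 1" for f
      unfolding A_def by (intro weighted_comp_diff_measurable \<upsilon> \<phi> u that)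
    have S_meas: "S f \<in> borel_measurable \<upsilon>" if "f holomorphic_on ball 0 1" for f
      unfolding S_def by (intro two_term_measurable \<upsilon> \<phi> \<psi> u v that)
    show ?thesis
    proof (cases "op_norm \<omega> p \<upsilon> q S")
      case top
      thus ?thesis using C unfolding S_def by (simp add: ennreal_mult_top)
    next
      case (real s)
      have "Lq_norm \<upsilon> q (A f) \<le> ennreal (C * s)" if f: "f \<in> bergman \<omega> p" "bergman_norm \<omega> p f \<le> 1" for f
      proof -
        have fh: "f holomorphic_on ball 0 1" by (rule bergman_holomorphic[OF f(1)])
        obtain d where d: "coefficient_majorant n f Cd d" using Cd(2)[OF fh f(2)] by blast
        note d0 = coefficient_majorantD(1)[OF d]
        have bound: "(\<integral>\<^sup>+z. ennreal (cmod (A f z) powr q) * indicator {z. cmod (\<phi> z) < 1 - 1 / real \<kappa> ^ I} z \<partial>\<upsilon>) \<le> ennreal ((C * s) powr q)" for I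
        proof -
          define K where "K = level_nodes 0 I"
          have K: "finite K" "K \<subseteq> nodes" by (simp_all add: K_def finite_level_nodes level_nodes_subset)
          define a where "a j k z = of_real (d k) * S (atom p (\<gamma>0 + j) k) z" for j k z
          define F where "F j E = (\<lambda>w. \<Sum>k\<in>K. ((if k \<in> E then 1 else -1) * of_real (d k)) * atom p (\<gamma>0 + j) k w)" for j :: nat and E
          have SF: "S (F j E) z = sign_sum K (\<lambda>k. a j k z) E" if "z \<in> ball 0 1" for j E z
            unfolding F_def sign_sum_def a_def S_def using K \<phi> \<psi> that
            by (subst two_term_sum) (auto intro!: atom_holomorphic simp: mult.assoc)
          have Fn: "bergman_norm \<omega> p (F j E) \<le> ennreal X" for j E
          proof -
            have "bergman_norm \<omega> p (F j E) \<le> ennreal (M * (\<Sum>k\<in>K. cmod ((if k \<in> E then 1 else -1) * of_real (d k)) powr p) powr (1 / p))"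
              unfolding F_def by (intro synthesis_constantD(2)[OF M(2)] K) auto
            also have "(\<Sum>k\<in>K. cmod ((if k \<in> E then 1 else -1) * of_real (d k)) powr p) = (\<Sum>k\<in>K. d k powr p)"
              using d0 by (intro sum.cong refl) (auto simp: norm_mult)
            also have "ennreal (M * (\<Sum>k\<in>K. d k powr p) powr (1 / p)) \<le> ennreal X"
              unfolding X_def using coefficient_majorantD(3)[OF d K] M0 p
              by (intro ennreal_leI mult_left_mono powr_mono2 sum_nonneg) auto
            finally show ?thesis .
          qed
          have FB: "F j E \<in> bergman \<omega> p" for j E
            unfolding F_def by (rule atom_sum_bergman) (use Fn[of j E] in \<open>simp add: F_def\<close>)
          have SFn: "Lq_power \<upsilon> q (S (F j E)) \<le> ennreal ((X * s) powr q)" for j E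
          proof -
            have "Lq_norm \<upsilon> q (S (F j E)) \<le> ennreal X * op_norm \<omega> p \<upsilon> q S"
              unfolding S_def
              by (intro op_norm_bound two_term_cmult two_term_measurable \<upsilon> \<phi> \<psi> u v bergman_holomorphic q1 X Fn FB)
            also have "\<dots> = ennreal (X * s)" using X real by (simp add: ennreal_mult)
            finally show ?thesis using X real q by (subst (asm) Lq_norm_le_iff) auto
          qed
          have pw: "ennreal (cmod (A f z) powr q) * indicator {z. cmod (\<phi> z) < 1 - 1 / real \<kappa> ^ I} z
              \<le> ennreal (B / 2 ^ card K) * (\<Sum>j<3. \<Sum>E\<in>Pow K. ennreal (cmod (S (F j E) z) powr q))" if z: "z \<in> ball 0 1" for z
          proof (cases "cmod (\<phi> z) < 1 - 1 / real \<kappa> ^ I")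
            case True
            obtain k where k: "k \<in> K" "\<phi> z \<in> cell k"
              using level_nodes_cover[of 0 "\<phi> z" I] True unfolding K_def by auto
            have "cmod (A f z) powr q \<le> B * d k powr q * (\<Sum>j<3. cmod (S (atom p (\<gamma>0 + j) k) z) powr q)"
              unfolding A_def S_def by (rule B(2)[where z = z and \<phi> = \<phi>, OF d \<psi> z k(2)])
            also have "\<dots> = B * (\<Sum>j<3. cmod (a j k z) powr q)"
              using d0[of k] by (simp add: a_def norm_mult powr_mult sum_distrib_left mult.assoc)
            also have "\<dots> \<le> B * (\<Sum>j<3. (\<Sum>E\<in>Pow K. cmod (sign_sum K (\<lambda>k. a j k z) E) powr q) / 2 ^ card K)"
              using q B K k by (intro mult_left_mono sum_mono sign_sum_average[where x = "\<lambda>k. a _ k z"]) auto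
            also have "\<dots> = B / 2 ^ card K * (\<Sum>j<3. \<Sum>E\<in>Pow K. cmod (S (F j E) z) powr q)"
              unfolding SF[OF z] by (simp add: sum_divide_distrib[symmetric])
            finally have "ennreal (cmod (A f z) powr q) \<le> ennreal \<dots>" by (rule ennreal_leI)
            also have "\<dots> = ennreal (B / 2 ^ card K) * (\<Sum>j<3. \<Sum>E\<in>Pow K. ennreal (cmod (S (F j E) z) powr q))"
              using B by (subst ennreal_mult) (auto simp: sum_nonneg)
            finally show ?thesis using True by simp
          qed simp
          have SFm: "(\<lambda>z. ennreal (cmod (S (F j E) z) powr q)) \<in> borel_measurable \<upsilon>" for j E
          proof -
            note [measurable] = S_meas[OF bergman_holomorphic[OF FB[of j E]]]
            show ?thesis by measurable
          qed
          have "(\<integral>\<^sup>+z. ennreal (cmod (A f z) powr q) * indicator {z. cmod (\<phi> z) < 1 - 1 / real \<kappa> ^ I} z \<partial>\<upsilon>)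
            \<le> (\<integral>\<^sup>+z. ennreal (B / 2 ^ card K) * (\<Sum>j<3. \<Sum>E\<in>Pow K. ennreal (cmod (S (F j E) z) powr q)) \<partial>\<upsilon>)"
            by (intro nn_integral_mono pw) (simp add: space_disc_measure[OF \<upsilon>])
          also have "\<dots> = ennreal (B / 2 ^ card K) * (\<Sum>j<3. \<Sum>E\<in>Pow K. Lq_power \<upsilon> q (S (F j E)))"
            unfolding Lq_power_def using SFm
            by (subst nn_integral_cmult, force intro!: borel_measurable_sum, subst nn_integral_sum, force intro!: borel_measurable_sum)
               (intro arg_cong2[where f = "(*)"] refl sum.cong nn_integral_sum)
          also have "\<dots> \<le> ennreal (B / 2 ^ card K) * (\<Sum>j<(3::nat). \<Sum>E\<in>Pow K. ennreal ((X * s) powr q))"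
            by (intro mult_left_mono sum_mono SFn) auto
          also have "\<dots> = ennreal (B / 2 ^ card K) * ennreal (\<Sum>j<(3::nat). \<Sum>E\<in>Pow K. (X * s) powr q)"
            by (simp only: sum_ennreal sum_nonneg powr_ge_zero)
          also have "\<dots> = ennreal (B / 2 ^ card K * (\<Sum>j<(3::nat). \<Sum>E\<in>Pow K. (X * s) powr q))"
            using B by (intro ennreal_mult[symmetric]) (auto intro!: sum_nonneg)
          also have "B / 2 ^ card K * (\<Sum>j<(3::nat). \<Sum>E\<in>Pow K. (X * s) powr q) = 3 * B * (X * s) powr q"
            using K by (simp add: card_Pow)
          also have "\<dots> = (C * s) powr q"
          proof -
            have "(C * s) powr q = ((3 * B) powr (1 / q)) powr q * (X * s) powr q"
              using B X real by (simp add: C_def powr_mult)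
            thus ?thesis using B q by (simp add: powr_powr)
          qed
          finally show ?thesis .
        qed
        have "Lq_power \<upsilon> q (A f) \<le> ennreal ((C * s) powr q)"
          by (rule Lq_power_exhaustion[OF \<upsilon> \<phi> A_meas[OF fh]]) (rule bound)
        thus ?thesis using q C real by (subst Lq_norm_le_iff) auto
      qed
      hence "op_norm \<omega> p \<upsilon> q A \<le> ennreal (C * s)" unfolding op_norm_def by (intro SUP_least) auto
      also have "\<dots> = ennreal C * op_norm \<omega> p \<upsilon> q S" using C real by (simp add: ennreal_mult)
      finally show ?thesis by (simp add: A_def S_def)
    qed
  qed
  from C main show thesis by (rule that)
qed

end

section \<open>Compact operators\<close>

lemma ennreal_le_INF_eps:
  fixes x :: ennreal and c :: real
  assumes "0 < c" and "\<And>K e. K \<in> A \<Longrightarrow> 0 < e \<Longrightarrow> x \<le> ennreal c * (f K + ennreal e)"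
  shows "x \<le> ennreal c * (INF K\<in>A. f K)"
proof (cases "(INF K\<in>A. f K) = top")
  case True
  thus ?thesis using assms(1) by (simp add: ennreal_mult_top)
next
  case False
  define y where "y = (INF K\<in>A. f K)"
  have y: "y < top" using False unfolding y_def by (simp only: less_top)
  have "x \<le> ennreal c * y"
  proof (rule ennreal_le_epsilon)
    fix e :: real assume e: "0 < e"
    define e' where "e' = e / (2 * (c + 1))"
    have e': "0 < e'" using e assms(1) by (simp add: e'_def)
    have "y < y + ennreal e'" using y e' by (cases y) (auto simp flip: ennreal_plus simp: ennreal_less_iff)
    then obtain K where K: "K \<in> A" "f K < y + ennreal e'" unfolding y_def INF_less_iff by auto
    have "x \<le> ennreal c * (f K + ennreal e')" by (rule assms(2)[OF K(1) e'])
    also have "\<dots> \<le> ennreal c * ((y + ennreal e') + ennreal e')"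
      using K(2) by (intro mult_left_mono add_mono) auto
    also have "\<dots> = ennreal c * y + ennreal (c * (2 * e'))"
      using assms(1) e' by (simp add: add.assoc distrib_left ennreal_mult flip: ennreal_plus)
    also have "c * (2 * e') \<le> e" using assms(1) e by (simp add: e'_def field_simps)
    hence "ennreal c * y + ennreal (c * (2 * e')) \<le> ennreal c * y + ennreal e"
      by (intro add_left_mono ennreal_leI)
    finally show "x \<le> ennreal c * y + ennreal e" .
  qed
  thus ?thesis by (simp add: y_def)
qed

context bergman_space
begin

lemma linear_op_add:
  fixes K1 K2 :: operator and \<eta> :: complex
  assumes q: "1 \<le> q" and K: "linear_op \<omega> p \<upsilon> q K1" "linear_op \<omega> p \<upsilon> q K2"
  shows "linear_op \<omega> p \<upsilon> q (\<lambda>f z. K1 f z + \<eta> * K2 f z)"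
  unfolding linear_op_def
proof (intro conjI ballI allI impI)
  fix f assume f: "f \<in> bergman \<omega> p"
  show "(\<lambda>z. K1 f z + \<eta> * K2 f z) \<in> Lq \<upsilon> q"
    using q by (intro Lq_add Lq_cmult linear_op_Lq[OF K(1) f] linear_op_Lq[OF K(2) f]) auto
next
  fix f g a b assume fg: "f \<in> bergman \<omega> p" "g \<in> bergman \<omega> p"
  show "AE z in \<upsilon>. K1 (\<lambda>w. a * f w + b * g w) z + \<eta> * K2 (\<lambda>w. a * f w + b * g w) z = a * (K1 f z + \<eta> * K2 f z) + b * (K1 g z + \<eta> * K2 g z)"
    using linear_op_lincomb[OF K(1) fg, of a b] linear_op_lincomb[OF K(2) fg, of a b]
    by eventually_elim (simp add: algebra_simps)
next
  fix f g assume fg: "f \<in> bergman \<omega> p" "g \<in> bergman \<omega> p" "\<forall>z\<in>ball 0 1. f z = g z"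
  have "AE z in \<upsilon>. K1 f z = K1 g z" "AE z in \<upsilon>. K2 f z = K2 g z"
    using K fg unfolding linear_op_def by blast+
  thus "AE z in \<upsilon>. K1 f z + \<eta> * K2 f z = K1 g z + \<eta> * K2 g z" by eventually_elim simp
qed

lemma compact_op_add:
  fixes K1 K2 :: operator and \<eta> :: complex
  assumes q: "1 \<le> q" and K: "compact_op \<omega> p \<upsilon> q K1" "compact_op \<omega> p \<upsilon> q K2"
  shows "compact_op \<omega> p \<upsilon> q (\<lambda>f z. K1 f z + \<eta> * K2 f z)"
proof -
  have lin: "linear_op \<omega> p \<upsilon> q K1" "linear_op \<omega> p \<upsilon> q K2" using K by (auto simp: compact_op_def)
  have "\<exists>s g. strict_mono s \<and> g \<in> Lq \<upsilon> q \<and> (\<lambda>j. Lq_norm \<upsilon> q (\<lambda>z. K1 (F (s j)) z + \<eta> * K2 (F (s j)) z - g z)) \<longlonglongrightarrow> 0"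
    if F: "\<forall>j. F j \<in> bergman \<omega> p \<and> bergman_norm \<omega> p (F j) \<le> 1" for F :: "nat \<Rightarrow> complex \<Rightarrow> complex"
  proof -
    obtain s1 g1 where 1: "strict_mono s1" "g1 \<in> Lq \<upsilon> q" "(\<lambda>j. Lq_norm \<upsilon> q (\<lambda>z. K1 (F (s1 j)) z - g1 z)) \<longlonglongrightarrow> 0"
      using K(1) F unfolding compact_op_def by blast
    have F1: "\<forall>j. F (s1 j) \<in> bergman \<omega> p \<and> bergman_norm \<omega> p (F (s1 j)) \<le> 1" using F by simp
    obtain s2 g2 where 2: "strict_mono s2" "g2 \<in> Lq \<upsilon> q" "(\<lambda>j. Lq_norm \<upsilon> q (\<lambda>z. K2 (F (s1 (s2 j))) z - g2 z)) \<longlonglongrightarrow> 0"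
      using K(2) F1 unfolding compact_op_def by (elim conjE allE[of _ "\<lambda>j. F (s1 j)"]) blast
    define s where "s = s1 \<circ> s2"
    define g where "g z = g1 z + \<eta> * g2 z" for z
    have s: "strict_mono s" unfolding s_def using 1(1) 2(1) by (rule strict_mono_o)
    have g: "g \<in> Lq \<upsilon> q" unfolding g_def using q by (intro Lq_add Lq_cmult 1 2) auto
    have l1: "(\<lambda>j. Lq_norm \<upsilon> q (\<lambda>z. K1 (F (s j)) z - g1 z)) \<longlonglongrightarrow> 0"
      using LIMSEQ_subseq_LIMSEQ[OF 1(3) 2(1)] by (simp add: o_def s_def)
    have le: "Lq_norm \<upsilon> q (\<lambda>z. K1 (F (s j)) z + \<eta> * K2 (F (s j)) z - g z)
       \<le> 2 * (Lq_norm \<upsilon> q (\<lambda>z. K1 (F (s j)) z - g1 z) + ennreal (cmod \<eta>) * Lq_norm \<upsilon> q (\<lambda>z. K2 (F (s1 (s2 j))) z - g2 z))" for j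
    proof -
      have m: "(\<lambda>z. K1 (F (s j)) z - g1 z) \<in> Lq \<upsilon> q" "(\<lambda>z. K2 (F (s j)) z - g2 z) \<in> Lq \<upsilon> q"
        using q F by (auto intro!: Lq_diff linear_op_Lq[OF lin(1)] linear_op_Lq[OF lin(2)] 1 2)
      hence m': "(\<lambda>z. K1 (F (s j)) z - g1 z) \<in> borel_measurable \<upsilon>" "(\<lambda>z. K2 (F (s j)) z - g2 z) \<in> borel_measurable \<upsilon>"
        by (auto simp: Lq_def)
      have "Lq_norm \<upsilon> q (\<lambda>z. (K1 (F (s j)) z - g1 z) + \<eta> * (K2 (F (s j)) z - g2 z))
        \<le> 2 * (Lq_norm \<upsilon> q (\<lambda>z. K1 (F (s j)) z - g1 z) + Lq_norm \<upsilon> q (\<lambda>z. \<eta> * (K2 (F (s j)) z - g2 z)))"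
        using q m' by (intro Lq_norm_add_le) auto
      also have "Lq_norm \<upsilon> q (\<lambda>z. \<eta> * (K2 (F (s j)) z - g2 z)) = ennreal (cmod \<eta>) * Lq_norm \<upsilon> q (\<lambda>z. K2 (F (s j)) z - g2 z)"
        using q m' by (intro Lq_norm_cmult) auto
      finally show ?thesis by (simp add: g_def s_def algebra_simps)
    qed
    have L: "(\<lambda>j. 2 * (Lq_norm \<upsilon> q (\<lambda>z. K1 (F (s j)) z - g1 z) + ennreal (cmod \<eta>) * Lq_norm \<upsilon> q (\<lambda>z. K2 (F (s1 (s2 j))) z - g2 z))) \<longlonglongrightarrow> 2 * (0 + ennreal (cmod \<eta>) * 0)"
      by (intro ennreal_tendsto_cmult tendsto_add l1 2(3)) auto
    have "(\<lambda>j. Lq_norm \<upsilon> q (\<lambda>z. K1 (F (s j)) z + \<eta> * K2 (F (s j)) z - g z)) \<longlonglongrightarrow> 0"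
      by (rule tendsto_sandwich[OF eventuallyI eventuallyI tendsto_const L[unfolded mult_zero_right add_0_left]]) (rule zero_le, rule le)
    with s g show ?thesis by blast
  qed
  thus ?thesis unfolding compact_op_def using linear_op_add[OF q lin] by blast
qed

lemma op_norm_add_le:
  fixes T1 T2 :: operator and \<eta> :: complex
  assumes q: "1 \<le> q"
    and m1: "\<And>f. f \<in> bergman \<omega> p \<Longrightarrow> T1 f \<in> borel_measurable \<upsilon>"
    and m2: "\<And>f. f \<in> bergman \<omega> p \<Longrightarrow> T2 f \<in> borel_measurable \<upsilon>"
    and \<eta>: "cmod \<eta> = 1"
  shows "op_norm \<omega> p \<upsilon> q (\<lambda>f z. T1 f z + \<eta> * T2 f z) \<le> 2 * (op_norm \<omega> p \<upsilon> q T1 + op_norm \<omega> p \<upsilon> q T2)"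
  unfolding op_norm_def[of _ _ _ _ "\<lambda>f z. T1 f z + \<eta> * T2 f z"]
proof (rule SUP_least)
  fix f assume f: "f \<in> {f \<in> bergman \<omega> p. bergman_norm \<omega> p f \<le> 1}"
  have "Lq_norm \<upsilon> q (\<lambda>z. T1 f z + \<eta> * T2 f z) \<le> 2 * (Lq_norm \<upsilon> q (T1 f) + Lq_norm \<upsilon> q (\<lambda>z. \<eta> * T2 f z))"
    using f m1 m2 by (intro Lq_norm_add_le q) auto
  also have "Lq_norm \<upsilon> q (\<lambda>z. \<eta> * T2 f z) = Lq_norm \<upsilon> q (T2 f)"
    using q f m2 \<eta> by (subst Lq_norm_cmult) auto
  also have "2 * (Lq_norm \<upsilon> q (T1 f) + Lq_norm \<upsilon> q (T2 f)) \<le> 2 * (op_norm \<omega> p \<upsilon> q T1 + op_norm \<omega> p \<upsilon> q T2)"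
    unfolding op_norm_def by (intro mult_left_mono add_mono SUP_upper f) auto
  finally show "Lq_norm \<upsilon> q (\<lambda>z. T1 f z + \<eta> * T2 f z) \<le> 2 * (op_norm \<omega> p \<upsilon> q T1 + op_norm \<omega> p \<upsilon> q T2)" .
qed

lemma essential_norm_add_le:
  fixes T1 T2 :: operator and \<eta> :: complex
  assumes q: "1 \<le> q"
    and m1: "\<And>f. f \<in> bergman \<omega> p \<Longrightarrow> T1 f \<in> borel_measurable \<upsilon>"
    and m2: "\<And>f. f \<in> bergman \<omega> p \<Longrightarrow> T2 f \<in> borel_measurable \<upsilon>"
    and \<eta>: "cmod \<eta> = 1"
  shows "essential_norm \<omega> p \<upsilon> q (\<lambda>f z. T1 f z + \<eta> * T2 f z) \<le> 2 * (essential_norm \<omega> p \<upsilon> q T1 + essential_norm \<omega> p \<upsilon> q T2)"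
proof -
  let ?e = "essential_norm \<omega> p \<upsilon> q (\<lambda>f z. T1 f z + \<eta> * T2 f z)"
  let ?Cp = "{K. compact_op \<omega> p \<upsilon> q K}"
  have le: "?e \<le> 2 * (op_norm \<omega> p \<upsilon> q (\<lambda>f z. T1 f z - K1 f z) + op_norm \<omega> p \<upsilon> q (\<lambda>f z. T2 f z - K2 f z))"
    if K: "K1 \<in> ?Cp" "K2 \<in> ?Cp" for K1 K2 :: operator
  proof -
    have Km: "f \<in> bergman \<omega> p \<Longrightarrow> K1 f \<in> borel_measurable \<upsilon>" "f \<in> bergman \<omega> p \<Longrightarrow> K2 f \<in> borel_measurable \<upsilon>" for f
      using K by (auto simp: compact_op_def linear_op_def Lq_def)
    have "?e \<le> op_norm \<omega> p \<upsilon> q (\<lambda>f z. (T1 f z + \<eta> * T2 f z) - (K1 f z + \<eta> * K2 f z))"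
      unfolding essential_norm_def by (rule INF_lower) (use compact_op_add[OF q] K in auto)
    also have "(\<lambda>f z. (T1 f z + \<eta> * T2 f z) - (K1 f z + \<eta> * K2 f z)) = (\<lambda>f z. (T1 f z - K1 f z) + \<eta> * (T2 f z - K2 f z))"
      by (simp add: algebra_simps fun_eq_iff)
    also have "op_norm \<omega> p \<upsilon> q \<dots> \<le> 2 * (op_norm \<omega> p \<upsilon> q (\<lambda>f z. T1 f z - K1 f z) + op_norm \<omega> p \<upsilon> q (\<lambda>f z. T2 f z - K2 f z))"
      using m1 m2 Km by (intro op_norm_add_le q \<eta> borel_measurable_diff) auto
    finally show ?thesis .
  qed
  show ?thesis
  proof (cases "essential_norm \<omega> p \<upsilon> q T1 = top \<or> essential_norm \<omega> p \<upsilon> q T2 = top")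
    case True thus ?thesis by (auto simp: ennreal_mult_top)
  next
    case False
    define a where "a = essential_norm \<omega> p \<upsilon> q T1"
    define b where "b = essential_norm \<omega> p \<upsilon> q T2"
    have ab: "a < top" "b < top" using False by (auto simp: a_def b_def less_top)
    have "?e \<le> 2 * (a + b)"
    proof (rule ennreal_le_epsilon)
      fix e :: real assume e: "0 < e"
      have less: "x < x + ennreal (e / 4)" if "x < top" for x
        using that e by (cases x) (auto simp flip: ennreal_plus simp: ennreal_less_iff)
      obtain K1 where K1: "K1 \<in> ?Cp" "op_norm \<omega> p \<upsilon> q (\<lambda>f z. T1 f z - K1 f z) < a + ennreal (e / 4)"
        using less[OF ab(1)] unfolding a_def essential_norm_def INF_less_iff by auto
      obtain K2 where K2: "K2 \<in> ?Cp" "op_norm \<omega> p \<upsilon> q (\<lambda>f z. T2 f z - K2 f z) < b + ennreal (e / 4)"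
        using less[OF ab(2)] unfolding b_def essential_norm_def INF_less_iff by auto
      have "?e \<le> 2 * ((a + ennreal (e / 4)) + (b + ennreal (e / 4)))"
        by (rule order.trans[OF le[OF K1(1) K2(1)]]) (intro mult_left_mono add_mono less_imp_le K1 K2, simp)
      also have "\<dots> = 2 * (a + b) + 2 * (ennreal (e / 4) + ennreal (e / 4))" by (simp add: distrib_left ac_simps)
      also have "2 * (ennreal (e / 4) + ennreal (e / 4)) = ennreal e"
      proof -
        have "2 * (ennreal (e / 4) + ennreal (e / 4)) = ennreal 2 * ennreal (e / 2)" using e by (simp flip: ennreal_plus)
        also have "\<dots> = ennreal e" using e by (subst ennreal_mult[symmetric]) auto
        finally show ?thesis .
      qed
      finally show "?e \<le> 2 * (a + b) + ennreal e" .
    qed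
    thus ?thesis by (simp add: a_def b_def)
  qed
qed

lemma compact_op_bounded:
  assumes q: "1 \<le> q" and K: "compact_op \<omega> p \<upsilon> q K"
  obtains b :: real where "0 \<le> b" "op_norm \<omega> p \<upsilon> q K \<le> ennreal b"
proof -
  have lin: "linear_op \<omega> p \<upsilon> q K" using K by (simp add: compact_op_def)
  have "\<exists>n::nat. \<forall>f. f \<in> bergman \<omega> p \<and> bergman_norm \<omega> p f \<le> 1 \<longrightarrow> Lq_norm \<upsilon> q (K f) \<le> ennreal (real n)"
  proof (rule ccontr)
    assume "\<not> ?thesis"
    hence "\<forall>n::nat. \<exists>f. f \<in> bergman \<omega> p \<and> bergman_norm \<omega> p f \<le> 1 \<and> ennreal (real n) < Lq_norm \<upsilon> q (K f)"
      by (auto simp: not_le)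
    then obtain F where F: "\<And>n. F n \<in> bergman \<omega> p" "\<And>n. bergman_norm \<omega> p (F n) \<le> 1" "\<And>n. ennreal (real n) < Lq_norm \<upsilon> q (K (F n))"
      by metis
    obtain s g where s: "strict_mono s" "g \<in> Lq \<upsilon> q" "(\<lambda>j. Lq_norm \<upsilon> q (\<lambda>z. K (F (s j)) z - g z)) \<longlonglongrightarrow> 0"
      using K F unfolding compact_op_def by blast
    obtain g0 where g0: "Lq_norm \<upsilon> q g = ennreal g0" "0 \<le> g0"
      using s(2) by (cases "Lq_norm \<upsilon> q g") (auto simp: Lq_def)
    have "eventually (\<lambda>j. Lq_norm \<upsilon> q (\<lambda>z. K (F (s j)) z - g z) < 1) sequentially"
      using order_tendstoD(2)[OF s(3), of 1] by simp
    then obtain J where J: "\<And>j. J \<le> j \<Longrightarrow> Lq_norm \<upsilon> q (\<lambda>z. K (F (s j)) z - g z) < 1"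
      by (auto simp: eventually_sequentially)
    define j where "j = max J (nat \<lceil>2 * (1 + g0)\<rceil>)"
    have jr: "2 * (1 + g0) \<le> real j" unfolding j_def by linarith
    have KL: "K (F (s j)) \<in> Lq \<upsilon> q" by (intro linear_op_Lq[OF lin] F)
    have m: "(\<lambda>z. K (F (s j)) z - g z) \<in> borel_measurable \<upsilon>" "g \<in> borel_measurable \<upsilon>"
      using Lq_diff[OF q KL s(2)] s(2) by (auto simp: Lq_def)
    have "Lq_norm \<upsilon> q (K (F (s j))) = Lq_norm \<upsilon> q (\<lambda>z. (K (F (s j)) z - g z) + g z)" by simp
    also have "\<dots> \<le> 2 * (Lq_norm \<upsilon> q (\<lambda>z. K (F (s j)) z - g z) + Lq_norm \<upsilon> q g)"
      by (intro Lq_norm_add_le q m)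
    also have "\<dots> \<le> 2 * (1 + ennreal g0)"
      unfolding g0 using J[of j] by (intro mult_left_mono add_right_mono) (auto simp: j_def)
    also have "\<dots> = ennreal (2 * (1 + g0))"
    proof -
      have "ennreal (2 * (1 + g0)) = ennreal 2 * (ennreal 1 + ennreal g0)"
        using g0(2) by (simp only: ennreal_mult ennreal_plus)
      thus ?thesis by simp
    qed
    also have "\<dots> \<le> ennreal (real (s j))"
      using jr seq_suble[OF s(1), of j] by (intro ennreal_leI) linarith
    finally show False using F(3)[of "s j"] by simp
  qed
  then obtain n :: nat where n: "\<And>f. f \<in> bergman \<omega> p \<Longrightarrow> bergman_norm \<omega> p f \<le> 1 \<Longrightarrow> Lq_norm \<upsilon> q (K f) \<le> ennreal (real n)"
    by blast
  have "op_norm \<omega> p \<upsilon> q K \<le> ennreal (real n)" unfolding op_norm_def by (rule SUP_least) (use n in auto)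
  thus thesis by (intro that[of "real n"]) auto
qed

text \<open>
  Otherwise \<open>K\<close> maps infinitely many atoms to functions of norm greater than \<open>\<epsilon>\<close>, and along a sequence of them
  the images converge to some \<open>g\<close>. Means of \<open>N\<close> of these atoms have norm at most of order \<open>N\<^sup>1\<^sup>/\<^sup>p\<^sup>-\<^sup>1\<close>, which tends to zero
  because \<open>p > 1\<close>, while their images approach \<open>g\<close>. So \<open>g = 0\<close>, a contradiction.
\<close>

lemma compact_op_atoms_vanish:
  assumes q: "1 < q" and K: "compact_op \<omega> p \<upsilon> q K" and syn: "synthesis_constant \<gamma> M"
    and \<epsilon>: "0 < \<epsilon>"
  obtains I :: nat where "\<And>k. k \<in> nodes \<Longrightarrow> I \<le> fst k \<Longrightarrow> Lq_norm \<upsilon> q (K (atom p \<gamma> k)) \<le> ennreal \<epsilon>"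
proof -
  have lin: "linear_op \<omega> p \<upsilon> q K" using K by (simp add: compact_op_def)
  have q1: "1 \<le> q" "0 < q" using q by auto
  have M: "M > 0" by (rule synthesis_constantD(1)[OF syn])
  define X where "X = {k \<in> nodes. \<not> Lq_norm \<upsilon> q (K (atom p \<gamma> k)) \<le> ennreal \<epsilon>}"
  have "finite X"
  proof (rule ccontr)
    assume "infinite X"
    then obtain e :: "nat \<Rightarrow> nat \<times> nat" where e: "inj e" "range e \<subseteq> X"
      using infinite_countable_subset by blast
    have eX: "e j \<in> nodes" "ennreal \<epsilon> < Lq_norm \<upsilon> q (K (atom p \<gamma> (e j)))" for j
      using e(2) by (auto simp: X_def not_le)
    define h where "h c J = (\<lambda>z. \<Sum>k\<in>e ` J. of_real c * atom p \<gamma> k z)" for c :: real and J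
    have hn: "bergman_norm \<omega> p (h c J) \<le> ennreal (M * (real (card J) * \<bar>c\<bar> powr p) powr (1 / p))" if "finite J" for c J
    proof -
      have "bergman_norm \<omega> p (h c J) \<le> ennreal (M * (\<Sum>k\<in>e ` J. cmod (of_real c) powr p) powr (1 / p))"
        unfolding h_def using that eX by (intro synthesis_constantD(2)[OF syn]) auto
      also have "(\<Sum>k\<in>e ` J. cmod (of_real c) powr p) = real (card J) * \<bar>c\<bar> powr p"
        using card_image[of e J] e(1) by (simp add: inj_on_subset)
      finally show ?thesis .
    qed
    have hB: "h c J \<in> bergman \<omega> p" if "finite J" for c J
      unfolding h_def by (rule atom_sum_bergman) (use hn[OF that, of c] in \<open>simp add: h_def\<close>)
    define F where "F j = h (1 / M) {j}" for j
    have F_eq: "F j = (\<lambda>z. of_real (1 / M) * atom p \<gamma> (e j) z)" for j by (simp add: F_def h_def)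
    have FB: "F j \<in> bergman \<omega> p" for j unfolding F_def by (rule hB) simp
    have Fn: "bergman_norm \<omega> p (F j) \<le> 1" for j
      using hn[of "{j}" "1 / M"] M p by (simp add: F_def powr_powr)
    obtain s g where s: "strict_mono s" "g \<in> Lq \<upsilon> q" "(\<lambda>j. Lq_norm \<upsilon> q (\<lambda>z. K (F (s j)) z - g z)) \<longlonglongrightarrow> 0"
      using K FB Fn unfolding compact_op_def by blast
    obtain b where b: "0 \<le> b" "op_norm \<omega> p \<upsilon> q K \<le> ennreal b" by (rule compact_op_bounded[OF q1(1) K]) blast
    \<comment> \<open>three uses of the triangle inequality, with its factor 2, add up to \<open>2 (\<delta> + 2 (\<delta> + \<delta>)) = 10 \<delta>\<close>\<close>
    define \<delta> where "\<delta> = \<epsilon> / (10 * M)"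
    have \<delta>: "\<delta> > 0" using \<epsilon> M by (simp add: \<delta>_def)
    have "eventually (\<lambda>j. Lq_norm \<upsilon> q (\<lambda>z. K (F (s j)) z - g z) < ennreal \<delta>) sequentially"
      using order_tendstoD(2)[OF s(3), of "ennreal \<delta>"] \<delta> by simp
    then obtain t where t: "\<And>j. t \<le> j \<Longrightarrow> Lq_norm \<upsilon> q (\<lambda>z. K (F (s j)) z - g z) < ennreal \<delta>"
      by (auto simp: eventually_sequentially)
    have "((\<lambda>N::nat. b * real N powr ((1 - p) / p)) \<longlongrightarrow> b * 0) sequentially"
      using p by (intro tendsto_mult tendsto_const tendsto_neg_powr filterlim_real_sequentially) (simp add: field_simps)
    hence "eventually (\<lambda>N::nat. b * real N powr ((1 - p) / p) < \<delta> \<and> 0 < N) sequentially"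
      using \<delta> by (intro eventually_conj order_tendstoD eventually_gt_at_top) auto
    then obtain N :: nat where N: "b * real N powr ((1 - p) / p) < \<delta>" "0 < N" by (auto dest: eventually_happens)
    define J where "J = {t..<t + N}"
    define G where "G = (\<lambda>z. \<Sum>j\<in>J. of_real (1 / real N) * F (s j) z)"
    have KFL: "K (F j) \<in> Lq \<upsilon> q" for j by (intro linear_op_Lq[OF lin] FB)
    have KFm: "(\<lambda>z. K (F j) z - g z) \<in> borel_measurable \<upsilon>" for j
      using Lq_diff[OF q1(1) KFL s(2)] by (simp add: Lq_def)
    have gm: "g \<in> borel_measurable \<upsilon>" using s(2) by (simp add: Lq_def)
    have G_eq: "G = h (1 / (real N * M)) (s ` J)"
    proof -
      have "inj_on (\<lambda>j. e (s j)) J"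
        using e(1) strict_mono_imp_inj_on[OF s(1)] by (auto simp: inj_on_def)
      thus ?thesis
        unfolding G_def h_def F_eq by (simp add: image_image sum.reindex fun_eq_iff)
    qed
    have GB: "G \<in> bergman \<omega> p" unfolding G_eq by (rule hB) (simp add: J_def)
    have Gn: "bergman_norm \<omega> p G \<le> ennreal (real N powr ((1 - p) / p))"
    proof -
      have "bergman_norm \<omega> p G \<le> ennreal (M * (real (card (s ` J)) * \<bar>1 / (real N * M)\<bar> powr p) powr (1 / p))"
        unfolding G_eq by (rule hn) (simp add: J_def)
      also have "card (s ` J) = N" using strict_mono_imp_inj_on[OF s(1)] by (subst card_image) (auto simp: J_def inj_on_def)
      also have "M * (real N * \<bar>1 / (real N * M)\<bar> powr p) powr (1 / p) = real N powr ((1 - p) / p)"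
      proof -
        have "(real N * \<bar>1 / (real N * M)\<bar> powr p) powr (1 / p) = real N powr (1 / p) * (1 / (real N * M))"
        proof -
          define x where "x = \<bar>1 / (real N * M)\<bar>"
          have "(x powr p) powr (1 / p) = x powr (p * (1 / p))" by (rule powr_powr)
          also have "\<dots> = x" using p by (simp add: x_def)
          also have "x = 1 / (real N * M)" using M by (simp add: x_def)
          finally show ?thesis unfolding x_def by (simp only: powr_mult)
        qed
        moreover have "real N powr ((1 - p) / p) = real N powr (1 / p) * (1 / real N)"
        proof -
          have "(1 - p) / p = 1 / p - 1" using p by (simp add: field_simps)
          thus ?thesis using N(2) by (simp add: powr_diff)
        qed
        ultimately show ?thesis using M by simp
      qed
      finally show ?thesis .
    qed
    have KGL: "K G \<in> Lq \<upsilon> q" by (rule linear_op_Lq[OF lin GB])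
    have KG: "Lq_norm \<upsilon> q (K G) \<le> ennreal \<delta>"
    proof -
      have "Lq_norm \<upsilon> q (K G) \<le> ennreal (real N powr ((1 - p) / p)) * op_norm \<omega> p \<upsilon> q K"
        using N(2) q1 GB Gn linear_op_Lq[OF lin]
        by (intro op_norm_bound linear_op_cmult[OF lin]) (auto simp: Lq_def)
      also have "\<dots> \<le> ennreal (real N powr ((1 - p) / p)) * ennreal b" by (intro mult_left_mono b) auto
      also have "\<dots> = ennreal (b * real N powr ((1 - p) / p))" using b by (simp add: ennreal_mult mult.commute)
      also have "\<dots> \<le> ennreal \<delta>" using N(1) by (intro ennreal_leI) auto
      finally show ?thesis .
    qed
    have KGg: "Lq_norm \<upsilon> q (\<lambda>z. g z - K G z) \<le> ennreal \<delta>"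
    proof -
      define y where "y j = (\<lambda>z. of_real (- 1 / real N) * (K (F (s j)) z - g z))" for j
      have "AE z in \<upsilon>. K G z = (\<Sum>j\<in>J. K (\<lambda>z. of_real (1 / real N) * F (s j) z) z)"
        unfolding G_def
      proof (rule linear_op_sum[OF lin])
        show "finite J" by (simp add: J_def)
      qed (rule bergman_cmult[OF FB])
      moreover have "AE z in \<upsilon>. \<forall>j\<in>J. K (\<lambda>z. of_real (1 / real N) * F (s j) z) z = of_real (1 / real N) * K (F (s j)) z"
      proof (rule AE_finite_allI)
        show "finite J" by (simp add: J_def)
      qed (rule linear_op_cmult[OF lin FB])
      ultimately have "AE z in \<upsilon>. g z - K G z = (\<Sum>j\<in>J. y j z)"
      proof eventually_elim
        case (elim z)
        hence "K G z = (\<Sum>j\<in>J. of_real (1 / real N) * K (F (s j)) z)" by simp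
        moreover have "g z = (\<Sum>j\<in>J. of_real (1 / real N) * g z)" using N(2) by (simp add: J_def)
        ultimately have "g z - K G z = (\<Sum>j\<in>J. of_real (1 / real N) * g z - of_real (1 / real N) * K (F (s j)) z)"
          by (simp only: sum_subtractf)
        also have "\<dots> = (\<Sum>j\<in>J. y j z)" by (intro sum.cong refl) (simp add: y_def algebra_simps)
        finally show ?case .
      qed
      hence "Lq_norm \<upsilon> q (\<lambda>z. g z - K G z) = Lq_norm \<upsilon> q (\<lambda>z. \<Sum>j\<in>J. y j z)" by (rule Lq_norm_cong_AE)
      also have "\<dots> \<le> ennreal \<delta>"
      proof -
        have ym: "y j \<in> borel_measurable \<upsilon>" for j
          unfolding y_def by (intro borel_measurable_times borel_measurable_const KFm)
        have yn: "Lq_power \<upsilon> q (y j) \<le> ennreal ((\<delta> / real N) powr q)" if "j \<in> J" for j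
        proof -
          have "Lq_norm \<upsilon> q (y j) = ennreal (1 / real N) * Lq_norm \<upsilon> q (\<lambda>z. K (F (s j)) z - g z)"
            unfolding y_def by (subst Lq_norm_cmult[OF q1(2) KFm]) (simp add: norm_divide)
          also have "\<dots> \<le> ennreal (1 / real N) * ennreal \<delta>"
            using t[of j] that by (intro mult_left_mono less_imp_le) (auto simp: J_def)
          also have "\<dots> = ennreal (\<delta> / real N)" using \<delta> by (simp flip: ennreal_mult)
          finally show ?thesis using q1 \<delta> by (subst (asm) Lq_norm_le_iff) auto
        qed
        have "Lq_power \<upsilon> q (\<lambda>z. \<Sum>j\<in>J. y j z) \<le> ennreal (real (card J) powr (q - 1)) * (\<Sum>j\<in>J. Lq_power \<upsilon> q (y j))"
          by (intro Lq_power_sum_le q1 ym) (simp add: J_def)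
        also have "\<dots> \<le> ennreal (real (card J) powr (q - 1)) * (\<Sum>j\<in>J. ennreal ((\<delta> / real N) powr q))"
          by (intro mult_left_mono sum_mono yn) auto
        also have "\<dots> = ennreal (real N powr (q - 1) * (real N * (\<delta> / real N) powr q))"
          by (simp add: J_def ennreal_mult ennreal_of_nat_eq_real_of_nat)
        also have "real N powr (q - 1) * (real N * (\<delta> / real N) powr q) = \<delta> powr q"
          using N(2) \<delta> by (simp add: powr_divide powr_diff)
        finally show ?thesis using q1 \<delta> by (subst Lq_norm_le_iff) auto
      qed
      finally show ?thesis .
    qed
    have two: "2 * (ennreal a + ennreal c) = ennreal (2 * (a + c))" if "0 \<le> a" "0 \<le> c" for a c :: real
      using that by (simp add: ennreal_mult ennreal_plus)
    have gn: "Lq_norm \<upsilon> q g \<le> ennreal (2 * (\<delta> + \<delta>))"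
    proof -
      have "Lq_norm \<upsilon> q g = Lq_norm \<upsilon> q (\<lambda>z. (g z - K G z) + K G z)" by simp
      also have "\<dots> \<le> 2 * (Lq_norm \<upsilon> q (\<lambda>z. g z - K G z) + Lq_norm \<upsilon> q (K G))"
        using Lq_diff[OF q1(1) s(2) KGL] KGL by (intro Lq_norm_add_le q1) (auto simp: Lq_def)
      also have "\<dots> \<le> 2 * (ennreal \<delta> + ennreal \<delta>)" by (intro mult_left_mono add_mono KGg KG) auto
      also have "\<dots> = ennreal (2 * (\<delta> + \<delta>))" using \<delta> by (intro two) auto
      finally show ?thesis .
    qed
    have "Lq_norm \<upsilon> q (K (F (s t))) = Lq_norm \<upsilon> q (\<lambda>z. (K (F (s t)) z - g z) + g z)" by simp
    also have "\<dots> \<le> 2 * (Lq_norm \<upsilon> q (\<lambda>z. K (F (s t)) z - g z) + Lq_norm \<upsilon> q g)"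
      by (intro Lq_norm_add_le q1 KFm gm)
    also have "\<dots> \<le> 2 * (ennreal \<delta> + ennreal (2 * (\<delta> + \<delta>)))"
      using t[of t] by (intro mult_left_mono add_mono gn) auto
    also have "\<dots> = ennreal (2 * (\<delta> + 2 * (\<delta> + \<delta>)))" using \<delta> by (intro two) auto
    also have "2 * (\<delta> + 2 * (\<delta> + \<delta>)) = \<epsilon> / M" using M by (simp add: \<delta>_def field_simps)
    finally have up: "Lq_norm \<upsilon> q (K (F (s t))) \<le> ennreal (\<epsilon> / M)" .
    have aB: "atom p \<gamma> (e (s t)) \<in> bergman \<omega> p"
      using hB[of "{s t}" 1] by (simp add: h_def)
    have "Lq_norm \<upsilon> q (K (F (s t))) = Lq_norm \<upsilon> q (\<lambda>z. of_real (1 / M) * K (atom p \<gamma> (e (s t))) z)"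
      unfolding F_eq by (rule Lq_norm_cong_AE[OF linear_op_cmult[OF lin aB]])
    also have "\<dots> = ennreal (1 / M) * Lq_norm \<upsilon> q (K (atom p \<gamma> (e (s t))))"
      using M linear_op_Lq[OF lin aB] by (subst Lq_norm_cmult[OF q1(2)]) (simp_all add: Lq_def norm_divide)
    finally have "ennreal M * (ennreal (1 / M) * Lq_norm \<upsilon> q (K (atom p \<gamma> (e (s t))))) \<le> ennreal M * ennreal (\<epsilon> / M)"
      using up by (intro mult_left_mono) auto
    hence "Lq_norm \<upsilon> q (K (atom p \<gamma> (e (s t)))) \<le> ennreal \<epsilon>"
      using M \<epsilon> by (simp add: mult.assoc[symmetric] flip: ennreal_mult)
    thus False using eX(2)[of "s t"] by simp
  qed
  hence "finite (fst ` X)" by simp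
  then obtain I where I: "\<And>i. i \<in> fst ` X \<Longrightarrow> i < I" by (meson finite_nat_set_iff_bounded)
  show thesis
  proof (rule that[of I])
    fix k assume k: "k \<in> nodes" "I \<le> fst k"
    hence "fst k \<notin> fst ` X" using I[of "fst k"] by linarith
    hence "k \<notin> X" by blast
    thus "Lq_norm \<upsilon> q (K (atom p \<gamma> k)) \<le> ennreal \<epsilon>" using k(1) by (simp add: X_def)
  qed
qed

end

section \<open>The term of lower order in the essential norm\<close>

context bergman_space
begin

lemma derivative_uniform_bound:
  assumes "R < 1"
  obtains B where "0 \<le> B"
    "\<And>f w. f holomorphic_on ball 0 1 \<Longrightarrow> bergman_norm \<omega> p f \<le> 1 \<Longrightarrow> cmod w \<le> R \<Longrightarrow> cmod ((deriv ^^ n) f w) \<le> B"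
proof -
  obtain C where C: "C > 0"
    "\<And>f. f holomorphic_on ball 0 1 \<Longrightarrow> bergman_norm \<omega> p f \<le> 1 \<Longrightarrow> \<exists>d. coefficient_majorant n f C d"
    by (rule derivative_coefficients[of n]) blast
  obtain I where I: "1 / (1 - R) < real \<kappa> ^ I" using real_arch_pow[of "real \<kappa>" "1 / (1 - R)"] kappa by auto
  have RI: "R < 1 - 1 / real \<kappa> ^ I" using I assms kappa by (simp add: field_simps)
  define B where "B = (\<Sum>k\<in>level_nodes 0 I. C powr (1 / p) * (mass k powr (- 1 / p) * real (num (fst k)) ^ n))"
  show thesis
  proof (rule that)
    show "0 \<le> B" unfolding B_def by (intro sum_nonneg) auto
    fix f w assume f: "f holomorphic_on ball 0 1" "bergman_norm \<omega> p f \<le> 1" and w: "cmod w \<le> R"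
    obtain d where "coefficient_majorant n f C d" using C(2)[OF f] by blast
    note d = coefficient_majorantD[OF this]
    have wI: "cmod w < 1 - 1 / real \<kappa> ^ I" using w RI by linarith
    obtain k where k: "k \<in> level_nodes 0 I" "w \<in> cell k"
      using level_nodes_cover[of 0 w I] wI by auto
    have "d k powr p \<le> C" using d(3)[of "{k}"] k(1) level_nodes_subset[of 0 I] by auto
    hence "(d k powr p) powr (1 / p) \<le> C powr (1 / p)" using p by (intro powr_mono2) auto
    hence dk: "d k \<le> C powr (1 / p)" using d(1)[of k] p by (simp add: powr_powr)
    have "cmod ((deriv ^^ n) f w) \<le> d k * (mass k powr (- 1 / p) * real (num (fst k)) ^ n)" by (rule d(2)[OF k(2)])
    also have "\<dots> \<le> C powr (1 / p) * (mass k powr (- 1 / p) * real (num (fst k)) ^ n)" by (intro mult_right_mono dk) auto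
    also have "\<dots> \<le> B" unfolding B_def
      by (rule member_le_sum[OF k(1)]) (auto simp: finite_level_nodes)
    finally show "cmod ((deriv ^^ n) f w) \<le> B" .
  qed
qed

text \<open>
  Montel's theorem is applied to the derivatives \<open>f\<^sup>(\<^sup>n\<^sup>)\<close> of the given sequence, whose limit is then used
  directly to define the limit of the images.
\<close>

lemma truncation_compact:
  assumes q: "1 < q" and \<upsilon>: "borel_measure_on_disc \<upsilon>" and \<phi>: "self_map \<phi>"
    and u: "u holomorphic_on ball 0 1" "u \<in> Lq \<upsilon> q" and R: "R < 1"
  shows "compact_op \<omega> p \<upsilon> q (\<lambda>f z. if cmod (\<phi> z) < R then weighted_comp_diff u \<phi> n f z else 0)"
proof -
  define T :: operator where "T = (\<lambda>f z. if cmod (\<phi> z) < R then weighted_comp_diff u \<phi> n f z else 0)"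
  have sp: "space \<upsilon> = ball 0 1" by (rule space_disc_measure[OF \<upsilon>])
  have q1: "1 \<le> q" "0 < q" using q by auto
  have um: "u \<in> borel_measurable \<upsilon>" and un: "Lq_norm \<upsilon> q u < top" using u by (auto simp: Lq_def)
  have sub: "cball 0 R \<subseteq> ball (0::complex) 1" using R by auto
  have \<phi>_meas: "\<phi> \<in> borel_measurable \<upsilon>"
    using \<phi> unfolding self_map_def by (intro continuous_on_disc_measurable[OF \<upsilon>] holomorphic_on_imp_continuous_on) auto
  have \<phi>b: "\<phi> z \<in> ball 0 1" if "z \<in> ball 0 1" for z using \<phi> that unfolding self_map_def by blast
  have inLq: "(\<lambda>z. if cmod (\<phi> z) < R then u z * h (\<phi> z) else 0) \<in> Lq \<upsilon> q" if h: "h holomorphic_on ball 0 1" for h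
  proof -
    have "compact (h ` cball 0 R)"
      by (intro compact_continuous_image continuous_on_subset[OF holomorphic_on_imp_continuous_on[OF h] sub] compact_cball)
    then obtain B where B: "\<And>w. w \<in> cball 0 R \<Longrightarrow> cmod (h w) \<le> B"
      using compact_imp_bounded bounded_iff by (metis imageI)
    have hm: "(\<lambda>z. h (\<phi> z)) \<in> borel_measurable \<upsilon>"
      by (intro continuous_on_disc_measurable[OF \<upsilon>] continuous_on_compose2[OF holomorphic_on_imp_continuous_on[OF h]] holomorphic_on_imp_continuous_on)
         (use \<phi> in \<open>auto simp: self_map_def\<close>)
    have m: "(\<lambda>z. if cmod (\<phi> z) < R then u z * h (\<phi> z) else 0) \<in> borel_measurable \<upsilon>"
      using \<phi>_meas um hm by measurable
    have "Lq_norm \<upsilon> q (\<lambda>z. if cmod (\<phi> z) < R then u z * h (\<phi> z) else 0) \<le> Lq_norm \<upsilon> q (\<lambda>z. of_real \<bar>B\<bar> * u z)"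
    proof (rule Lq_norm_mono_AE[OF q1(2)], rule AE_I2)
      fix z
      show "cmod (if cmod (\<phi> z) < R then u z * h (\<phi> z) else 0) \<le> cmod (of_real \<bar>B\<bar> * u z)"
      proof (cases "cmod (\<phi> z) < R")
        case True
        hence "cmod (h (\<phi> z)) \<le> \<bar>B\<bar>" using B[of "\<phi> z"] by simp
        hence "cmod (u z) * cmod (h (\<phi> z)) \<le> cmod (u z) * \<bar>B\<bar>" by (rule mult_left_mono) simp
        thus ?thesis using True by (simp add: norm_mult mult.commute)
      qed simp
    qed
    also have "\<dots> < top" using un by (simp add: Lq_norm_cmult[OF q1(2) um] ennreal_mult_less_top)
    finally show ?thesis using m by (simp add: Lq_def)
  qed
  have T_eq: "T f = (\<lambda>z. if cmod (\<phi> z) < R then u z * (deriv ^^ n) f (\<phi> z) else 0)" for f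
    unfolding T_def weighted_comp_diff_def ..
  have hd: "(deriv ^^ n) f holomorphic_on ball 0 1" if "f \<in> bergman \<omega> p" for f
    by (intro holomorphic_higher_deriv bergman_holomorphic that open_ball)
  have lin: "linear_op \<omega> p \<upsilon> q T"
    unfolding linear_op_def
  proof (intro conjI ballI allI impI)
    fix f assume "f \<in> bergman \<omega> p"
    thus "T f \<in> Lq \<upsilon> q" unfolding T_eq by (intro inLq hd)
  next
    fix f g a b assume "f \<in> bergman \<omega> p" "g \<in> bergman \<omega> p"
    thus "AE z in \<upsilon>. T (\<lambda>w. a * f w + b * g w) z = a * T f z + b * T g z"
      by (intro AE_I2) (simp add: T_def sp weighted_comp_diff_lincomb bergman_holomorphic \<phi>)
  next
    fix f g assume fg: "f \<in> bergman \<omega> p" "g \<in> bergman \<omega> p" "\<forall>z\<in>ball 0 1. f z = g z"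
    show "AE z in \<upsilon>. T f z = T g z"
      using weighted_comp_diff_cong_disc[OF bergman_holomorphic[OF fg(1)] bergman_holomorphic[OF fg(2)] \<phi> _ fg(3)]
      by (intro AE_I2) (simp add: T_def sp)
  qed
  have "\<exists>s g. strict_mono s \<and> g \<in> Lq \<upsilon> q \<and> (\<lambda>j. Lq_norm \<upsilon> q (\<lambda>z. T (F (s j)) z - g z)) \<longlonglongrightarrow> 0"
    if F: "\<forall>j. F j \<in> bergman \<omega> p \<and> bergman_norm \<omega> p (F j) \<le> 1" for F :: "nat \<Rightarrow> complex \<Rightarrow> complex"
  proof -
    define D where "D j = (deriv ^^ n) (F j)" for j
    have Fh: "F j holomorphic_on ball 0 1" for j using F bergman_holomorphic by blast
    have Dh: "D j holomorphic_on ball 0 1" for j unfolding D_def using hd F by blast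
    obtain g r where g: "g holomorphic_on ball 0 1" "strict_mono r"
      "\<And>K. compact K \<Longrightarrow> K \<subseteq> ball 0 1 \<Longrightarrow> uniform_limit K (D \<circ> r) g sequentially"
    proof (rule Montel[of "ball 0 1" "range D" D])
      fix K :: "complex set" assume K: "compact K" "K \<subseteq> ball 0 1"
      obtain R' where R': "R' < 1" "K \<subseteq> cball 0 R'"
      proof (cases "K = {}")
        case False
        have "continuous_on K cmod" by (intro continuous_intros)
        from continuous_attains_sup[OF K(1) False this] obtain x where x: "x \<in> K" "\<And>y. y \<in> K \<Longrightarrow> cmod y \<le> cmod x" by blast
        thus thesis using K by (intro that[of "cmod x"]) auto
      qed (use that[of 0] in auto)
      obtain B where B: "\<And>f w. f holomorphic_on ball 0 1 \<Longrightarrow> bergman_norm \<omega> p f \<le> 1 \<Longrightarrow> cmod w \<le> R' \<Longrightarrow> cmod ((deriv ^^ n) f w) \<le> B"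
        by (rule derivative_uniform_bound[OF R'(1), of n]) blast
      have "cmod (D j w) \<le> B" if "w \<in> K" for j w
        unfolding D_def using F R'(2) that by (intro B Fh) auto
      thus "\<exists>B. \<forall>h\<in>range D. \<forall>z\<in>K. norm (h z) \<le> B" by blast
    qed (use Dh in auto)
    define G where "G = (\<lambda>z. if cmod (\<phi> z) < R then u z * g (\<phi> z) else 0)"
    have GL: "G \<in> Lq \<upsilon> q" unfolding G_def by (rule inLq[OF g(1)])
    have lim: "(\<lambda>j. Lq_norm \<upsilon> q (\<lambda>z. T (F (r j)) z - G z)) \<longlonglongrightarrow> 0"
    proof (rule order_tendstoI)
      fix a :: ennreal assume "a < 0" thus "eventually (\<lambda>j. a < Lq_norm \<upsilon> q (\<lambda>z. T (F (r j)) z - G z)) sequentially" by simp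
    next
      fix a :: ennreal assume a: "0 < a"
      obtain l where l: "Lq_norm \<upsilon> q u = ennreal l" "0 \<le> l" using un by (cases "Lq_norm \<upsilon> q u") auto
      obtain a' where a': "0 < a'" "ennreal a' \<le> a"
      proof (cases a)
        case (real x) thus thesis using a by (intro that[of x]) auto
      qed (use that[of 1] in auto)
      define e where "e = a' / (l + 1)"
      have e: "0 < e" using a' l by (simp add: e_def)
      have el: "e * l < a'" using a' l by (simp add: e_def field_simps)
      have "eventually (\<lambda>j. \<forall>x\<in>cball 0 R. dist ((D \<circ> r) j x) (g x) < e) sequentially"
        using g(3)[OF compact_cball sub] e by (rule uniform_limitD)
      thus "eventually (\<lambda>j. Lq_norm \<upsilon> q (\<lambda>z. T (F (r j)) z - G z) < a) sequentially"
      proof eventually_elim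
        case (elim j)
        have "Lq_norm \<upsilon> q (\<lambda>z. T (F (r j)) z - G z) \<le> Lq_norm \<upsilon> q (\<lambda>z. of_real e * u z)"
        proof (rule Lq_norm_mono_AE[OF q1(2)], rule AE_I2)
          fix z
          show "cmod (T (F (r j)) z - G z) \<le> cmod (of_real e * u z)"
          proof (cases "cmod (\<phi> z) < R")
            case True
            hence "cmod (D (r j) (\<phi> z) - g (\<phi> z)) \<le> e" using elim by (auto simp: dist_norm less_imp_le)
            hence "cmod (u z) * cmod (D (r j) (\<phi> z) - g (\<phi> z)) \<le> cmod (u z) * e" by (rule mult_left_mono) simp
            moreover have "T (F (r j)) z - G z = u z * (D (r j) (\<phi> z) - g (\<phi> z))"
              using True by (simp add: T_eq G_def D_def right_diff_distrib)
            ultimately show ?thesis using e by (simp add: norm_mult mult.commute)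
          qed (simp add: T_eq G_def)
        qed
        also have "\<dots> = ennreal (e * l)" using e l by (simp add: Lq_norm_cmult[OF q1(2) um] ennreal_mult)
        also have "\<dots> < ennreal a'" using el e l by (intro ennreal_lessI) (auto simp: a')
        finally show ?case using a'(2) by (rule less_le_trans)
      qed
    qed
    show ?thesis using g(2) GL lim by blast
  qed
  thus ?thesis unfolding compact_op_def T_def[symmetric] using lin by blast
qed

text \<open>
  Let \<open>K\<close> be compact. Up to a compact truncation \<open>A\<close> lives where \<open>\<bar>\<phi>(z)\<bar> \<ge> R\<close>. There the atoms at the nodes concerned
  satisfy \<open>\<parallel>S atom\<parallel> \<le> 2 (\<parallel>(S - K) atom\<parallel> + e)\<close>, and the contributions of the nodes are summed
  using \<open>\<Sum> d\<^sub>k\<^sup>q \<le> (\<Sum> d\<^sub>k\<^sup>p)\<^sup>q\<^sup>/\<^sup>p\<close>.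
\<close>

theorem essential_norm_lower_order_term:
  assumes nm: "n < m" and q: "1 < q" and pq: "p \<le> q"
  obtains C where "C > 0"
    "\<And>\<upsilon> \<phi> \<psi> u v. borel_measure_on_disc \<upsilon> \<Longrightarrow> self_map \<phi> \<Longrightarrow> self_map \<psi> \<Longrightarrow> u holomorphic_on ball 0 1 \<Longrightarrow> v holomorphic_on ball 0 1 \<Longrightarrow> u \<in> Lq \<upsilon> q \<Longrightarrow>
      essential_norm \<omega> p \<upsilon> q (weighted_comp_diff u \<phi> n) \<le> ennreal C * essential_norm \<omega> p \<upsilon> q (two_term u \<phi> n v \<psi> m)"
proof -
  have q1: "1 \<le> q" "0 < q" using q by auto
  obtain \<gamma>0 M where M: "1 \<le> \<gamma>0" "\<And>\<gamma>. \<gamma>0 \<le> \<gamma> \<Longrightarrow> synthesis_constant \<gamma> M"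
    by (rule synthesis_norm) blast
  have syn: "synthesis_constant (\<gamma>0 + j) M" for j by (rule M(2)) simp
  have M0: "M > 0" by (rule synthesis_constantD[OF M(2)[OF order.refl]])
  obtain B where B: "B > 0"
    "\<And>u \<phi> v \<psi> f C d k z. coefficient_majorant n f C d \<Longrightarrow> self_map \<psi> \<Longrightarrow> z \<in> ball 0 1 \<Longrightarrow> \<phi> z \<in> cell k \<Longrightarrow>
       cmod (weighted_comp_diff u \<phi> n f z) powr q \<le>
         B * d k powr q * (\<Sum>j<3. cmod (two_term u \<phi> n v \<psi> m (atom p (\<gamma>0 + j) k) z) powr q)"
    by (rule cell_domination[OF nm M(1) q1(1)]) blast
  obtain Cd where Cd: "Cd > 0"
    "\<And>f. f holomorphic_on ball 0 1 \<Longrightarrow> bergman_norm \<omega> p f \<le> 1 \<Longrightarrow> \<exists>d. coefficient_majorant n f Cd d"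
    by (rule derivative_coefficients[of n]) blast
  define C where "C = (3 * B) powr (1 / q) * Cd powr (1 / p) * (2 * (M + 1))"
  have C: "C > 0" using B M0 Cd by (simp add: C_def)
  have main: "essential_norm \<omega> p \<upsilon> q (weighted_comp_diff u \<phi> n) \<le> ennreal C * essential_norm \<omega> p \<upsilon> q (two_term u \<phi> n v \<psi> m)"
    if \<upsilon>: "borel_measure_on_disc \<upsilon>" and \<phi>: "self_map \<phi>" and \<psi>: "self_map \<psi>"
      and u: "u holomorphic_on ball 0 1" and v: "v holomorphic_on ball 0 1" and uL: "u \<in> Lq \<upsilon> q" for \<upsilon> \<phi> \<psi> u v
  proof -
    define A where "A = weighted_comp_diff u \<phi> n"
    define S where "S = two_term u \<phi> n v \<psi> m"
    have A_meas: "A f \<in> borel_measurable \<upsilon>" if "f holomorphic_on ball 0 1" for f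
      unfolding A_def by (intro weighted_comp_diff_measurable \<upsilon> \<phi> u that)
    have S_meas: "S f \<in> borel_measurable \<upsilon>" if "f holomorphic_on ball 0 1" for f
      unfolding S_def by (intro two_term_measurable \<upsilon> \<phi> \<psi> u v that)
    have S_hom: "AE z in \<upsilon>. S (\<lambda>w. a * f w) z = a * S f z" if "f \<in> bergman \<omega> p" for f a
      unfolding S_def by (intro two_term_cmult \<upsilon> \<phi> \<psi> bergman_holomorphic that)
    have \<phi>_meas: "\<phi> \<in> borel_measurable \<upsilon>"
      using \<phi> unfolding self_map_def by (intro continuous_on_disc_measurable[OF \<upsilon>] holomorphic_on_imp_continuous_on) auto
    have "essential_norm \<omega> p \<upsilon> q A \<le> ennreal C * (op_norm \<omega> p \<upsilon> q (\<lambda>f z. S f z - K f z) + ennreal e)"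
      if K: "compact_op \<omega> p \<upsilon> q K" and e: "0 < e" for K :: operator and e
    proof -
      have lin: "linear_op \<omega> p \<upsilon> q K" using K by (simp add: compact_op_def)
      define T where "T = (\<lambda>f z. S f z - K f z)"
      have K_meas: "K f \<in> borel_measurable \<upsilon>" if "f \<in> bergman \<omega> p" for f
        using linear_op_Lq[OF lin that] by (simp add: Lq_def)
      have T_meas: "T f \<in> borel_measurable \<upsilon>" if "f \<in> bergman \<omega> p" for f
        unfolding T_def by (intro borel_measurable_diff S_meas K_meas bergman_holomorphic that)
      have T_hom: "AE z in \<upsilon>. T (\<lambda>w. a * f w) z = a * T f z" if "f \<in> bergman \<omega> p" for f a
        using S_hom[OF that, of a] linear_op_cmult[OF lin that, of a]
        by eventually_elim (simp add: T_def right_diff_distrib)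
      show ?thesis
      proof (cases "op_norm \<omega> p \<upsilon> q T")
        case top
        thus ?thesis using C unfolding T_def by (simp add: ennreal_mult_top)
      next
        case (real s)
        have van: "\<exists>I. \<forall>k\<in>nodes. I \<le> fst k \<longrightarrow> Lq_norm \<upsilon> q (K (atom p (\<gamma>0 + j) k)) \<le> ennreal e" for j
        proof -
          obtain I where "\<And>k. k \<in> nodes \<Longrightarrow> I \<le> fst k \<Longrightarrow> Lq_norm \<upsilon> q (K (atom p (\<gamma>0 + j) k)) \<le> ennreal e"
            using compact_op_atoms_vanish[OF q K syn e] by blast
          thus ?thesis by blast
        qed
        then obtain I' where I': "\<And>j k. k \<in> nodes \<Longrightarrow> I' j \<le> fst k \<Longrightarrow> Lq_norm \<upsilon> q (K (atom p (\<gamma>0 + j) k)) \<le> ennreal e"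
          by metis
        define I0 where "I0 = Max (I' ` {..<3})"
        have I0: "I' j \<le> I0" if "j < 3" for j unfolding I0_def using that by (intro Max_ge) auto
        define R where "R = 1 - 1 / real \<kappa> ^ I0"
        have R: "R < 1" using kappa by (simp add: R_def)
        note aN = atom_bergman(1)[OF syn] and aB = atom_bergman(2)[OF syn]
        have Sa: "Lq_power \<upsilon> q (S (atom p (\<gamma>0 + j) k)) \<le> ennreal ((2 * (M * s + e)) powr q)"
          if k: "k \<in> nodes" "I0 \<le> fst k" and j: "j < 3" for j k
        proof -
          have "Lq_norm \<upsilon> q (T (atom p (\<gamma>0 + j) k)) \<le> ennreal M * op_norm \<omega> p \<upsilon> q T"
            by (intro op_norm_bound T_hom T_meas aB k aN M0 q1)
          also have "\<dots> = ennreal (M * s)" using M0 real by (simp add: ennreal_mult)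
          finally have t: "Lq_norm \<upsilon> q (T (atom p (\<gamma>0 + j) k)) \<le> ennreal (M * s)" .
          have "Lq_norm \<upsilon> q (S (atom p (\<gamma>0 + j) k)) = Lq_norm \<upsilon> q (\<lambda>z. T (atom p (\<gamma>0 + j) k) z + K (atom p (\<gamma>0 + j) k) z)"
            by (simp add: T_def)
          also have "\<dots> \<le> 2 * (Lq_norm \<upsilon> q (T (atom p (\<gamma>0 + j) k)) + Lq_norm \<upsilon> q (K (atom p (\<gamma>0 + j) k)))"
            by (intro Lq_norm_add_le q1 T_meas K_meas aB k)
          also have "\<dots> \<le> 2 * (ennreal (M * s) + ennreal e)"
            using I0[OF j] k by (intro mult_left_mono add_mono t I') auto
          also have "\<dots> = ennreal (2 * (M * s + e))"
            using M0 real e by (simp add: ennreal_mult ennreal_plus)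
          finally show ?thesis using M0 real e q1 by (subst (asm) Lq_norm_le_iff) auto
        qed
        define E where "E = (\<lambda>f z. A f z - (if cmod (\<phi> z) < R then A f z else 0))"
        have E_eq: "E f z = (if cmod (\<phi> z) < R then 0 else A f z)" for f z by (simp add: E_def)
        have "Lq_norm \<upsilon> q (E f) \<le> ennreal (C * (s + e))" if f: "f \<in> bergman \<omega> p" "bergman_norm \<omega> p f \<le> 1" for f
        proof -
          have fh: "f holomorphic_on ball 0 1" by (rule bergman_holomorphic[OF f(1)])
          have E_meas: "E f \<in> borel_measurable \<upsilon>"
            unfolding E_eq[abs_def] using \<phi>_meas A_meas[OF fh] by measurable
          obtain d where dm: "coefficient_majorant n f Cd d" using Cd(2)[OF fh f(2)] by blast
          note d = coefficient_majorantD[OF dm]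
          have bound: "(\<integral>\<^sup>+z. ennreal (cmod (E f z) powr q) * indicator {z. cmod (\<phi> z) < 1 - 1 / real \<kappa> ^ I} z \<partial>\<upsilon>) \<le> ennreal ((C * (s + e)) powr q)" for I
          proof -
            define L where "L = level_nodes I0 I"
            have L: "finite L" "L \<subseteq> nodes" by (simp_all add: L_def finite_level_nodes level_nodes_subset)
            define Y where "Y = (2 * (M * s + e)) powr q"
            have pw: "ennreal (cmod (E f z) powr q) * indicator {z. cmod (\<phi> z) < 1 - 1 / real \<kappa> ^ I} z
               \<le> (\<Sum>k\<in>L. ennreal (B * d k powr q) * (\<Sum>j<3. ennreal (cmod (S (atom p (\<gamma>0 + j) k) z) powr q)))" if z: "z \<in> ball 0 1" for z
            proof (cases "R \<le> cmod (\<phi> z) \<and> cmod (\<phi> z) < 1 - 1 / real \<kappa> ^ I")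
              case False thus ?thesis by (auto simp: E_eq split: split_indicator)
            next
              case True
              obtain k where k: "k \<in> L" "\<phi> z \<in> cell k"
                using level_nodes_cover[of I0 "\<phi> z" I] True unfolding L_def R_def by auto
              have "cmod (E f z) powr q \<le> B * d k powr q * (\<Sum>j<3. cmod (S (atom p (\<gamma>0 + j) k) z) powr q)"
                using B(2)[where z = z and \<phi> = \<phi> and u = u and v = v, OF dm \<psi> z k(2)] True by (simp add: E_eq A_def S_def)
              hence "ennreal (cmod (E f z) powr q) \<le> ennreal \<dots>" by (rule ennreal_leI)
              also have "\<dots> = ennreal (B * d k powr q) * (\<Sum>j<3. ennreal (cmod (S (atom p (\<gamma>0 + j) k) z) powr q))"
                using B by (subst ennreal_mult) (auto simp: sum_nonneg)
              also have "\<dots> \<le> (\<Sum>k\<in>L. ennreal (B * d k powr q) * (\<Sum>j<3. ennreal (cmod (S (atom p (\<gamma>0 + j) k) z) powr q)))"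
                by (rule member_le_sum[OF k(1)]) (auto simp: L)
              finally show ?thesis using True by simp
            qed
            have SFm: "(\<lambda>z. ennreal (cmod (S (atom p (\<gamma>0 + j) k) z) powr q)) \<in> borel_measurable \<upsilon>" for j k
            proof -
              note [measurable] = S_meas[OF atom_holomorphic[of p "\<gamma>0 + j" k]]
              show ?thesis by measurable
            qed
            have "(\<integral>\<^sup>+z. ennreal (cmod (E f z) powr q) * indicator {z. cmod (\<phi> z) < 1 - 1 / real \<kappa> ^ I} z \<partial>\<upsilon>)
              \<le> (\<integral>\<^sup>+z. (\<Sum>k\<in>L. ennreal (B * d k powr q) * (\<Sum>j<3. ennreal (cmod (S (atom p (\<gamma>0 + j) k) z) powr q))) \<partial>\<upsilon>)"
              by (intro nn_integral_mono pw) (simp add: space_disc_measure[OF \<upsilon>])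
            also have "\<dots> = (\<Sum>k\<in>L. \<integral>\<^sup>+z. ennreal (B * d k powr q) * (\<Sum>j<3. ennreal (cmod (S (atom p (\<gamma>0 + j) k) z) powr q)) \<partial>\<upsilon>)"
            proof (rule nn_integral_sum)
              note [measurable] = SFm
              show "(\<lambda>z. ennreal (B * d k powr q) * (\<Sum>j<3. ennreal (cmod (S (atom p (\<gamma>0 + j) k) z) powr q))) \<in> borel_measurable \<upsilon>" for k
                by measurable
            qed
            also have "\<dots> = (\<Sum>k\<in>L. ennreal (B * d k powr q) * (\<integral>\<^sup>+z. (\<Sum>j<3. ennreal (cmod (S (atom p (\<gamma>0 + j) k) z) powr q)) \<partial>\<upsilon>))"
              by (intro sum.cong refl nn_integral_cmult borel_measurable_sum SFm)
            also have "\<dots> = (\<Sum>k\<in>L. ennreal (B * d k powr q) * (\<Sum>j<3. Lq_power \<upsilon> q (S (atom p (\<gamma>0 + j) k))))"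
              unfolding Lq_power_def by (intro sum.cong refl arg_cong2[where f = "(*)"] nn_integral_sum SFm)
            also have "\<dots> \<le> (\<Sum>k\<in>L. ennreal (B * d k powr q) * (\<Sum>j<(3::nat). ennreal Y))"
              unfolding Y_def using L(2) by (intro sum_mono mult_left_mono Sa) (auto simp: L_def level_nodes_def)
            also have "\<dots> = (\<Sum>k\<in>L. ennreal (B * d k powr q * (3 * Y)))"
            proof (intro sum.cong refl)
              fix k
              have "(\<Sum>j<(3::nat). ennreal Y) = ennreal (3 * Y)" by (simp add: Y_def ennreal_mult)
              thus "ennreal (B * d k powr q) * (\<Sum>j<(3::nat). ennreal Y) = ennreal (B * d k powr q * (3 * Y))"
                using B by (simp add: ennreal_mult Y_def)
            qed
            also have "\<dots> = ennreal (\<Sum>k\<in>L. B * d k powr q * (3 * Y))"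
              using B by (intro sum_ennreal) (auto simp: Y_def)
            also have "(\<Sum>k\<in>L. B * d k powr q * (3 * Y)) = 3 * B * Y * (\<Sum>k\<in>L. d k powr q)"
              by (simp add: sum_distrib_left mult_ac)
            also have "(\<Sum>k\<in>L. d k powr q) \<le> Cd powr (q / p)"
            proof -
              have "(\<Sum>k\<in>L. d k powr q) \<le> (\<Sum>k\<in>L. Cd powr ((q - p) / p) * d k powr p)"
              proof (rule sum_mono)
                fix k assume k: "k \<in> L"
                have "d k powr p \<le> Cd" using d(3)[of "{k}"] k L by auto
                hence "(d k powr p) powr ((q - p) / p) \<le> Cd powr ((q - p) / p)" using pq p by (intro powr_mono2) auto
                also have "(d k powr p) powr ((q - p) / p) = d k powr (p * ((q - p) / p))" by (rule powr_powr)
                also have "p * ((q - p) / p) = q - p" using p by simp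
                finally have "d k powr (q - p) * d k powr p \<le> Cd powr ((q - p) / p) * d k powr p" by (rule mult_right_mono) simp
                thus "d k powr q \<le> Cd powr ((q - p) / p) * d k powr p" by (simp flip: powr_add)
              qed
              also have "\<dots> = Cd powr ((q - p) / p) * (\<Sum>k\<in>L. d k powr p)" by (simp add: sum_distrib_left)
              also have "\<dots> \<le> Cd powr ((q - p) / p) * Cd" by (intro mult_left_mono d(3) L) auto
              also have "\<dots> = Cd powr (q / p)"
              proof -
                have "(q - p) / p = q / p - 1" using p by (simp add: field_simps)
                thus ?thesis using Cd(1) by (simp add: powr_diff)
              qed
              finally show ?thesis .
            qed
            hence "ennreal (3 * B * Y * (\<Sum>k\<in>L. d k powr q)) \<le> ennreal (3 * B * Y * Cd powr (q / p))"
              using B by (intro ennreal_leI mult_left_mono) (auto simp: Y_def)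
            also have "3 * B * Y * Cd powr (q / p) \<le> (C * (s + e)) powr q"
            proof -
              have "M * s + e \<le> (M + 1) * (s + e)"
                using M0 real e by (simp add: algebra_simps)
              hence "Y \<le> (2 * ((M + 1) * (s + e))) powr q"
                unfolding Y_def using M0 real e q by (intro powr_mono2) auto
              hence "3 * B * Y * Cd powr (q / p) \<le> 3 * B * (2 * ((M + 1) * (s + e))) powr q * Cd powr (q / p)"
                using B by (intro mult_right_mono mult_left_mono) auto
              also have "\<dots> = ((3 * B) powr (1 / q)) powr q * (2 * ((M + 1) * (s + e))) powr q * (Cd powr (1 / p)) powr q"
                using B q1 by (simp add: powr_powr)
              also have "\<dots> = (C * (s + e)) powr q"
                unfolding powr_mult[symmetric] C_def by (simp only: mult_ac)
              finally show ?thesis .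
            qed
            hence "ennreal (3 * B * Y * Cd powr (q / p)) \<le> ennreal ((C * (s + e)) powr q)" by (rule ennreal_leI)
            finally show ?thesis .
          qed
          have "Lq_power \<upsilon> q (E f) \<le> ennreal ((C * (s + e)) powr q)"
            by (rule Lq_power_exhaustion[OF \<upsilon> \<phi> E_meas bound])
          thus ?thesis using q1 C real e by (subst Lq_norm_le_iff) auto
        qed
        hence "op_norm \<omega> p \<upsilon> q E \<le> ennreal (C * (s + e))" unfolding op_norm_def by (intro SUP_least) auto
        moreover have "essential_norm \<omega> p \<upsilon> q A \<le> op_norm \<omega> p \<upsilon> q E"
          unfolding essential_norm_def E_def
        proof (rule INF_lower2)
          show "(\<lambda>f z. if cmod (\<phi> z) < R then A f z else 0) \<in> {K. compact_op \<omega> p \<upsilon> q K}"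
            using truncation_compact[OF q \<upsilon> \<phi> u uL R, of n] unfolding A_def by simp
        qed simp
        moreover have "ennreal (C * (s + e)) = ennreal C * (op_norm \<omega> p \<upsilon> q T + ennreal e)"
          using C real e by (simp add: ennreal_mult ennreal_plus)
        ultimately show ?thesis by (simp add: T_def)
      qed
    qed
    hence "essential_norm \<omega> p \<upsilon> q A \<le> ennreal C * (INF K\<in>{K. compact_op \<omega> p \<upsilon> q K}. op_norm \<omega> p \<upsilon> q (\<lambda>f z. S f z - K f z))"
      by (intro ennreal_le_INF_eps C) auto
    thus ?thesis by (simp add: essential_norm_def[of _ _ _ _ S, symmetric] A_def S_def[symmetric])
  qed
  from C main show thesis by (rule that)
qed

text \<open>
  Apply the operator to \<open>w\<^sup>n\<close>: its \<open>n\<close>-th derivative is constant and its \<open>m\<close>-th derivative vanishes.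
\<close>

lemma lower_symbol_Lq:
  assumes nm: "n < m" and q: "0 < q" and \<upsilon>: "borel_measure_on_disc \<upsilon>"
    and S: "linear_op \<omega> p \<upsilon> q (two_term u \<phi> n v \<psi> m)"
  shows "u \<in> Lq \<upsilon> q"
proof -
  define f where "f = (\<lambda>w::complex. (w - 0) ^ n)"
  have "f \<in> bergman \<omega> p"
    unfolding f_def by (rule bergman_bounded) (auto intro!: holomorphic_intros simp: norm_power power_le_one)
  hence "two_term u \<phi> n v \<psi> m f \<in> Lq \<upsilon> q"
    by (rule linear_op_Lq[OF S])
  moreover have "(deriv ^^ n) f w = fact n" for w
    unfolding f_def higher_deriv_power by (simp add: pochhammer_fact)
  moreover have "(deriv ^^ m) f w = 0" for w
    unfolding f_def higher_deriv_power using nm by (simp add: pochhammer_0_left)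
  ultimately have "(\<lambda>z. u z * fact n) \<in> Lq \<upsilon> q" by (simp add: two_term_def[abs_def] weighted_comp_diff_def)
  from Lq_cmult[OF q this, of "1 / fact n"] show ?thesis by simp
qed

end

lemma comparableI:
  assumes "C \<ge> 1" "Y \<le> ennreal C * X" "X \<le> ennreal C * Y"
  shows "comparable C X Y"
proof -
  have "ennreal (inverse C) * Y \<le> ennreal (inverse C) * (ennreal C * X)" using assms by (intro mult_left_mono) auto
  also have "\<dots> = X" using assms(1) by (simp add: mult.assoc[symmetric] flip: ennreal_mult)
  finally show ?thesis using assms by (simp add: comparable_def)
qed

lemma sum_le_of_quasi_triangle:
  fixes a b s :: ennreal
  assumes "a \<le> ennreal C * s" "b \<le> 2 * (s + a)" "0 \<le> C"
  shows "a + b \<le> ennreal (3 * C + 2) * s"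
proof -
  have "a + b \<le> ennreal C * s + 2 * (s + ennreal C * s)"
    by (rule order.trans[OF add_mono[OF assms(1,2)]]) (intro add_left_mono mult_left_mono assms(1), simp)
  also have "\<dots> = (ennreal C + 2 + 2 * ennreal C) * s" by (simp add: distrib_left distrib_right mult.assoc add.assoc)
  also have "ennreal C + 2 + 2 * ennreal C = ennreal (3 * C + 2)"
  proof -
    have "ennreal (3 * C + 2) = ennreal (C + 2 + 2 * C)" by (simp add: algebra_simps)
    also have "\<dots> = ennreal C + ennreal 2 + ennreal 2 * ennreal C" using assms(3) by (simp only: ennreal_plus ennreal_mult add_nonneg_nonneg mult_nonneg_nonneg zero_le_numeral)
    finally show ?thesis by simp
  qed
  finally show ?thesis .
qed

text \<open>
  The bound for the term of order \<open>m\<close> is that for \<open>B = S - A\<close>. The constant arises from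
  \<open>\<parallel>A\<parallel> \<le> C1 \<parallel>S\<parallel>\<close> and \<open>\<parallel>B\<parallel> \<le> 2 (\<parallel>S\<parallel> + \<parallel>A\<parallel>)\<close>.
\<close>

theorem theorem1:
  fixes p q :: real and n m :: nat and \<omega> :: "real \<Rightarrow> real"
  assumes "1 < p" and "1 < q" and "n < m" and "two_sided_doubling \<omega>"
  shows "\<exists>C\<ge>1. \<forall>\<upsilon> \<phi> \<psi> u\<^sub>n u\<^sub>m.
    borel_measure_on_disc \<upsilon> \<longrightarrow> self_map \<phi> \<longrightarrow> self_map \<psi> \<longrightarrow>
    u\<^sub>n holomorphic_on ball 0 1 \<longrightarrow> u\<^sub>m holomorphic_on ball 0 1 \<longrightarrow>
    (let A = weighted_comp_diff u\<^sub>n \<phi> n;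
         B = weighted_comp_diff u\<^sub>m \<psi> m;
         S = (\<lambda>f z. A f z + B f z)
     in comparable C (op_norm \<omega> p \<upsilon> q S) (op_norm \<omega> p \<upsilon> q A + op_norm \<omega> p \<upsilon> q B) \<and>
        (p \<le> q \<and> bounded_op \<omega> p \<upsilon> q S \<longrightarrow>
           comparable C (essential_norm \<omega> p \<upsilon> q S)
             (essential_norm \<omega> p \<upsilon> q A + essential_norm \<omega> p \<upsilon> q B)))"
proof -
  obtain \<mu> \<kappa> V \<sigma> D c where dw: "disc_weight \<mu> \<kappa> V \<sigma> D c"
    and bn: "\<And>p f. f holomorphic_on ball 0 1 \<Longrightarrow> bergman_norm \<omega> p f = ennreal_power (disc_power_integral \<mu> p f) (1 / p)"
    by (rule disc_weight_exists[OF assms(4)]) blast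
  interpret disc_weight \<mu> \<kappa> V \<sigma> D c by (rule dw)
  interpret bergman_space \<mu> \<kappa> V \<sigma> D c \<omega> p by unfold_locales (use assms(1) bn in auto)
  have q1: "1 \<le> q" "0 < q" using assms(2) by auto
  obtain C1 where C1: "C1 > 0"
    "\<And>\<upsilon> \<phi> \<psi> u v. borel_measure_on_disc \<upsilon> \<Longrightarrow> self_map \<phi> \<Longrightarrow> self_map \<psi> \<Longrightarrow> u holomorphic_on ball 0 1 \<Longrightarrow> v holomorphic_on ball 0 1 \<Longrightarrow>
      op_norm \<omega> p \<upsilon> q (weighted_comp_diff u \<phi> n) \<le> ennreal C1 * op_norm \<omega> p \<upsilon> q (two_term u \<phi> n v \<psi> m)"
    by (rule op_norm_lower_order_term[OF assms(3,2)]) blast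
  obtain C2 where C2: "C2 > 0"
    "\<And>\<upsilon> \<phi> \<psi> u v. p \<le> q \<Longrightarrow> borel_measure_on_disc \<upsilon> \<Longrightarrow> self_map \<phi> \<Longrightarrow> self_map \<psi> \<Longrightarrow> u holomorphic_on ball 0 1 \<Longrightarrow> v holomorphic_on ball 0 1 \<Longrightarrow> u \<in> Lq \<upsilon> q \<Longrightarrow>
      essential_norm \<omega> p \<upsilon> q (weighted_comp_diff u \<phi> n) \<le> ennreal C2 * essential_norm \<omega> p \<upsilon> q (two_term u \<phi> n v \<psi> m)"
  proof (cases "p \<le> q")
    case True
    show thesis by (rule essential_norm_lower_order_term[OF assms(3,2) True]) (rule that)
  qed (use that[of 1] in auto)
  define C where "C = 3 * max C1 C2 + 2"
  have C: "1 \<le> C" "2 \<le> C" "3 * C1 + 2 \<le> C" "3 * C2 + 2 \<le> C" using C1(1) by (auto simp: C_def)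
  have le2: "2 * y \<le> ennreal C * y" for y :: ennreal
    using ennreal_leI[OF C(2)] by (intro mult_right_mono) auto
  show ?thesis
  proof (intro exI[of _ C] conjI C(1) allI impI)
    fix \<upsilon> \<phi> \<psi> u v
    assume \<upsilon>: "borel_measure_on_disc \<upsilon>" and \<phi>: "self_map \<phi>" and \<psi>: "self_map \<psi>"
      and u: "u holomorphic_on ball 0 1" and v: "v holomorphic_on ball 0 1"
    define A where "A = weighted_comp_diff u \<phi> n"
    define B where "B = weighted_comp_diff v \<psi> m"
    define S where "S = (\<lambda>f z. A f z + B f z)"
    have mA: "A f \<in> borel_measurable \<upsilon>" and mB: "B f \<in> borel_measurable \<upsilon>" if "f \<in> bergman \<omega> p" for f
      unfolding A_def B_def by (intro weighted_comp_diff_measurable \<upsilon> \<phi> \<psi> u v bergman_holomorphic that)+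
    have mS: "S f \<in> borel_measurable \<upsilon>" if "f \<in> bergman \<omega> p" for f
      unfolding S_def by (intro borel_measurable_add mA mB that)
    have S2: "S = two_term u \<phi> n v \<psi> m" by (simp add: S_def A_def B_def two_term_def fun_eq_iff)
    have S1: "S = (\<lambda>f z. A f z + 1 * B f z)" by (simp add: S_def)
    have B1: "B = (\<lambda>f z. S f z + (-1) * A f z)" by (simp add: S_def fun_eq_iff)
    have "comparable C (op_norm \<omega> p \<upsilon> q S) (op_norm \<omega> p \<upsilon> q A + op_norm \<omega> p \<upsilon> q B)"
    proof (rule comparableI[OF C(1)])
      have "op_norm \<omega> p \<upsilon> q A \<le> ennreal C1 * op_norm \<omega> p \<upsilon> q S"
        unfolding A_def S2 by (rule C1(2)[OF \<upsilon> \<phi> \<psi> u v])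
      moreover have "op_norm \<omega> p \<upsilon> q B \<le> 2 * (op_norm \<omega> p \<upsilon> q S + op_norm \<omega> p \<upsilon> q A)"
        by (subst B1) (intro op_norm_add_le q1 mS mA, auto)
      ultimately have "op_norm \<omega> p \<upsilon> q A + op_norm \<omega> p \<upsilon> q B \<le> ennreal (3 * C1 + 2) * op_norm \<omega> p \<upsilon> q S"
        using C1(1) by (intro sum_le_of_quasi_triangle) auto
      also have "\<dots> \<le> ennreal C * op_norm \<omega> p \<upsilon> q S" by (intro mult_right_mono ennreal_leI C) auto
      finally show "op_norm \<omega> p \<upsilon> q A + op_norm \<omega> p \<upsilon> q B \<le> ennreal C * op_norm \<omega> p \<upsilon> q S" .
      have "op_norm \<omega> p \<upsilon> q S \<le> 2 * (op_norm \<omega> p \<upsilon> q A + op_norm \<omega> p \<upsilon> q B)"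
        by (subst S1) (intro op_norm_add_le q1 mA mB, auto)
      thus "op_norm \<omega> p \<upsilon> q S \<le> ennreal C * (op_norm \<omega> p \<upsilon> q A + op_norm \<omega> p \<upsilon> q B)" using le2 order.trans by blast
    qed
    moreover have "comparable C (essential_norm \<omega> p \<upsilon> q S) (essential_norm \<omega> p \<upsilon> q A + essential_norm \<omega> p \<upsilon> q B)"
      if pq: "p \<le> q" and bdd: "bounded_op \<omega> p \<upsilon> q S"
    proof (rule comparableI[OF C(1)])
      have "linear_op \<omega> p \<upsilon> q S" using bdd by (simp add: bounded_op_def)
      hence uL: "u \<in> Lq \<upsilon> q"
        unfolding S2 by (rule lower_symbol_Lq[OF assms(3) q1(2) \<upsilon>])
      have "essential_norm \<omega> p \<upsilon> q A \<le> ennreal C2 * essential_norm \<omega> p \<upsilon> q S"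
        unfolding A_def S2 by (rule C2(2)[OF pq \<upsilon> \<phi> \<psi> u v uL])
      moreover have "essential_norm \<omega> p \<upsilon> q B \<le> 2 * (essential_norm \<omega> p \<upsilon> q S + essential_norm \<omega> p \<upsilon> q A)"
        by (subst B1) (intro essential_norm_add_le q1 mS mA, auto)
      ultimately have "essential_norm \<omega> p \<upsilon> q A + essential_norm \<omega> p \<upsilon> q B \<le> ennreal (3 * C2 + 2) * essential_norm \<omega> p \<upsilon> q S"
        using C2(1) by (intro sum_le_of_quasi_triangle) auto
      also have "\<dots> \<le> ennreal C * essential_norm \<omega> p \<upsilon> q S" by (intro mult_right_mono ennreal_leI C) auto
      finally show "essential_norm \<omega> p \<upsilon> q A + essential_norm \<omega> p \<upsilon> q B \<le> ennreal C * essential_norm \<omega> p \<upsilon> q S" .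
      have "essential_norm \<omega> p \<upsilon> q S \<le> 2 * (essential_norm \<omega> p \<upsilon> q A + essential_norm \<omega> p \<upsilon> q B)"
        by (subst S1) (intro essential_norm_add_le q1 mA mB, auto)
      thus "essential_norm \<omega> p \<upsilon> q S \<le> ennreal C * (essential_norm \<omega> p \<upsilon> q A + essential_norm \<omega> p \<upsilon> q B)" using le2 order.trans by blast
    qed
    ultimately show "let A = weighted_comp_diff u \<phi> n; B = weighted_comp_diff v \<psi> m; S = (\<lambda>f z. A f z + B f z)
     in comparable C (op_norm \<omega> p \<upsilon> q S) (op_norm \<omega> p \<upsilon> q A + op_norm \<omega> p \<upsilon> q B) \<and>
        (p \<le> q \<and> bounded_op \<omega> p \<upsilon> q S \<longrightarrow>
           comparable C (essential_norm \<omega> p \<upsilon> q S) (essential_norm \<omega> p \<upsilon> q A + essential_norm \<omega> p \<upsilon> q B))"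
      unfolding Let_def A_def[symmetric] B_def[symmetric] S_def[symmetric] by blast
  qed
qed

end
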